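(* Let $s\in(0,1)$ and $p\in(1,+\infty)$. Assume $u\in C^2_b(\mathbb R^n)$ and $x_0\in\mathbb R^n$. If $p\in(1,\frac{2}{2-s})$ assume additionally that $\nabla u(x_0)\neq 0$. Then $$(-\Delta)_p^s u(x_0)=C_4(n,s,p)\int_0^\infty \Delta(t-\Delta)^{-1}\big[\Phi_p(u(x_0)-u(\cdot))\big](x_0)\,\frac{dt}{t^{1-\frac{sp}{2}}},$$ where $$C_4(n,s,p)=\frac{\pi^{\frac n2}}{2^{sp}\,\Gamma\left(\frac{2+sp}{2}\right)\Gamma\left(\frac{n+sp}{2}\right)}\,C_1(n,s,p).$$
   Context: $C^2_b(\mathbb R^n)$ is the space of $C^2$ functions $\mathbb R^n\to\mathbb R$ that are bounded together with their derivatives up to order two. $\Phi_p(t)=|t|^{p-2}t$ (with $\Phi_p(0)=0$). The fractional $p$-Laplacian is defined pointwise by $$(-\Delta)_p^s u(x)=C_1(n,s,p)\,\mathrm{P.V.}\int_{\mathbb R^n}\frac{\Phi_p(u(x)-u(y))}{|x-y|^{n+sp}}\,dy,\qquad \mathrm{P.V.}\int_{\mathbb R^n}=\lim_{\varepsilon\to0^+}\int_{|x-y|>\varepsilon},$$ where $C_1(n,s,p)>0$ is a fixed constant. For $t>0$ and $f$ bounded and continuous, the operator $\Delta(t-\Delta)^{-1}$ is given pointwise by $$\Delta(t-\Delta)^{-1}[f](x)=(R_t*f)(x)-f(x),\qquad R_t(x)=t\int_0^\infty e^{-t\tau}\frac{1}{(4\pi\tau)^{n/2}}e^{-\frac{|x|^2}{4\tau}}\,d\tau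 .$$ In the formula, $\Delta(t-\Delta)^{-1}$ acts on the function $y\mapsto\Phi_p(u(x_0)-u(y))$ and the result is evaluated at $x_0$.
   Formalization: If p = 2/(2−s) and ∇u(x₀) = 0, the principal value can diverge (e.g. u = |x−x₀|² near x₀); there the identity is stated as: the truncated principal values and C₄ times the integral over (0,T] have the same limit in [−∞,∞], if any. *)

theory Defs
  imports "HOL-Analysis.Analysis"
begin

definition gradient :: "(real^'n \<Rightarrow> real) \<Rightarrow> real^'n \<Rightarrow> real^'n" where
  "gradient u x = (THE D. GDERIV u x :> D)"

definition C2b :: "(real^'n \<Rightarrow> real) set" where
  "C2b = {u. \<exists>(g :: real^'n \<Rightarrow> real^'n) (H :: real^'n \<Rightarrow> real^'n^'n).
     (\<forall>x. GDERIV u x :> g x) \<and>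
     (\<forall>x. (g has_derivative (\<lambda>h. H x *v h)) (at x)) \<and>
     continuous_on UNIV H \<and>
     bounded (range u) \<and> bounded (range g) \<and> bounded (range H)}"

definition Phi :: "real \<Rightarrow> real \<Rightarrow> real" where
  "Phi p t = \<bar>t\<bar> powr (p - 2) * t"

definition frac_p_laplacian_trunc ::
  "real \<Rightarrow> real \<Rightarrow> real \<Rightarrow> (real^'n \<Rightarrow> real) \<Rightarrow> real^'n \<Rightarrow> real \<Rightarrow> real" where
  "frac_p_laplacian_trunc C1 s p u x \<epsilon> =
     C1 * (LINT y:{y. \<epsilon> < norm (x - y)}|lborel.
             Phi p (u x - u y) / norm (x - y) powr (real CARD('n) + s * p))"

text \<open>The principal value. It is only meaningful when the truncations converge to a real number;
  the convergence has to be stated separately.\<close>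

definition frac_p_laplacian ::
  "real \<Rightarrow> real \<Rightarrow> real \<Rightarrow> (real^'n \<Rightarrow> real) \<Rightarrow> real^'n \<Rightarrow> real" where
  "frac_p_laplacian C1 s p u x = Lim (at_right 0) (frac_p_laplacian_trunc C1 s p u x)"

text \<open>At \<open>z = 0\<close> the integral below diverges in dimension at least 2 and Isabelle assigns it
  the value 0. This is a null set, so the convolution is not affected.\<close>

definition resolvent_kernel :: "real \<Rightarrow> real^'n \<Rightarrow> real" where
  "resolvent_kernel t z =
     t * (LINT \<tau>:{0<..}|lborel.
            exp (- t * \<tau>) * (1 / (4 * pi * \<tau>) powr (real CARD('n) / 2))
              * exp (- (norm z)\<^sup>2 / (4 * \<tau>)))"

definition laplacian_resolvent :: "real \<Rightarrow> (real^'n \<Rightarrow> real) \<Rightarrow> real^'n \<Rightarrow> real" where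
  "laplacian_resolvent t f x = (LINT y|lborel. resolvent_kernel t (x - y) * f y) - f x"

definition balakrishnan_integrand ::
  "real \<Rightarrow> real \<Rightarrow> (real^'n \<Rightarrow> real) \<Rightarrow> real^'n \<Rightarrow> real \<Rightarrow> real" where
  "balakrishnan_integrand s p u x t =
     laplacian_resolvent t (\<lambda>y. Phi p (u x - u y)) x / t powr (1 - s * p / 2)"

definition C4 :: "real \<Rightarrow> nat \<Rightarrow> real \<Rightarrow> real \<Rightarrow> real" where
  "C4 C1 n s p =
     pi powr (real n / 2)
       / (2 powr (s * p) * Gamma ((2 + s * p) / 2) * Gamma ((real n + s * p) / 2)) * C1"

end

(* Write R_t(z) = t^(n/2) r(sqrt t |z|) for the resolvent kernel. The Mellin transform of the profile r is a
   product of two Gamma values; hence kappa(x) = 2 x^(n+sp) r(x) / c is a probability density for dx/x, where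
   C_4 = C_1 / c, and averaging over t turns R_t(z) into the weight |z|^(-n-sp). With the symmetrised increment
   of Phi_p(u(x0) - u(x0 - z)) times this weight called H, the truncated principal value is the integral of H
   over |z| > eps, and the truncated t-integral is the integral of H(z) K(sqrt T |z|), K being the distribution
   function of kappa. If H is integrable, the claim follows from Fubini's theorem and dominated convergence;
   this covers every case except p = 2/(2-s) with vanishing gradient. There H(z) = O(|z|^(-n)), and the Taylor
   expansion at x0 shows that the two truncated integrals (with eps = T^(-1/2)) differ asymptotically by a
   constant. As the second is a kappa-average of the first, a finite limit of either one forces this constant
   to be zero. *)

theory Submission
  imports Defs
begin

section \<open>Haar measure of the multiplicative group of positive reals\<close>

text \<open>Dilating a radius translates its logarithm. Radial integrals are therefore taken against
  dx/x, for which every Mellin transform is a plain integral. Integrability of H at the origin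
  dictates the case split. Phi_p is odd, so the symmetrised increment is half a difference of Phi_p
  at two points that both equal e . z + O(|z|^2), e being the gradient. This gives O(|z|^p) for p >=
  2 and O(|z|^(2(p-1))) for p < 2; the latter is integrable against the weight only if 2(p-1) > sp,
  that is p > 2/(2-s). For p < 2 and e nonzero there is the finer bound |e . z|^(p-2) |z|^2, of
  degree p > sp and integrable on shells because p - 2 > -1. In the remaining case, returning from
  averaged to truncated integrals is a Tauberian question. Averaging alone does not settle it; the
  constant asymptotic difference does. An infinite limit absorbs that constant, hence the extended
  reals.\<close>

definition haar :: "real measure" where
  "haar = density lborel (\<lambda>x. ennreal (indicator {0<..} x / x))"

lemma sets_haar [simp, measurable_cong]: "sets haar = sets borel"
  by (simp add: haar_def)

lemma space_haar [simp]: "space haar = UNIV"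
  by (simp add: haar_def)

lemma nn_integral_haar:
  assumes [measurable]: "f \<in> borel_measurable borel"
  shows "(\<integral>\<^sup>+x. f x \<partial>haar) = (\<integral>\<^sup>+x. ennreal (indicator {0<..} x / x) * f x \<partial>lborel)"
  unfolding haar_def by (rule nn_integral_density) auto

interpretation haar: sigma_finite_measure haar
  unfolding haar_def
  by (subst sigma_finite_measure.sigma_finite_iff_density_finite[OF sigma_finite_lborel]) auto

lemma AE_haar_pos: "AE x in haar. 0 < x"
  unfolding haar_def by (subst AE_density) (auto split: split_indicator)

lemma haar_neq: "AE x in haar. x \<noteq> c"
  unfolding haar_def by (subst AE_density) (auto intro: AE_mp[OF AE_lborel_singleton[of c]])

text \<open>Substitution x = exp y on compact intervals, then monotone convergence. As exp carries
  Lebesgue measure to dx/x, scalings and powers of x become translations and dilations of y in the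
  lemmas below.\<close>

lemma nn_integral_haar_exp:
  assumes [measurable]: "f \<in> borel_measurable borel"
  shows "(\<integral>\<^sup>+x. f x \<partial>haar) = (\<integral>\<^sup>+y. f (exp y) \<partial>lborel)"
proof -
  define F where "F x = ennreal (indicator {0<..} x / x) * f x" for x :: real
  have [measurable]: "F \<in> borel_measurable borel"
    unfolding F_def by measurable
  \<comment> \<open>\<open>Suc k\<close> rather than \<open>k\<close> keeps the intervals
    nondegenerate even at k = 0.\<close>
  have sub: "(\<integral>\<^sup>+x. F x * indicator {exp (- real (Suc k))..exp (real (Suc k))} x \<partial>lborel)
      = (\<integral>\<^sup>+y. f (exp y) * indicator {- real (Suc k)..real (Suc k)} y \<partial>lborel)" for k :: nat
  proof -
    have "(\<integral>\<^sup>+x. F x * indicator {exp (- real (Suc k))..exp (real (Suc k))} x \<partial>lborel)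
      = (\<integral>\<^sup>+y. F (exp y) * ennreal (exp y) * indicator {- real (Suc k)..real (Suc k)} y \<partial>lborel)"
      by (rule nn_integral_substitution_aux) (auto intro!: derivative_eq_intros continuous_intros)
    also have "\<dots> = (\<integral>\<^sup>+y. f (exp y) * indicator {- real (Suc k)..real (Suc k)} y \<partial>lborel)"
    proof (intro nn_integral_cong)
      fix y :: real
      have "ennreal (1 / exp y) * f (exp y) * ennreal (exp y) = f (exp y) * ennreal (1 / exp y * exp y)"
        by (simp only: ennreal_mult' mult_ac exp_ge_zero)
      then show "F (exp y) * ennreal (exp y) * indicator {- real (Suc k)..real (Suc k)} y
          = f (exp y) * indicator {- real (Suc k)..real (Suc k)} y"
        by (simp add: F_def)
    qed
    finally show ?thesis .
  qed
  have "incseq (\<lambda>k x. F x * indicator {exp (- real (Suc k))..exp (real (Suc k))} x)"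
    unfolding incseq_def le_fun_def
  proof (intro allI impI mult_left_mono)
    fix m n :: nat and x :: real
    assume "m \<le> n"
    then have "{exp (- real (Suc m))..exp (real (Suc m))} \<subseteq> {exp (- real (Suc n))..exp (real (Suc n))}"
      by (auto intro: order_trans[of "exp _"] order_trans[of _ "exp _"])
    then show "indicator {exp (- real (Suc m))..exp (real (Suc m))} x
        \<le> (indicator {exp (- real (Suc n))..exp (real (Suc n))} x :: ennreal)"
      by (intro indicator_leI) blast
  qed simp
  then have 1: "(\<integral>\<^sup>+x. (SUP k. F x * indicator {exp (- real (Suc k))..exp (real (Suc k))} x) \<partial>lborel)
      = (SUP k. \<integral>\<^sup>+x. F x * indicator {exp (- real (Suc k))..exp (real (Suc k))} x \<partial>lborel)"
    by (rule nn_integral_monotone_convergence_SUP) auto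
  have "incseq (\<lambda>k y. f (exp y) * indicator {- real (Suc k)..real (Suc k)} y)"
    unfolding incseq_def le_fun_def
    by (intro allI impI mult_left_mono) (auto split: split_indicator)
  then have 2: "(\<integral>\<^sup>+y. (SUP k. f (exp y) * indicator {- real (Suc k)..real (Suc k)} y) \<partial>lborel)
      = (SUP k. \<integral>\<^sup>+y. f (exp y) * indicator {- real (Suc k)..real (Suc k)} y \<partial>lborel)"
    by (rule nn_integral_monotone_convergence_SUP) auto
  have s1: "(SUP k. F x * indicator {exp (- real (Suc k))..exp (real (Suc k))} x) = F x" for x :: real
  proof (cases "0 < x")
    case True
    obtain k :: nat where k: "\<bar>ln x\<bar> \<le> real k"
      using real_arch_simple by blast
    have "x = exp (ln x)" using True by simp
    moreover have "- real (Suc k) \<le> ln x" "ln x \<le> real (Suc k)" using k by auto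
    ultimately have "x \<in> {exp (- real (Suc k))..exp (real (Suc k))}"
      by (metis atLeastAtMost_iff exp_le_cancel_iff)
    then have "F x \<le> F x * indicator {exp (- real (Suc k))..exp (real (Suc k))} x" by simp
    also have "\<dots> \<le> (SUP k. F x * indicator {exp (- real (Suc k))..exp (real (Suc k))} x)"
      by (rule SUP_upper) simp
    finally show ?thesis
      by (intro antisym SUP_least) (auto split: split_indicator)
  next
    case False
    then have "F x = 0" by (simp add: F_def)
    then show ?thesis by simp
  qed
  have s2: "(SUP k. f (exp y) * indicator {- real (Suc k)..real (Suc k)} y) = f (exp y)" for y :: real
  proof -
    obtain k :: nat where k: "\<bar>y\<bar> \<le> real k"
      using real_arch_simple by blast
    then have "f (exp y) \<le> f (exp y) * indicator {- real (Suc k)..real (Suc k)} y"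
      by (auto split: split_indicator)
    also have "\<dots> \<le> (SUP k. f (exp y) * indicator {- real (Suc k)..real (Suc k)} y)"
      by (rule SUP_upper) simp
    finally show ?thesis
      by (intro antisym SUP_least) (auto split: split_indicator)
  qed
  show ?thesis
    using 1 2 unfolding sub s1 s2 by (simp add: nn_integral_haar F_def)
qed

text \<open>The image-measure form transfers Bochner integrals, with integrability, from Lebesgue
  measure without a second approximation argument.\<close>

lemma haar_eq_distr: "haar = distr lborel borel exp"
proof (rule measure_eqI)
  fix A assume A: "A \<in> sets haar"
  then have [measurable]: "A \<in> sets borel" by simp
  have "emeasure haar A = (\<integral>\<^sup>+x. indicator A x \<partial>haar)"
    using A by simp
  also have "\<dots> = (\<integral>\<^sup>+y. indicator A (exp y) \<partial>lborel)"
    by (rule nn_integral_haar_exp) auto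
  also have "\<dots> = emeasure (distr lborel borel exp) A"
    using nn_integral_distr[of exp lborel borel "indicator A"] by simp
  finally show "emeasure haar A = emeasure (distr lborel borel exp) A" .
qed simp

lemma nn_integral_haar_mult:
  assumes [measurable]: "f \<in> borel_measurable borel" and c: "0 < c"
  shows "(\<integral>\<^sup>+x. f (c * x) \<partial>haar) = (\<integral>\<^sup>+x. f x \<partial>haar)"
proof -
  have "(\<integral>\<^sup>+x. f x \<partial>haar) = (\<integral>\<^sup>+y. f (exp y) \<partial>lborel)"
    by (rule nn_integral_haar_exp) auto
  also have "\<dots> = (\<integral>\<^sup>+y. f (exp (ln c + 1 * y)) \<partial>lborel)"
    by (subst nn_integral_real_affine[where c=1 and t="ln c"]) auto
  also have "\<dots> = (\<integral>\<^sup>+x. f (c * x) \<partial>haar)"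
    using c by (subst nn_integral_haar_exp) (auto simp: exp_add)
  finally show ?thesis ..
qed

lemma nn_integral_haar_powr:
  assumes [measurable]: "f \<in> borel_measurable borel" and a: "a \<noteq> 0"
  shows "(\<integral>\<^sup>+x. f x \<partial>haar) = ennreal \<bar>a\<bar> * (\<integral>\<^sup>+x. f (x powr a) \<partial>haar)"
proof -
  have "(\<integral>\<^sup>+x. f x \<partial>haar) = (\<integral>\<^sup>+y. f (exp y) \<partial>lborel)"
    by (rule nn_integral_haar_exp) auto
  also have "\<dots> = ennreal \<bar>a\<bar> * (\<integral>\<^sup>+y. f (exp (0 + a * y)) \<partial>lborel)"
    using a by (subst nn_integral_real_affine[where c=a and t=0]) auto
  also have "\<dots> = ennreal \<bar>a\<bar> * (\<integral>\<^sup>+x. f (x powr a) \<partial>haar)"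
    by (subst nn_integral_haar_exp) (auto simp: powr_def mult_ac)
  finally show ?thesis .
qed

lemma nn_integral_haar_divide:
  assumes [measurable]: "f \<in> borel_measurable borel" and c: "0 < c"
  shows "(\<integral>\<^sup>+x. f (c / x) \<partial>haar) = (\<integral>\<^sup>+x. f x \<partial>haar)"
proof -
  have "(\<integral>\<^sup>+x. f x \<partial>haar) = (\<integral>\<^sup>+x. f (c * x) \<partial>haar)"
    using c by (simp add: nn_integral_haar_mult)
  also have "\<dots> = ennreal \<bar>-1\<bar> * (\<integral>\<^sup>+x. f (c * (x powr -1)) \<partial>haar)"
    by (rule nn_integral_haar_powr) auto
  also have "\<dots> = (\<integral>\<^sup>+x. f (c / x) \<partial>haar)"
    using AE_haar_pos by (simp, intro nn_integral_cong_AE) (auto simp: powr_minus divide_inverse)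
  finally show ?thesis ..
qed

lemma integral_haar_mult:
  fixes f :: "real \<Rightarrow> real"
  assumes [measurable]: "f \<in> borel_measurable borel" and c: "0 < c"
  shows "(\<integral>x. f (c * x) \<partial>haar) = (\<integral>x. f x \<partial>haar)"
    and "integrable haar (\<lambda>x. f (c * x)) \<longleftrightarrow> integrable haar f"
proof -
  have "haar = distr haar borel (\<lambda>x. c * x)"
  proof (rule measure_eqI)
    fix A assume A: "A \<in> sets haar"
    then have [measurable]: "A \<in> sets borel" by simp
    have "emeasure haar A = (\<integral>\<^sup>+x. indicator A x \<partial>haar)"
      using A by simp
    also have "\<dots> = (\<integral>\<^sup>+x. indicator A (c * x) \<partial>haar)"
      using c by (simp add: nn_integral_haar_mult)
    also have "\<dots> = emeasure (distr haar borel (\<lambda>x. c * x)) A"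
      using nn_integral_distr[of "\<lambda>x. c * x" haar borel "indicator A"] by simp
    finally show "emeasure haar A = emeasure (distr haar borel (\<lambda>x. c * x)) A" .
  qed simp
  then show "(\<integral>x. f (c * x) \<partial>haar) = (\<integral>x. f x \<partial>haar)"
    and "integrable haar (\<lambda>x. f (c * x)) \<longleftrightarrow> integrable haar f"
    using integral_distr[of "\<lambda>x. c * x" haar borel f] integrable_distr_eq[of "\<lambda>x. c * x" haar borel f]
    by simp_all
qed

lemma nn_integral_haar_Gamma:
  assumes "0 < b"
  shows "(\<integral>\<^sup>+x. ennreal (x powr b * exp (- x)) \<partial>haar) = ennreal (Gamma b)"
proof -
  have "(\<integral>\<^sup>+x. ennreal (x powr b * exp (- x)) \<partial>haar)
      = (\<integral>\<^sup>+x. ennreal (indicator {0<..} x / x) * ennreal (x powr b * exp (- x)) \<partial>lborel)"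
    by (rule nn_integral_haar) auto
  also have "\<dots> = (\<integral>\<^sup>+x. ennreal (indicator {0..} x * x powr (b - 1) / exp x) \<partial>lborel)"
  proof (rule nn_integral_cong_AE)
    show "AE x in lborel. ennreal (indicator {0<..} x / x) * ennreal (x powr b * exp (- x))
      = ennreal (indicator {0..} x * x powr (b - 1) / exp x)"
      using AE_lborel_singleton[of "0::real"]
      by eventually_elim
        (auto simp: ennreal_mult[symmetric] powr_diff exp_minus divide_inverse split: split_indicator)
  qed
  also have "\<dots> = ennreal (Gamma b)"
    using Gamma_conv_nn_integral_real[OF assms] by simp
  finally show ?thesis .
qed

text \<open>On x <= R the factor exp (R - x) is at least 1, so the Gamma integral dominates. The
  counterpart at infinity follows by inversion.\<close>

lemma nn_integral_haar_powr_atMost: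
  assumes "0 < a" "0 < R"
  shows "(\<integral>\<^sup>+x. ennreal (x powr a) * indicator {..R} x \<partial>haar) < \<infinity>"
proof -
  have "(\<integral>\<^sup>+x. ennreal (x powr a) * indicator {..R} x \<partial>haar)
      \<le> (\<integral>\<^sup>+x. ennreal (exp R) * ennreal (x powr a * exp (- x)) \<partial>haar)"
  proof (intro nn_integral_mono)
    fix x :: real
    have "x powr a \<le> exp R * (x powr a * exp (- x))" if "x \<le> R"
    proof -
      have "x powr a * 1 \<le> x powr a * exp (R - x)"
        using that by (intro mult_left_mono) auto
      then show ?thesis by (simp add: exp_diff exp_minus field_simps)
    qed
    then show "ennreal (x powr a) * indicator {..R} x \<le> ennreal (exp R) * ennreal (x powr a * exp (- x))"
      by (auto simp: ennreal_mult[symmetric] split: split_indicator intro!: ennreal_leI)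
  qed
  also have "\<dots> = ennreal (exp R) * ennreal (Gamma a)"
    using assms by (subst nn_integral_cmult) (auto simp: nn_integral_haar_Gamma)
  also have "\<dots> < \<infinity>" by (simp add: ennreal_mult_less_top)
  finally show ?thesis .
qed

lemma nn_integral_haar_powr_atLeast:
  assumes "a < 0" "0 < R"
  shows "(\<integral>\<^sup>+x. ennreal (x powr a) * indicator {R..} x \<partial>haar) < \<infinity>"
proof -
  have "(\<integral>\<^sup>+x. ennreal (x powr a) * indicator {R..} x \<partial>haar)
    = (\<integral>\<^sup>+x. ennreal ((1 / x) powr a) * indicator {R..} (1 / x) \<partial>haar)"
    by (rule nn_integral_haar_divide[symmetric]) auto
  also have "\<dots> \<le> (\<integral>\<^sup>+x. ennreal (x powr (- a)) * indicator {..1/R} x \<partial>haar)"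
  proof (rule nn_integral_mono_AE)
    show "AE x in haar. ennreal ((1 / x) powr a) * indicator {R..} (1 / x)
        \<le> ennreal (x powr (- a)) * indicator {..1/R} x"
      using AE_haar_pos
      by eventually_elim
         (use assms in \<open>auto simp: powr_divide powr_minus field_simps split: split_indicator\<close>)
  qed
  also have "\<dots> < \<infinity>"
    using assms by (intro nn_integral_haar_powr_atMost) auto
  finally show ?thesis .
qed

lemma integral_haar_exp:
  fixes f :: "real \<Rightarrow> real"
  assumes [measurable]: "f \<in> borel_measurable borel"
  shows "(\<integral>x. f x \<partial>haar) = (\<integral>y. f (exp y) \<partial>lborel)"
    and "integrable haar f \<longleftrightarrow> integrable lborel (\<lambda>y. f (exp y))"
  unfolding haar_eq_distr by (auto simp: integral_distr integrable_distr_eq)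

lemma integral_haar_powr:
  fixes f :: "real \<Rightarrow> real"
  assumes [measurable]: "f \<in> borel_measurable borel" and a: "a \<noteq> 0"
  shows "(\<integral>x. f x \<partial>haar) = \<bar>a\<bar> * (\<integral>x. f (x powr a) \<partial>haar)"
    and "integrable haar f \<longleftrightarrow> integrable haar (\<lambda>x. f (x powr a))"
proof -
  have e: "exp y powr a = exp (0 + a * y)" for y by (simp add: powr_def)
  show "(\<integral>x. f x \<partial>haar) = \<bar>a\<bar> * (\<integral>x. f (x powr a) \<partial>haar)"
    using lborel_integral_real_affine[OF a, of "\<lambda>y. f (exp y)" 0]
    by (simp add: integral_haar_exp e)
  show "integrable haar f \<longleftrightarrow> integrable haar (\<lambda>x. f (x powr a))"
    using lborel_integrable_real_affine_iff[OF a, of "\<lambda>y. f (exp y)" 0]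
    by (simp add: integral_haar_exp e)
qed

lemma integral_haar:
  fixes f :: "real \<Rightarrow> real"
  assumes [measurable]: "f \<in> borel_measurable borel"
  shows "(\<integral>x. f x \<partial>haar) = (\<integral>x. indicator {0<..} x / x * f x \<partial>lborel)"
    and "integrable haar f \<longleftrightarrow> integrable lborel (\<lambda>x. indicator {0<..} x / x * f x)"
  unfolding haar_def
  by (subst integral_density integrable_density; auto split: split_indicator)+

section \<open>Homogeneous weights on Euclidean space\<close>

lemma nn_integral_lborel_affine:
  fixes f :: "'a::euclidean_space \<Rightarrow> ennreal"
  assumes [measurable]: "f \<in> borel_measurable borel" and c: "c \<noteq> 0"
  shows "(\<integral>\<^sup>+x. f x \<partial>lborel) = ennreal (\<bar>c\<bar> ^ DIM('a)) * (\<integral>\<^sup>+x. f (t + c *\<^sub>R x) \<partial>lborel)"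
  by (subst lborel_affine[OF c, of t])
     (simp add: nn_integral_density nn_integral_distr nn_integral_cmult ennreal_power)

lemma lborel_reflect: "distr lborel borel (\<lambda>x. t - x) = (lborel :: 'a::euclidean_space measure)"
  by (subst (2) lborel_affine[of "-1" t]) (auto simp: density_1)

lemma integral_lborel_reflect:
  fixes f :: "'a::euclidean_space \<Rightarrow> real"
  assumes [measurable]: "f \<in> borel_measurable borel"
  shows "(\<integral>x. f (t - x) \<partial>lborel) = (\<integral>x. f x \<partial>lborel)"
  by (subst lborel_reflect[of t, symmetric], subst integral_distr) auto

lemma integrable_lborel_reflect:
  fixes f :: "'a::euclidean_space \<Rightarrow> real"
  assumes "integrable lborel f"
  shows "integrable lborel (\<lambda>x. f (t - x))"
proof -
  have [measurable]: "f \<in> borel_measurable borel"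
    using assms by (simp add: borel_measurable_integrable)
  have "integrable (distr lborel borel (\<lambda>x. t - x)) f"
    using assms by (simp add: lborel_reflect)
  then show ?thesis
    by (subst (asm) integrable_distr_eq) auto
qed

lemma integral_lborel_scale:
  fixes f :: "'a::euclidean_space \<Rightarrow> real"
  assumes [measurable]: "f \<in> borel_measurable borel" and c: "0 < c"
  shows "(\<integral>x. f x \<partial>lborel) = (\<integral>x. f (c *\<^sub>R x) * c ^ DIM('a) \<partial>lborel)"
  using c by (subst lborel_affine[of c 0])
     (auto simp: integral_density integral_distr mult_ac)

lemma haar_lborel_Fubini:
  fixes f :: "real \<Rightarrow> 'a::euclidean_space \<Rightarrow> ennreal"
  assumes "case_prod f \<in> borel_measurable (borel \<Otimes>\<^sub>M borel)"
  shows "(\<integral>\<^sup>+z. (\<integral>\<^sup>+r. f r z \<partial>haar) \<partial>lborel) = (\<integral>\<^sup>+r. (\<integral>\<^sup>+z. f r z \<partial>lborel) \<partial>haar)"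
proof -
  interpret pair_sigma_finite haar "lborel :: 'a measure" ..
  show ?thesis
    by (rule Fubini') (use assms in \<open>simp cong: measurable_cong_sets sets_pair_measure_cong\<close>)
qed

lemma haar_lborel_Fubini_integral:
  fixes f :: "real \<Rightarrow> 'a::euclidean_space \<Rightarrow> real"
  assumes m: "case_prod f \<in> borel_measurable (borel \<Otimes>\<^sub>M borel)"
    and fin: "(\<integral>\<^sup>+z. (\<integral>\<^sup>+r. ennreal \<bar>f r z\<bar> \<partial>haar) \<partial>lborel) < \<infinity>"
  shows "integrable haar (\<lambda>r. \<integral>z. f r z \<partial>lborel)"
    and "(\<integral>r. (\<integral>z. f r z \<partial>lborel) \<partial>haar) = (\<integral>z. (\<integral>r. f r z \<partial>haar) \<partial>lborel)"
proof -
  interpret pair_sigma_finite haar "lborel :: 'a measure" ..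
  have m' [measurable]: "case_prod f \<in> borel_measurable (haar \<Otimes>\<^sub>M lborel)"
    using m by (simp cong: measurable_cong_sets sets_pair_measure_cong)
  have "integrable (haar \<Otimes>\<^sub>M lborel) (case_prod f)"
  proof (rule integrableI_bounded[OF m'])
    have "(\<integral>\<^sup>+x. ennreal (norm (case x of (r, z) \<Rightarrow> f r z)) \<partial>(haar \<Otimes>\<^sub>M lborel))
       = (\<integral>\<^sup>+z. (\<integral>\<^sup>+r. ennreal \<bar>f r z\<bar> \<partial>haar) \<partial>lborel)"
      by (subst nn_integral_snd[symmetric]) auto
    then show "(\<integral>\<^sup>+x. ennreal (norm (case x of (r, z) \<Rightarrow> f r z)) \<partial>(haar \<Otimes>\<^sub>M lborel)) < \<infinity>"
      using fin by simp
  qed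
  then show "integrable haar (\<lambda>r. \<integral>z. f r z \<partial>lborel)"
    and "(\<integral>r. (\<integral>z. f r z \<partial>lborel) \<partial>haar) = (\<integral>z. (\<integral>r. f r z \<partial>haar) \<partial>lborel)"
    by (auto dest: integrable_fst simp: Fubini_integral)
qed

lemma AE_lborel_nonzero: "AE z in (lborel :: 'a::euclidean_space measure). z \<noteq> 0"
  by (rule AE_lborel_singleton)

text \<open>The shell has the same multiplicative mass ln 2 as seen from every nonzero point; this
  normalises the averaging over scalings.\<close>

lemma nn_integral_haar_shell:
  assumes "0 < R"
  shows "(\<integral>\<^sup>+r. indicator {1<..<2} (r * R) \<partial>haar) = ennreal (ln 2)"
proof -
  have "(\<integral>\<^sup>+r. indicator {1<..<2} (r * R) \<partial>haar) = (\<integral>\<^sup>+r. indicator {1<..<2::real} r \<partial>haar)"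
    using nn_integral_haar_mult[of "indicator {1<..<2}" R] assms by (simp add: mult.commute)
  also have "\<dots> = (\<integral>\<^sup>+y. indicator {1<..<2::real} (exp y) \<partial>lborel)"
    by (rule nn_integral_haar_exp) auto
  also have "\<dots> = (\<integral>\<^sup>+y. indicator {0<..<ln 2} (y::real) \<partial>lborel)"
  proof (intro nn_integral_cong)
    fix y :: real
    have "exp y < 2 \<longleftrightarrow> y < ln 2"
      using exp_less_cancel_iff[of y "ln 2"] by simp
    then show "indicator {1<..<2::real} (exp y) = (indicator {0<..<ln 2} y :: ennreal)"
      by (auto split: split_indicator)
  qed
  also have "\<dots> = ennreal (ln 2)" by simp
  finally show ?thesis .
qed

text \<open>Polar coordinates without a surface measure: the radial variable is produced by averaging the
  cut-off \<open>1 < \<lambda> \<parallel>z\<parallel> < 2\<close> over all scalings \<open>\<lambda>\<close>.\<close>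

lemma nn_integral_homogeneous:
  fixes Q :: "'a::euclidean_space \<Rightarrow> real" and \<phi> :: "real \<Rightarrow> ennreal" and b :: real
  assumes [measurable]: "Q \<in> borel_measurable borel" "\<phi> \<in> borel_measurable borel"
    and Q0: "\<And>z. 0 \<le> Q z"
    and hom: "\<And>l z. 0 < l \<Longrightarrow> Q (l *\<^sub>R z) = l powr b * Q z"
  shows "ennreal (ln 2) * (\<integral>\<^sup>+z. Q z * \<phi> (norm z) \<partial>lborel)
    = (\<integral>\<^sup>+w. ennreal (Q w * norm w powr (- b - DIM('a))) * indicator {1<..<2} (norm w) \<partial>lborel)
       * (\<integral>\<^sup>+r. ennreal (r powr (b + DIM('a))) * \<phi> r \<partial>haar)"
proof -
  let ?n = "real DIM('a)"
  have [measurable]: "(indicator {1<..<2::real} :: real \<Rightarrow> ennreal) \<in> borel_measurable borel" by auto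
  have "ennreal (ln 2) * (\<integral>\<^sup>+z. Q z * \<phi> (norm z) \<partial>lborel)
      = (\<integral>\<^sup>+z. (\<integral>\<^sup>+l. Q z * \<phi> (norm z) * indicator {1<..<2} (l * norm z) \<partial>haar) \<partial>lborel)"
    (is "_ = ?R")
  proof -
    have "?R = (\<integral>\<^sup>+z. Q z * \<phi> (norm z) * ennreal (ln 2) \<partial>(lborel :: 'a measure))"
    proof (rule nn_integral_cong_AE)
      show "AE z::'a in lborel. (\<integral>\<^sup>+l. Q z * \<phi> (norm z) * indicator {1<..<2} (l * norm z) \<partial>haar)
          = Q z * \<phi> (norm z) * ennreal (ln 2)"
        using AE_lborel_nonzero
        by eventually_elim (simp add: nn_integral_cmult nn_integral_haar_shell)
    qed
    also have "\<dots> = (\<integral>\<^sup>+z. Q z * \<phi> (norm z) \<partial>(lborel :: 'a measure)) * ennreal (ln 2)"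
      by (rule nn_integral_multc) measurable
    finally show ?thesis by (simp add: mult.commute)
  qed
  also have "\<dots> = (\<integral>\<^sup>+l. (\<integral>\<^sup>+z. Q z * \<phi> (norm z) * indicator {1<..<2} (l * norm z) \<partial>lborel) \<partial>haar)"
    by (rule haar_lborel_Fubini) measurable
  \<comment> \<open>Put z = w / l: the Jacobian gives l^(-n) and homogeneity gives l^(-b).\<close>
  also have "\<dots> = (\<integral>\<^sup>+l. (\<integral>\<^sup>+w. ennreal (Q w) * indicator {1<..<2} (norm w)
       * (ennreal (l powr (- b - ?n)) * \<phi> (norm w / l)) \<partial>lborel) \<partial>haar)"
  proof (rule nn_integral_cong_AE)
    show "AE l in haar. (\<integral>\<^sup>+z. Q z * \<phi> (norm z) * indicator {1<..<2} (l * norm z) \<partial>lborel)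
      = (\<integral>\<^sup>+w. ennreal (Q w) * indicator {1<..<2} (norm w) * (ennreal (l powr (- b - ?n)) * \<phi> (norm w / l)) \<partial>lborel)"
      using AE_haar_pos
    proof eventually_elim
      case (elim l)
      have "(\<integral>\<^sup>+z. Q z * \<phi> (norm z) * indicator {1<..<2} (l * norm z) \<partial>lborel)
        = ennreal (\<bar>1/l\<bar> ^ DIM('a)) * (\<integral>\<^sup>+w. Q (0 + (1/l) *\<^sub>R w) * \<phi> (norm (0 + (1/l) *\<^sub>R w))
             * indicator {1<..<2} (l * norm (0 + (1/l) *\<^sub>R w)) \<partial>(lborel::'a measure))"
        using elim by (intro nn_integral_lborel_affine) auto
      also have "\<dots> = (\<integral>\<^sup>+w. ennreal (\<bar>1/l\<bar> ^ DIM('a)) * (Q (0 + (1/l) *\<^sub>R w) * \<phi> (norm (0 + (1/l) *\<^sub>R w))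
             * indicator {1<..<2} (l * norm (0 + (1/l) *\<^sub>R w))) \<partial>(lborel::'a measure))"
        by (subst nn_integral_cmult) auto
      also have "\<dots> = (\<integral>\<^sup>+w. ennreal (Q w) * indicator {1<..<2} (norm w) * (ennreal (l powr (- b - ?n)) * \<phi> (norm w / l)) \<partial>lborel)"
      proof (intro nn_integral_cong)
        fix w :: 'a
        have e: "\<bar>1/l\<bar> ^ DIM('a) * (1/l) powr b = l powr (- b - ?n)"
          using elim by (simp add: powr_realpow[symmetric] powr_divide powr_diff powr_minus field_simps)
        have q: "Q ((1/l) *\<^sub>R w) = (1/l) powr b * Q w"
          using elim by (intro hom) auto
        have "ennreal (\<bar>1/l\<bar> ^ DIM('a)) * ennreal ((1/l) powr b * Q w) = ennreal (Q w) * ennreal (l powr (- b - ?n))"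
          unfolding e[symmetric] by (simp add: ennreal_mult[symmetric] Q0 mult_ac)
        moreover have "norm ((1/l) *\<^sub>R w) = norm w / l" using elim by simp
        ultimately show "ennreal (\<bar>1/l\<bar> ^ DIM('a)) * (Q (0 + (1/l) *\<^sub>R w) * \<phi> (norm (0 + (1/l) *\<^sub>R w))
             * indicator {1<..<2} (l * norm (0 + (1/l) *\<^sub>R w)))
          = ennreal (Q w) * indicator {1<..<2} (norm w) * (ennreal (l powr (- b - ?n)) * \<phi> (norm w / l))"
          using elim q by (simp add: mult.assoc[symmetric]) (simp add: mult_ac)
      qed
      finally show ?case .
    qed
  qed
  also have "\<dots> = (\<integral>\<^sup>+w. (\<integral>\<^sup>+l. ennreal (Q w) * indicator {1<..<2} (norm w)
       * (ennreal (l powr (- b - ?n)) * \<phi> (norm w / l)) \<partial>haar) \<partial>lborel)"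
    by (rule haar_lborel_Fubini[symmetric]) measurable
  also have "\<dots> = (\<integral>\<^sup>+w. ennreal (Q w * norm w powr (- b - ?n)) * indicator {1<..<2} (norm w)
       * (\<integral>\<^sup>+r. ennreal (r powr (b + ?n)) * \<phi> r \<partial>haar) \<partial>(lborel::'a measure))"
  proof (rule nn_integral_cong_AE)
    show "AE w::'a in lborel. (\<integral>\<^sup>+l. ennreal (Q w) * indicator {1<..<2} (norm w) * (ennreal (l powr (- b - ?n)) * \<phi> (norm w / l)) \<partial>haar)
      = ennreal (Q w * norm w powr (- b - ?n)) * indicator {1<..<2} (norm w) * (\<integral>\<^sup>+r. ennreal (r powr (b + ?n)) * \<phi> r \<partial>haar)"
      using AE_lborel_nonzero
    proof eventually_elim
      case (elim w)
      \<comment> \<open>For fixed w the new variable is r = |w| / l, and dl/l is invariant under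
        this change.\<close>
      have "(\<integral>\<^sup>+l. ennreal (l powr (- b - ?n)) * \<phi> (norm w / l) \<partial>haar)
        = (\<integral>\<^sup>+l. ennreal (norm w powr (- b - ?n)) * (ennreal ((norm w / l) powr (b + ?n)) * \<phi> (norm w / l)) \<partial>haar)"
      proof (rule nn_integral_cong_AE)
        show "AE l in haar. ennreal (l powr (- b - ?n)) * \<phi> (norm w / l)
          = ennreal (norm w powr (- b - ?n)) * (ennreal ((norm w / l) powr (b + ?n)) * \<phi> (norm w / l))"
          using AE_haar_pos
        proof eventually_elim
          case (elim l)
          have "l powr (- b - ?n) = norm w powr (- b - ?n) * (norm w / l) powr (b + ?n)"
            using elim \<open>w \<noteq> 0\<close> by (simp add: powr_divide powr_minus powr_diff powr_add field_simps)
          then show ?case by (simp add: ennreal_mult mult.assoc)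
        qed
      qed
      also have "\<dots> = ennreal (norm w powr (- b - ?n)) * (\<integral>\<^sup>+r. ennreal (r powr (b + ?n)) * \<phi> r \<partial>haar)"
        using elim by (subst nn_integral_cmult)
          (auto simp: nn_integral_haar_divide[where f="\<lambda>r. ennreal (r powr (b + ?n)) * \<phi> r"])
      finally have e: "(\<integral>\<^sup>+l. ennreal (l powr (- b - ?n)) * \<phi> (norm w / l) \<partial>haar) = \<dots>" .
      have "(\<integral>\<^sup>+l. ennreal (Q w) * indicator {1<..<2} (norm w) * (ennreal (l powr (- b - ?n)) * \<phi> (norm w / l)) \<partial>haar)
        = ennreal (Q w) * indicator {1<..<2} (norm w) * (\<integral>\<^sup>+l. ennreal (l powr (- b - ?n)) * \<phi> (norm w / l) \<partial>haar)"
        by (rule nn_integral_cmult) measurable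
      then show ?case
        unfolding e by (simp add: ennreal_mult Q0 mult_ac)
    qed
  qed
  also have "\<dots> = (\<integral>\<^sup>+w. ennreal (Q w * norm w powr (- b - ?n)) * indicator {1<..<2} (norm w) \<partial>(lborel::'a measure))
       * (\<integral>\<^sup>+r. ennreal (r powr (b + ?n)) * \<phi> r \<partial>haar)"
    by (rule nn_integral_multc) measurable
  finally show ?thesis .
qed

lemma nn_integral_homogeneous_finite:
  fixes Q :: "'a::euclidean_space \<Rightarrow> real" and \<phi> :: "real \<Rightarrow> ennreal" and b :: real
  assumes [measurable]: "Q \<in> borel_measurable borel" "\<phi> \<in> borel_measurable borel"
    and Q0: "\<And>z. 0 \<le> Q z"
    and hom: "\<And>l z. 0 < l \<Longrightarrow> Q (l *\<^sub>R z) = l powr b * Q z"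
    and Q: "(\<integral>\<^sup>+w. ennreal (Q w) * indicator {1<..<2} (norm w) \<partial>lborel) < \<infinity>"
    and \<phi>: "(\<integral>\<^sup>+r. ennreal (r powr (b + DIM('a))) * \<phi> r \<partial>haar) < \<infinity>"
  shows "(\<integral>\<^sup>+z. ennreal (Q z) * \<phi> (norm z) \<partial>lborel) < \<infinity>"
proof -
  let ?n = "real DIM('a)"
  \<comment> \<open>On the shell a negative power of |w| is below its value at radius 1, a
    nonnegative one below its value at radius 2.\<close>
  define M where "M = max 1 (2 powr (- b - ?n))"
  have "(\<integral>\<^sup>+w. ennreal (Q w * norm w powr (- b - ?n)) * indicator {1<..<2} (norm w) \<partial>lborel)
      \<le> (\<integral>\<^sup>+w. ennreal M * (ennreal (Q w) * indicator {1<..<2} (norm w)) \<partial>lborel)"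
  proof (intro nn_integral_mono)
    fix w :: 'a
    have "norm w powr (- b - ?n) \<le> M" if "1 < norm w" "norm w < 2"
    proof (cases "0 \<le> - b - ?n")
      case True
      then have "norm w powr (- b - ?n) \<le> 2 powr (- b - ?n)"
        using that by (intro powr_mono2) auto
      then show ?thesis by (simp add: M_def)
    next
      case False
      then have "norm w powr (- b - ?n) \<le> norm w powr 0"
        using that by (intro powr_mono) auto
      moreover have "w \<noteq> 0" using that by auto
      ultimately show ?thesis by (simp add: M_def)
    qed
    then have "Q w * norm w powr (- b - ?n) \<le> M * Q w" if "1 < norm w" "norm w < 2"
      using that Q0[of w] by (subst mult.commute) (intro mult_right_mono, auto)
    moreover have "0 \<le> M" by (simp add: M_def)
    ultimately show "ennreal (Q w * norm w powr (- b - ?n)) * indicator {1<..<2} (norm w)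
      \<le> ennreal M * (ennreal (Q w) * indicator {1<..<2} (norm w))"
      by (auto simp: ennreal_mult[symmetric] Q0 split: split_indicator intro!: ennreal_leI)
  qed
  also have "\<dots> = ennreal M * (\<integral>\<^sup>+w. ennreal (Q w) * indicator {1<..<2} (norm w) \<partial>lborel)"
    by (rule nn_integral_cmult) measurable
  also have "\<dots> < \<infinity>" using Q by (simp add: ennreal_mult_less_top)
  finally have "(\<integral>\<^sup>+w. ennreal (Q w * norm w powr (- b - ?n)) * indicator {1<..<2} (norm w) \<partial>lborel) < \<infinity>" .
  then have "ennreal (ln 2) * (\<integral>\<^sup>+z. ennreal (Q z) * \<phi> (norm z) \<partial>lborel) < \<infinity>"
    by (subst nn_integral_homogeneous[OF assms(1-4)]) (use \<phi> in \<open>simp_all add: ennreal_mult_less_top\<close>)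
  moreover have "ennreal (ln 2) \<noteq> 0" by simp
  ultimately show ?thesis by (auto simp: ennreal_mult_less_top)
qed

lemma shell_finite:
  "(\<integral>\<^sup>+w. indicator {1<..<2} (norm w) \<partial>(lborel :: 'a::euclidean_space measure)) < \<infinity>"
proof -
  have "(\<integral>\<^sup>+w. indicator {1<..<2} (norm w) \<partial>(lborel :: 'a measure))
      \<le> (\<integral>\<^sup>+w. indicator (ball 0 2) w \<partial>(lborel :: 'a measure))"
    by (intro nn_integral_mono) (auto split: split_indicator)
  also have "\<dots> < \<infinity>"
    using emeasure_bounded_finite[of "ball 0 2 :: 'a set"] by simp
  finally show ?thesis .
qed

lemma nn_integral_radial_finite:
  fixes \<phi> :: "real \<Rightarrow> ennreal" and b :: real
  assumes [measurable]: "\<phi> \<in> borel_measurable borel"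
    and \<phi>: "(\<integral>\<^sup>+r. ennreal (r powr (b + DIM('a))) * \<phi> r \<partial>haar) < \<infinity>"
  shows "(\<integral>\<^sup>+z. ennreal (norm z powr b) * \<phi> (norm z) \<partial>(lborel :: 'a::euclidean_space measure)) < \<infinity>"
proof (rule nn_integral_homogeneous_finite[OF _ _ _ _ _ \<phi>])
  have "(\<integral>\<^sup>+w. ennreal (norm w powr b) * indicator {1<..<2} (norm w) \<partial>(lborel :: 'a measure))
      \<le> (\<integral>\<^sup>+w. ennreal (max 1 (2 powr b)) * indicator {1<..<2} (norm w) \<partial>(lborel :: 'a measure))"
  proof (intro nn_integral_mono)
    fix w :: 'a
    have "norm w powr b \<le> max 1 (2 powr b)" if "1 < norm w" "norm w < 2"
    proof (cases "0 \<le> b")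
      case True
      then have "norm w powr b \<le> 2 powr b"
        using that by (intro powr_mono2) auto
      then show ?thesis by simp
    next
      case False
      then have "norm w powr b \<le> norm w powr 0"
        using that by (intro powr_mono) auto
      moreover have "w \<noteq> 0" using that by auto
      ultimately show ?thesis by simp
    qed
    then show "ennreal (norm w powr b) * indicator {1<..<2} (norm w)
      \<le> ennreal (max 1 (2 powr b)) * indicator {1<..<2} (norm w)"
      by (auto split: split_indicator intro!: ennreal_leI)
  qed
  also have "\<dots> = ennreal (max 1 (2 powr b)) * (\<integral>\<^sup>+w. indicator {1<..<2} (norm w) \<partial>(lborel :: 'a measure))"
    by (rule nn_integral_cmult) measurable
  also have "\<dots> < \<infinity>" using shell_finite[where 'a='a] by (simp add: ennreal_mult_less_top)
  finally show "(\<integral>\<^sup>+w. ennreal (norm w powr b) * indicator {1<..<2} (norm w) \<partial>(lborel :: 'a measure)) < \<infinity>" .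
qed (auto simp: powr_mult)

section \<open>The radial profile of the resolvent kernel\<close>

text \<open>The kernel of (1 - Laplacian)^(-1) as a function of the radius, that is the Bessel
  potential kernel of order two.\<close>

definition resolvent_profile :: "nat \<Rightarrow> real \<Rightarrow> real" where
  "resolvent_profile n r =
     (LINT \<tau>:{0<..}|lborel. exp (- \<tau>) * (1 / (4 * pi * \<tau>) powr (real n / 2)) * exp (- r\<^sup>2 / (4 * \<tau>)))"

text \<open>Extended nonnegative values allow Tonelli without integrability and keep divergence
  visible: for n >= 2 the value at r = 0 is infinite.\<close>

definition resolvent_profile_nn :: "nat \<Rightarrow> real \<Rightarrow> ennreal" where
  "resolvent_profile_nn n r =
     (\<integral>\<^sup>+\<tau>. ennreal (\<tau> * exp (- \<tau>) * (4 * pi * \<tau>) powr (- real n / 2)) * ennreal (exp (- r\<^sup>2 / (4 * \<tau>))) \<partial>haar)"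

text \<open>Scaling tau by t reduces every kernel to t = 1. The identity includes z = 0, where both
  integrals may take the default value 0 together.\<close>

lemma resolvent_kernel_eq:
  fixes z :: "real^'n"
  assumes t: "0 < t"
  shows "resolvent_kernel t z = t powr (CARD('n) / 2) * resolvent_profile CARD('n) (sqrt t * norm z)"
proof -
  let ?n = "CARD('n)"
  let ?f = "\<lambda>\<tau>. indicator {0<..} \<tau> *\<^sub>R (exp (- \<tau>) * (1 / (4 * pi * \<tau>) powr (real ?n / 2))
                * exp (- (sqrt t * norm z)\<^sup>2 / (4 * \<tau>)))"
  have "resolvent_profile ?n (sqrt t * norm z) = (\<integral>\<tau>. ?f \<tau> \<partial>lborel)"
    by (simp add: resolvent_profile_def set_lebesgue_integral_def)
  also have "\<dots> = \<bar>t\<bar> *\<^sub>R (\<integral>\<tau>. ?f (0 + t * \<tau>) \<partial>lborel)"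
    using t by (intro lborel_integral_real_affine) auto
  finally have "t powr (?n / 2) * resolvent_profile ?n (sqrt t * norm z)
      = t * (t powr (?n / 2) * (\<integral>\<tau>. ?f (0 + t * \<tau>) \<partial>lborel))"
    using t by simp
  also have "t powr (?n / 2) * (\<integral>\<tau>. ?f (0 + t * \<tau>) \<partial>lborel) = (\<integral>\<tau>. t powr (?n / 2) * ?f (0 + t * \<tau>) \<partial>lborel)"
    by (rule integral_mult_right_zero[symmetric])
  also have "\<dots> = (LINT \<tau>:{0<..}|lborel. exp (- t * \<tau>) * (1 / (4 * pi * \<tau>) powr (real ?n / 2))
              * exp (- (norm z)\<^sup>2 / (4 * \<tau>)))"
    unfolding set_lebesgue_integral_def
  proof (intro Bochner_Integration.integral_cong refl)
    fix \<tau> :: real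
    show "t powr (?n / 2) * ?f (0 + t * \<tau>) = indicator {0<..} \<tau> *\<^sub>R (exp (- t * \<tau>)
        * (1 / (4 * pi * \<tau>) powr (real ?n / 2)) * exp (- (norm z)\<^sup>2 / (4 * \<tau>)))"
    proof (cases "0 < \<tau>")
      case True
      have "(sqrt t * norm z)\<^sup>2 / (4 * (t * \<tau>)) = (norm z)\<^sup>2 / (4 * \<tau>)"
        using t by (simp add: power_mult_distrib)
      moreover have "(4 * pi * (t * \<tau>)) powr (?n / 2) = t powr (?n / 2) * (4 * pi * \<tau>) powr (?n / 2)"
        using t True by (simp add: powr_mult mult_ac)
      ultimately show ?thesis using t True by simp
    qed (use t in \<open>simp add: zero_less_mult_iff\<close>)
  qed
  finally show ?thesis
    unfolding resolvent_kernel_def by simp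
qed

lemma resolvent_profile_nn_measurable [measurable]:
  "resolvent_profile_nn n \<in> borel_measurable borel"
  unfolding resolvent_profile_nn_def[abs_def] by measurable

text \<open>This is valid also where the integral diverges: the Bochner integral and
  \<open>enn2real\<close> both return 0 there.\<close>

lemma resolvent_profile_eq: "resolvent_profile n r = enn2real (resolvent_profile_nn n r)"
proof -
  have "resolvent_profile n r = enn2real (\<integral>\<^sup>+\<tau>. ennreal (indicator {0<..} \<tau> *\<^sub>R (exp (- \<tau>)
      * (1 / (4 * pi * \<tau>) powr (real n / 2)) * exp (- r\<^sup>2 / (4 * \<tau>)))) \<partial>lborel)"
    unfolding resolvent_profile_def set_lebesgue_integral_def
    by (rule integral_eq_nn_integral) auto
  also have "(\<integral>\<^sup>+\<tau>. ennreal (indicator {0<..} \<tau> *\<^sub>R (exp (- \<tau>)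
      * (1 / (4 * pi * \<tau>) powr (real n / 2)) * exp (- r\<^sup>2 / (4 * \<tau>)))) \<partial>lborel) = resolvent_profile_nn n r"
    unfolding resolvent_profile_nn_def
    by (subst nn_integral_haar)
       (auto intro!: nn_integral_cong simp: ennreal_mult[symmetric] powr_minus field_simps split: split_indicator)
  finally show ?thesis .
qed

lemma resolvent_profile_nonneg: "0 \<le> resolvent_profile n r"
  by (simp add: resolvent_profile_eq)

lemma resolvent_profile_measurable [measurable]: "resolvent_profile n \<in> borel_measurable borel"
  unfolding resolvent_profile_eq[abs_def] by measurable

section \<open>The Mellin transform of the radial profile\<close>

lemma nn_integral_haar_gauss:
  assumes "0 < b" "0 < \<tau>"
  shows "(\<integral>\<^sup>+r. ennreal (2 * r powr b) * ennreal (exp (- r\<^sup>2 / (4 * \<tau>))) \<partial>haar)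
    = ennreal ((4 * \<tau>) powr (b / 2) * Gamma (b / 2))"
proof -
  have "ennreal ((4 * \<tau>) powr (b / 2) * Gamma (b / 2))
      = ennreal ((4 * \<tau>) powr (b / 2)) * (\<integral>\<^sup>+x. ennreal (x powr (b / 2) * exp (- x)) \<partial>haar)"
    using assms by (subst nn_integral_haar_Gamma) (auto simp: ennreal_mult Gamma_real_pos less_imp_le)
  \<comment> \<open>Squaring the variable produces the factor 2 of the statement; scaling by 1 /
    sqrt (4 tau) follows.\<close>
  also have "\<dots> = ennreal ((4 * \<tau>) powr (b / 2)) * (ennreal \<bar>2\<bar> * (\<integral>\<^sup>+x. ennreal ((x powr 2) powr (b / 2) * exp (- (x powr 2))) \<partial>haar))"
    by (subst nn_integral_haar_powr[of "\<lambda>x. ennreal (x powr (b / 2) * exp (- x))" 2]) auto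
  also have "(\<integral>\<^sup>+x. ennreal ((x powr 2) powr (b / 2) * exp (- (x powr 2))) \<partial>haar)
      = (\<integral>\<^sup>+x. ennreal ((((1 / sqrt (4 * \<tau>)) * x) powr 2) powr (b / 2) * exp (- (((1 / sqrt (4 * \<tau>)) * x) powr 2))) \<partial>haar)"
    using assms by (intro nn_integral_haar_mult[symmetric, of "\<lambda>x. ennreal ((x powr 2) powr (b / 2) * exp (- (x powr 2)))"]) auto
  also have "ennreal ((4 * \<tau>) powr (b / 2)) * (ennreal \<bar>2\<bar> * \<dots>)
      = (\<integral>\<^sup>+x. ennreal ((4 * \<tau>) powr (b / 2)) * (ennreal \<bar>2\<bar> * ennreal ((((1 / sqrt (4 * \<tau>)) * x) powr 2) powr (b / 2) * exp (- (((1 / sqrt (4 * \<tau>)) * x) powr 2)))) \<partial>haar)"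
    unfolding mult.assoc[symmetric] by (rule nn_integral_cmult[symmetric]) measurable
  also have "\<dots> = (\<integral>\<^sup>+r. ennreal (2 * r powr b) * ennreal (exp (- r\<^sup>2 / (4 * \<tau>))) \<partial>haar)"
  proof (rule nn_integral_cong_AE)
    show "AE x in haar. ennreal ((4 * \<tau>) powr (b / 2)) * (ennreal \<bar>2\<bar> * ennreal ((((1 / sqrt (4 * \<tau>)) * x) powr 2) powr (b / 2) * exp (- (((1 / sqrt (4 * \<tau>)) * x) powr 2))))
      = ennreal (2 * x powr b) * ennreal (exp (- x\<^sup>2 / (4 * \<tau>)))"
      using AE_haar_pos
    proof eventually_elim
      case (elim x)
      have 1: "((1 / sqrt (4 * \<tau>)) * x) powr 2 = x\<^sup>2 / (4 * \<tau>)"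
        using elim assms by (simp add: power_mult_distrib power_divide)
      have 2: "(x\<^sup>2 / (4 * \<tau>)) powr (b / 2) = x powr b / (4 * \<tau>) powr (b / 2)"
      proof -
        have "x\<^sup>2 powr (b / 2) = x powr b"
          using elim by (simp add: powr_powr flip: powr_numeral)
        then show ?thesis using elim assms by (simp add: powr_divide)
      qed
      show ?case
        unfolding 1 2 using assms
        by (simp only: ennreal_mult'[symmetric] abs_ge_zero powr_ge_zero mult_nonneg_nonneg zero_le_numeral) (simp add: mult_ac)
    qed
  qed
  finally show ?thesis ..
qed

text \<open>For e = 0 this is 2 divided by the area of the unit sphere, in agreement with the total
  mass 1 of the kernel. For e = s * p it is the constant c with C_4 = C_1 / c.\<close>

definition mellin_const :: "nat \<Rightarrow> real \<Rightarrow> real" where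
  "mellin_const n e = 2 powr e * Gamma ((n + e) / 2) * Gamma (1 + e / 2) / pi powr (n / 2)"

lemma mellin_const_pos: "0 \<le> e \<Longrightarrow> 0 < n \<Longrightarrow> 0 < mellin_const n e"
  unfolding mellin_const_def by (auto intro!: mult_pos_pos divide_pos_pos Gamma_real_pos)

text \<open>By Tonelli, the Gaussian integral in r produces \<open>Gamma ((n + e) / 2)\<close> and
  the remaining integral in tau produces \<open>Gamma (1 + e / 2)\<close>; the powers of 4 tau
  combine to the exponent e / 2.\<close>

lemma mellin_resolvent_profile_nn:
  assumes "0 \<le> e" "0 < n"
  shows "(\<integral>\<^sup>+r. ennreal (2 * r powr (n + e)) * resolvent_profile_nn n r \<partial>haar) = ennreal (mellin_const n e)"
proof -
  interpret pair_sigma_finite haar haar ..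
  let ?g = "\<lambda>\<tau>. ennreal (\<tau> * exp (- \<tau>) * (4 * pi * \<tau>) powr (- real n / 2))"
  have "(\<integral>\<^sup>+r. ennreal (2 * r powr (n + e)) * resolvent_profile_nn n r \<partial>haar)
    = (\<integral>\<^sup>+r. (\<integral>\<^sup>+\<tau>. ?g \<tau> * (ennreal (2 * r powr (n + e)) * ennreal (exp (- r\<^sup>2 / (4 * \<tau>)))) \<partial>haar) \<partial>haar)"
    unfolding resolvent_profile_nn_def
    by (subst nn_integral_cmult[symmetric]) (auto simp: mult_ac)
  also have "\<dots> = (\<integral>\<^sup>+\<tau>. (\<integral>\<^sup>+r. ?g \<tau> * (ennreal (2 * r powr (n + e)) * ennreal (exp (- r\<^sup>2 / (4 * \<tau>)))) \<partial>haar) \<partial>haar)"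
    by (rule Fubini') measurable
  also have "\<dots> = (\<integral>\<^sup>+\<tau>. ennreal (2 powr e * Gamma ((n + e) / 2) / pi powr (n / 2)) * ennreal (\<tau> powr (1 + e / 2) * exp (- \<tau>)) \<partial>haar)"
  proof (rule nn_integral_cong_AE)
    show "AE \<tau> in haar. (\<integral>\<^sup>+r. ?g \<tau> * (ennreal (2 * r powr (n + e)) * ennreal (exp (- r\<^sup>2 / (4 * \<tau>)))) \<partial>haar)
       = ennreal (2 powr e * Gamma ((n + e) / 2) / pi powr (n / 2)) * ennreal (\<tau> powr (1 + e / 2) * exp (- \<tau>))"
      using AE_haar_pos
    proof eventually_elim
      case (elim \<tau>)
      have "(\<integral>\<^sup>+r. ?g \<tau> * (ennreal (2 * r powr (n + e)) * ennreal (exp (- r\<^sup>2 / (4 * \<tau>)))) \<partial>haar)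
        = ?g \<tau> * ennreal ((4 * \<tau>) powr ((n + e) / 2) * Gamma ((n + e) / 2))"
        using elim assms by (subst nn_integral_cmult, measurable) (subst nn_integral_haar_gauss, auto)
      also have "\<dots> = ennreal (\<tau> * exp (- \<tau>) * (4 * pi * \<tau>) powr (- real n / 2) * ((4 * \<tau>) powr ((n + e) / 2) * Gamma ((n + e) / 2)))"
        using elim assms by (subst ennreal_mult[symmetric]) (auto simp: Gamma_real_pos less_imp_le)
      also have "\<tau> * exp (- \<tau>) * (4 * pi * \<tau>) powr (- real n / 2) * ((4 * \<tau>) powr ((n + e) / 2) * Gamma ((n + e) / 2))
        = 2 powr e * Gamma ((n + e) / 2) / pi powr (n / 2) * (\<tau> powr (1 + e / 2) * exp (- \<tau>))"
      proof -
        have "(4::real) powr (e / 2) = (2 powr 2) powr (e / 2)" by simp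
        also have "\<dots> = 2 powr e" unfolding powr_powr by simp
        finally have 4: "(4::real) powr (e / 2) = 2 powr e" .
        have a: "(4 * pi * \<tau>) powr (- real n / 2) = (4 * \<tau>) powr (- real n / 2) * pi powr (- real n / 2)"
          using elim by (simp add: powr_mult mult_ac)
        have b: "(4 * \<tau>) powr (- real n / 2) * (4 * \<tau>) powr ((n + e) / 2) = (4 * \<tau>) powr (e / 2)"
          by (simp add: powr_add[symmetric] add_divide_distrib)
        have c: "(4 * \<tau>) powr (e / 2) = 2 powr e * \<tau> powr (e / 2)"
          using elim 4 by (simp add: powr_mult)
        have d: "\<tau> powr (1 + e / 2) = \<tau> * \<tau> powr (e / 2)"
          using elim by (simp add: powr_add)
        have f: "pi powr (- real n / 2) = 1 / pi powr (n / 2)"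
          using powr_minus_divide[of pi "n / 2"] by simp
        have "\<tau> * exp (- \<tau>) * (4 * pi * \<tau>) powr (- real n / 2) * ((4 * \<tau>) powr ((n + e) / 2) * Gamma ((n + e) / 2))
          = \<tau> * exp (- \<tau>) * pi powr (- real n / 2) * ((4 * \<tau>) powr (- real n / 2) * (4 * \<tau>) powr ((n + e) / 2)) * Gamma ((n + e) / 2)"
          unfolding a by (simp add: algebra_simps del: powr_add)
        also have "\<dots> = 2 powr e * Gamma ((n + e) / 2) / pi powr (n / 2) * (\<tau> powr (1 + e / 2) * exp (- \<tau>))"
          unfolding b c d f by (simp add: mult_ac)
        finally show ?thesis .
      qed
      also have "ennreal \<dots> = ennreal (2 powr e * Gamma ((n + e) / 2) / pi powr (n / 2)) * ennreal (\<tau> powr (1 + e / 2) * exp (- \<tau>))"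
        using assms by (intro ennreal_mult) (auto simp: Gamma_real_pos less_imp_le)
      finally show ?case .
    qed
  qed
  also have "\<dots> = ennreal (2 powr e * Gamma ((n + e) / 2) / pi powr (n / 2)) * ennreal (Gamma (1 + e / 2))"
    using assms by (subst nn_integral_cmult) (auto simp: nn_integral_haar_Gamma)
  also have "\<dots> = ennreal (mellin_const n e)"
    using assms by (subst ennreal_mult[symmetric])
      (auto simp: mellin_const_def Gamma_real_pos less_imp_le mult_ac)
  finally show ?thesis .
qed

text \<open>The Mellin integral at e = 0 is finite, so the profile is finite almost everywhere and
  passing to reals loses nothing.\<close>

lemma AE_resolvent_profile:
  assumes "0 < n"
  shows "AE r in haar. ennreal (resolvent_profile n r) = resolvent_profile_nn n r"
proof -
  have "(\<integral>\<^sup>+r. ennreal (2 * r powr (n + 0)) * resolvent_profile_nn n r \<partial>haar) \<noteq> \<infinity>"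
    using mellin_resolvent_profile_nn[of 0 n] assms by simp
  then have "AE r in haar. ennreal (2 * r powr (n + 0)) * resolvent_profile_nn n r \<noteq> \<infinity>"
    by (intro nn_integral_noteq_infinite) auto
  with AE_haar_pos show ?thesis
    by eventually_elim (auto simp: resolvent_profile_eq ennreal_mult_eq_top_iff less_top)
qed

lemma mellin_resolvent_profile:
  assumes "0 \<le> e" "0 < n"
  shows "(\<integral>\<^sup>+r. ennreal (2 * r powr (n + e) * resolvent_profile n r) \<partial>haar) = ennreal (mellin_const n e)"
proof -
  have "(\<integral>\<^sup>+r. ennreal (2 * r powr (n + e) * resolvent_profile n r) \<partial>haar)
     = (\<integral>\<^sup>+r. ennreal (2 * r powr (n + e)) * resolvent_profile_nn n r \<partial>haar)"
  proof (rule nn_integral_cong_AE)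
    show "AE r in haar. ennreal (2 * r powr (n + e) * resolvent_profile n r) = ennreal (2 * r powr (n + e)) * resolvent_profile_nn n r"
      using AE_resolvent_profile[OF assms(2)]
      by eventually_elim (simp add: ennreal_mult resolvent_profile_nonneg)
  qed
  then show ?thesis using mellin_resolvent_profile_nn[OF assms] by simp
qed

text \<open>In polar coordinates this is the finite Mellin integral at e = 0, with the radius scaled
  by sqrt t.\<close>

lemma integrable_resolvent_kernel:
  assumes t: "0 < t"
  shows "integrable lborel (resolvent_kernel t :: real^'n \<Rightarrow> real)"
proof -
  let ?n = "CARD('n)"
  have fin: "(\<integral>\<^sup>+z. ennreal (norm z powr 0) * ennreal (resolvent_profile ?n (sqrt t * norm z)) \<partial>(lborel :: (real^'n) measure)) < \<infinity>"
  proof (rule nn_integral_radial_finite)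
    have "(\<integral>\<^sup>+r. ennreal (2 * r powr (?n + 0) * resolvent_profile ?n r) \<partial>haar) < \<infinity>"
      using mellin_resolvent_profile[of 0 ?n] by simp
    also have "(\<integral>\<^sup>+r. ennreal (2 * r powr (?n + 0) * resolvent_profile ?n r) \<partial>haar)
        = (\<integral>\<^sup>+r. ennreal (2 * (sqrt t * r) powr (?n + 0) * resolvent_profile ?n (sqrt t * r)) \<partial>haar)"
      using t by (intro nn_integral_haar_mult[symmetric, of "\<lambda>r. ennreal (2 * r powr (?n + 0) * resolvent_profile ?n r)"]) auto
    also have "\<dots> = (\<integral>\<^sup>+r. ennreal (2 * sqrt t powr ?n) * (ennreal (r powr (0 + real DIM(real^'n))) * ennreal (resolvent_profile ?n (sqrt t * r))) \<partial>haar)"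
    proof (rule nn_integral_cong_AE)
      show "AE r in haar. ennreal (2 * (sqrt t * r) powr (?n + 0) * resolvent_profile ?n (sqrt t * r))
        = ennreal (2 * sqrt t powr ?n) * (ennreal (r powr (0 + real DIM(real^'n))) * ennreal (resolvent_profile ?n (sqrt t * r)))"
        using AE_haar_pos
      proof eventually_elim
        case (elim r)
        have "2 * (sqrt t * r) powr (?n + 0) * resolvent_profile ?n (sqrt t * r)
          = 2 * sqrt t powr ?n * (r powr (0 + real DIM(real^'n)) * resolvent_profile ?n (sqrt t * r))"
          using t elim by (simp add: powr_mult del: mult_eq_0_iff)
        then show ?case
          by (metis (no_types, lifting) ennreal_mult mult_nonneg_nonneg powr_ge_zero resolvent_profile_nonneg zero_le_numeral)
      qed
    qed
    also have "\<dots> = ennreal (2 * sqrt t powr ?n) * (\<integral>\<^sup>+r. ennreal (r powr (0 + real DIM(real^'n))) * ennreal (resolvent_profile ?n (sqrt t * r)) \<partial>haar)"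
      by (rule nn_integral_cmult) measurable
    finally show "(\<integral>\<^sup>+r. ennreal (r powr (0 + real DIM(real^'n))) * ennreal (resolvent_profile ?n (sqrt t * r)) \<partial>haar) < \<infinity>"
      using t by (auto simp: ennreal_mult_less_top)
  qed measurable
  have "integrable lborel (\<lambda>z::real^'n. resolvent_profile ?n (sqrt t * norm z))"
  proof (rule integrableI_nonneg)
    have "(\<integral>\<^sup>+z. ennreal (resolvent_profile ?n (sqrt t * norm z)) \<partial>(lborel :: (real^'n) measure))
       = (\<integral>\<^sup>+z. ennreal (norm z powr 0) * ennreal (resolvent_profile ?n (sqrt t * norm z)) \<partial>(lborel :: (real^'n) measure))"
      by (rule nn_integral_cong_AE, rule AE_mp[OF AE_lborel_nonzero]) simp
    then show "(\<integral>\<^sup>+z. ennreal (resolvent_profile ?n (sqrt t * norm z)) \<partial>(lborel :: (real^'n) measure)) < \<infinity>"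
      using fin by simp
  qed (auto simp: resolvent_profile_nonneg)
  then have "integrable lborel (\<lambda>z::real^'n. t powr (?n / 2) * resolvent_profile ?n (sqrt t * norm z))"
    by (rule integrable_mult_right)
  moreover have "(\<lambda>z::real^'n. t powr (?n / 2) * resolvent_profile ?n (sqrt t * norm z)) = resolvent_kernel t"
    using t by (intro ext) (rule resolvent_kernel_eq[symmetric])
  ultimately show ?thesis by simp
qed

section \<open>Averaging truncated integrals against a multiplicative probability density\<close>

text \<open>The moments of orders a and -a make the distribution function tend to 1 at infinity and
  to 0 at zero at a power rate, so that it differs from a unit step by an integrable amount against
  dr/r.\<close>

locale mult_density =
  fixes \<kappa> :: "real \<Rightarrow> real" and a :: real
  assumes kappa_measurable [measurable]: "\<kappa> \<in> borel_measurable borel"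
    and kappa_nonneg: "0 \<le> \<kappa> r"
    and kappa_mass: "(\<integral>\<^sup>+r. ennreal (\<kappa> r) \<partial>haar) = 1"
    and a_pos: "0 < a"
    and moment_pos: "(\<integral>\<^sup>+r. ennreal (r powr a * \<kappa> r) \<partial>haar) < \<infinity>"
    and moment_neg: "(\<integral>\<^sup>+r. ennreal (r powr (- a) * \<kappa> r) \<partial>haar) < \<infinity>"
begin

definition cdf :: "real \<Rightarrow> real" where
  "cdf r = (\<integral>\<rho>. (if \<rho> < r then \<kappa> \<rho> else 0) \<partial>haar)"

lemma integrable_kappa: "integrable haar \<kappa>"
  by (rule integrableI_nonneg) (auto simp: kappa_nonneg kappa_mass)

lemma integral_kappa: "(\<integral>\<rho>. \<kappa> \<rho> \<partial>haar) = 1"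
  by (subst integral_eq_nn_integral) (auto simp: kappa_nonneg kappa_mass)

lemma integrable_kappa_if:
  assumes [measurable]: "Measurable.pred borel P"
  shows "integrable haar (\<lambda>\<rho>. if P \<rho> then \<kappa> \<rho> else 0)"
  by (rule Bochner_Integration.integrable_bound[OF integrable_kappa]) (auto simp: kappa_nonneg)

lemma cdf_measurable [measurable]: "cdf \<in> borel_measurable borel"
  unfolding cdf_def[abs_def] by measurable

lemma cdf_nonneg: "0 \<le> cdf r"
  unfolding cdf_def by (auto intro!: integral_nonneg_AE simp: kappa_nonneg)

lemma cdf_nn: "ennreal (cdf r) = (\<integral>\<^sup>+\<rho>. ennreal (if \<rho> < r then \<kappa> \<rho> else 0) \<partial>haar)"
  unfolding cdf_def
  by (rule nn_integral_eq_integral[symmetric]) (auto simp: kappa_nonneg integrable_kappa_if)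

lemma cdf_compl: "1 - cdf r = (\<integral>\<rho>. (if r \<le> \<rho> then \<kappa> \<rho> else 0) \<partial>haar)"
proof -
  have "1 - cdf r = (\<integral>\<rho>. \<kappa> \<rho> - (if \<rho> < r then \<kappa> \<rho> else 0) \<partial>haar)"
    unfolding cdf_def using integrable_kappa_if[of "\<lambda>\<rho>. \<rho> < r"] integrable_kappa
    by (subst Bochner_Integration.integral_diff) (auto simp: integral_kappa)
  also have "\<dots> = (\<integral>\<rho>. (if r \<le> \<rho> then \<kappa> \<rho> else 0) \<partial>haar)"
    by (intro Bochner_Integration.integral_cong) auto
  finally show ?thesis .
qed

lemma cdf_le_1: "cdf r \<le> 1"
proof -
  have "0 \<le> 1 - cdf r"
    unfolding cdf_compl by (auto intro!: integral_nonneg_AE simp: kappa_nonneg)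
  then show ?thesis by simp
qed

lemma cdf_compl_nn: "ennreal (1 - cdf r) = (\<integral>\<^sup>+\<rho>. ennreal (if r \<le> \<rho> then \<kappa> \<rho> else 0) \<partial>haar)"
  unfolding cdf_compl
  by (rule nn_integral_eq_integral[symmetric]) (auto simp: kappa_nonneg integrable_kappa_if)

lemma cdf_scaled:
  assumes "0 < c"
  shows "(\<integral>\<^sup>+\<rho>. ennreal (if \<rho> < r then \<kappa> (\<rho> * c) else 0) \<partial>haar) = ennreal (cdf (r * c))"
    and "(\<integral>\<rho>. (if \<rho> < r then \<kappa> (\<rho> * c) else 0) \<partial>haar) = cdf (r * c)"
proof -
  have e: "(if \<rho> < r then \<kappa> (\<rho> * c) else 0) = (if c * \<rho> < r * c then \<kappa> (c * \<rho>) else 0)" for \<rho>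
    using assms by (auto simp: mult.commute)
  show "(\<integral>\<^sup>+\<rho>. ennreal (if \<rho> < r then \<kappa> (\<rho> * c) else 0) \<partial>haar) = ennreal (cdf (r * c))"
    unfolding cdf_nn e
    using nn_integral_haar_mult[of "\<lambda>\<rho>. ennreal (if \<rho> < r * c then \<kappa> \<rho> else 0)" c] assms by simp
  show "(\<integral>\<rho>. (if \<rho> < r then \<kappa> (\<rho> * c) else 0) \<partial>haar) = cdf (r * c)"
    unfolding cdf_def e
    using integral_haar_mult(1)[of "\<lambda>\<rho>. (if \<rho> < r * c then \<kappa> \<rho> else 0)" c] assms by simp
qed

lemma kappa_scaled:
  assumes "0 < c"
  shows "(\<integral>\<^sup>+\<rho>. ennreal (\<kappa> (\<rho> * c)) \<partial>haar) = 1" "(\<integral>\<rho>. \<kappa> (\<rho> * c) \<partial>haar) = 1"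
proof -
  show "(\<integral>\<^sup>+\<rho>. ennreal (\<kappa> (\<rho> * c)) \<partial>haar) = 1"
    using nn_integral_haar_mult[of "\<lambda>\<rho>. ennreal (\<kappa> \<rho>)" c] assms kappa_mass by (simp add: mult.commute)
  show "(\<integral>\<rho>. \<kappa> (\<rho> * c) \<partial>haar) = 1"
    using integral_haar_mult(1)[of "\<kappa>" c] assms integral_kappa by (simp add: mult.commute)
qed

definition cdf_defect :: "real \<Rightarrow> real" where
  "cdf_defect r = \<bar>cdf r - (if 1 < r then 1 else 0)\<bar>"

lemma cdf_defect_measurable [measurable]: "cdf_defect \<in> borel_measurable borel"
  unfolding cdf_defect_def[abs_def] by measurable

text \<open>Markov's inequality: the moment of order -a controls \<open>cdf\<close> by r^a below 1,
  and the moment of order a controls its complement by r^(-a) above 1. Both powers are integrable on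
  their side.\<close>

lemma nn_integral_cdf_defect: "(\<integral>\<^sup>+r. ennreal (cdf_defect r) \<partial>haar) < \<infinity>"
proof -
  define P where "P = (\<integral>\<^sup>+r. ennreal (r powr a * \<kappa> r) \<partial>haar)"
  define N where "N = (\<integral>\<^sup>+r. ennreal (r powr (- a) * \<kappa> r) \<partial>haar)"
  have 1: "ennreal (cdf r) \<le> N * ennreal (r powr a)" if "0 < r" for r
  proof -
    have "ennreal (cdf r) \<le> (\<integral>\<^sup>+\<rho>. ennreal (\<rho> powr (- a) * \<kappa> \<rho>) * ennreal (r powr a) \<partial>haar)"
      unfolding cdf_nn
    proof (rule nn_integral_mono_AE)
      show "AE \<rho> in haar. ennreal (if \<rho> < r then \<kappa> \<rho> else 0) \<le> ennreal (\<rho> powr (- a) * \<kappa> \<rho>) * ennreal (r powr a)"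
        using AE_haar_pos
      proof eventually_elim
        case (elim \<rho>)
        have "\<kappa> \<rho> \<le> \<rho> powr (- a) * \<kappa> \<rho> * r powr a" if "\<rho> < r"
        proof -
          have "\<rho> powr a \<le> r powr a" using that elim a_pos by (intro powr_mono2) auto
          then have "1 \<le> \<rho> powr (- a) * r powr a"
            using elim by (simp add: powr_minus field_simps)
          then have "\<kappa> \<rho> * 1 \<le> \<kappa> \<rho> * (\<rho> powr (- a) * r powr a)"
            using kappa_nonneg by (rule mult_left_mono)
          then show ?thesis by (simp add: mult_ac)
        qed
        then show ?case
          by (auto simp: ennreal_mult[symmetric] kappa_nonneg intro!: ennreal_leI)
      qed
    qed
    also have "\<dots> = N * ennreal (r powr a)" unfolding N_def by (rule nn_integral_multc) measurable
    finally show ?thesis .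
  qed
  have 2: "ennreal (1 - cdf r) \<le> P * ennreal (r powr (- a))" if "0 < r" for r
  proof -
    have "ennreal (1 - cdf r) \<le> (\<integral>\<^sup>+\<rho>. ennreal (\<rho> powr a * \<kappa> \<rho>) * ennreal (r powr (- a)) \<partial>haar)"
      unfolding cdf_compl_nn
    proof (intro nn_integral_mono)
      fix \<rho> :: real
      have "\<kappa> \<rho> \<le> \<rho> powr a * \<kappa> \<rho> * r powr (- a)" if "r \<le> \<rho>"
      proof -
        have "r powr a \<le> \<rho> powr a" using that \<open>0 < r\<close> a_pos by (intro powr_mono2) auto
        then have "1 \<le> \<rho> powr a * r powr (- a)"
          using \<open>0 < r\<close> by (simp add: powr_minus field_simps)
        then have "\<kappa> \<rho> * 1 \<le> \<kappa> \<rho> * (\<rho> powr a * r powr (- a))"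
          using kappa_nonneg by (rule mult_left_mono)
        then show ?thesis by (simp add: mult_ac)
      qed
      then show "ennreal (if r \<le> \<rho> then \<kappa> \<rho> else 0) \<le> ennreal (\<rho> powr a * \<kappa> \<rho>) * ennreal (r powr (- a))"
        by (auto simp: ennreal_mult[symmetric] kappa_nonneg intro!: ennreal_leI)
    qed
    also have "\<dots> = P * ennreal (r powr (- a))" unfolding P_def by (rule nn_integral_multc) measurable
    finally show ?thesis .
  qed
  have "(\<integral>\<^sup>+r. ennreal (cdf_defect r) \<partial>haar)
      \<le> (\<integral>\<^sup>+r. N * (ennreal (r powr a) * indicator {..1} r) + P * (ennreal (r powr (- a)) * indicator {1..} r) \<partial>haar)"
  proof (rule nn_integral_mono_AE)
    show "AE r in haar. ennreal (cdf_defect r)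
      \<le> N * (ennreal (r powr a) * indicator {..1} r) + P * (ennreal (r powr (- a)) * indicator {1..} r)"
      using AE_haar_pos
    proof eventually_elim
      case (elim r)
      show ?case
      proof (cases "1 < r")
        case True
        have "cdf_defect r = 1 - cdf r" using True cdf_le_1[of r] by (simp add: cdf_defect_def)
        then show ?thesis using 2[OF elim] True by simp
      next
        case False
        have "cdf_defect r = cdf r" using False cdf_nonneg[of r] by (simp add: cdf_defect_def)
        then have "ennreal (cdf_defect r) \<le> N * (ennreal (r powr a) * indicator {..1} r)"
          using 1[OF elim] False by simp
        then show ?thesis by (rule order_trans) simp
      qed
    qed
  qed
  also have "\<dots> = N * (\<integral>\<^sup>+r. ennreal (r powr a) * indicator {..1} r \<partial>haar)
      + P * (\<integral>\<^sup>+r. ennreal (r powr (- a)) * indicator {1..} r \<partial>haar)"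
    by (simp add: nn_integral_add nn_integral_cmult)
  also have "\<dots> < \<infinity>"
    using nn_integral_haar_powr_atMost[of a 1] nn_integral_haar_powr_atLeast[of "-a" 1] a_pos
      moment_pos moment_neg
    by (simp add: ennreal_mult_less_top P_def N_def)
  finally show ?thesis .
qed

text \<open>In polar coordinates |z|^(-n) dz is a multiple of dr/r, so the scale r drops
  out.\<close>

lemma nn_integral_cdf_defect_space:
  assumes "0 < r"
  shows "(\<integral>\<^sup>+z. ennreal (norm z powr (- real DIM('a))) * ennreal (cdf_defect (r * norm z))
           \<partial>(lborel :: 'a::euclidean_space measure)) < \<infinity>"
proof (rule nn_integral_radial_finite)
  have "(\<integral>\<^sup>+\<rho>. ennreal (\<rho> powr (- real DIM('a) + real DIM('a))) * ennreal (cdf_defect (r * \<rho>)) \<partial>haar)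
      \<le> (\<integral>\<^sup>+\<rho>. ennreal (cdf_defect (r * \<rho>)) \<partial>haar)"
    by (intro nn_integral_mono) auto
  also have "\<dots> = (\<integral>\<^sup>+\<rho>. ennreal (cdf_defect \<rho>) \<partial>haar)"
    using assms nn_integral_haar_mult[of "\<lambda>\<rho>. ennreal (cdf_defect \<rho>)" r] by simp
  also have "\<dots> < \<infinity>" by (rule nn_integral_cdf_defect)
  finally show "(\<integral>\<^sup>+\<rho>. ennreal (\<rho> powr (- real DIM('a) + real DIM('a))) * ennreal (cdf_defect (r * \<rho>)) \<partial>haar) < \<infinity>" .
qed measurable

text \<open>For nonzero z the density rescaled by |z| still has mass 1, so integrating over rho
  first leaves H z unchanged.\<close>

lemma average_integrable:
  fixes H :: "'a::euclidean_space \<Rightarrow> real"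
  assumes "integrable lborel H"
  shows "integrable haar (\<lambda>\<rho>. \<integral>z. H z * \<kappa> (\<rho> * norm z) \<partial>lborel)"
    and "(\<integral>\<rho>. (\<integral>z. H z * \<kappa> (\<rho> * norm z) \<partial>lborel) \<partial>haar) = (\<integral>z. H z \<partial>lborel)"
proof -
  have [measurable]: "H \<in> borel_measurable borel"
    using assms by (simp add: borel_measurable_integrable)
  have "(\<integral>\<^sup>+z. (\<integral>\<^sup>+\<rho>. ennreal \<bar>H z * \<kappa> (\<rho> * norm z)\<bar> \<partial>haar) \<partial>lborel) = (\<integral>\<^sup>+z. ennreal \<bar>H z\<bar> \<partial>lborel)"
  proof (rule nn_integral_cong_AE)
    show "AE z in lborel. (\<integral>\<^sup>+\<rho>. ennreal \<bar>H z * \<kappa> (\<rho> * norm z)\<bar> \<partial>haar) = ennreal \<bar>H z\<bar>"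
      using AE_lborel_nonzero
      by eventually_elim (simp add: abs_mult kappa_nonneg ennreal_mult nn_integral_cmult kappa_scaled)
  qed
  also have "\<dots> < \<infinity>" using assms by (simp add: integrable_iff_bounded)
  finally have fin: "(\<integral>\<^sup>+z. (\<integral>\<^sup>+\<rho>. ennreal \<bar>H z * \<kappa> (\<rho> * norm z)\<bar> \<partial>haar) \<partial>lborel) < \<infinity>" .
  show "integrable haar (\<lambda>\<rho>. \<integral>z. H z * \<kappa> (\<rho> * norm z) \<partial>lborel)"
    by (rule haar_lborel_Fubini_integral(1)[OF _ fin]) measurable
  have "(\<integral>\<rho>. (\<integral>z. H z * \<kappa> (\<rho> * norm z) \<partial>lborel) \<partial>haar) = (\<integral>z. (\<integral>\<rho>. H z * \<kappa> (\<rho> * norm z) \<partial>haar) \<partial>lborel)"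
    by (rule haar_lborel_Fubini_integral(2)[OF _ fin]) measurable
  also have "\<dots> = (\<integral>z. H z \<partial>lborel)"
  proof (rule integral_cong_AE)
    show "AE z in lborel. (\<integral>\<rho>. H z * \<kappa> (\<rho> * norm z) \<partial>haar) = H z"
      using AE_lborel_nonzero by eventually_elim (simp add: kappa_scaled)
  qed measurable
  finally show "(\<integral>\<rho>. (\<integral>z. H z * \<kappa> (\<rho> * norm z) \<partial>lborel) \<partial>haar) = (\<integral>z. H z \<partial>lborel)" .
qed

end

section \<open>Borderline singularities: averaged against truncated integrals\<close>

lemma tendsto_at_right_0_iff:
  "(f \<longlongrightarrow> l) (at_right (0::real)) \<longleftrightarrow> ((\<lambda>r. f (1 / r)) \<longlongrightarrow> l) at_top"
  using filterlim_at_right_to_top[of f "nhds l"] by (simp add: inverse_eq_divide)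

text \<open>A bound of order |z|^(-n) just fails to be integrable at the origin, so the truncated
  integrals may diverge as the cut-off shrinks. It fails at infinity too, hence the separate tail
  condition.\<close>

locale critical_density = mult_density +
  fixes H :: "'b::euclidean_space \<Rightarrow> real" and C :: real
  assumes H_measurable [measurable]: "H \<in> borel_measurable borel"
    and H_bound: "\<bar>H z\<bar> \<le> C * norm z powr (- real DIM('b))"
    and H_tail: "0 < d \<Longrightarrow> integrable lborel (\<lambda>z. if d < norm z then H z else 0)"
begin

definition truncated :: "real \<Rightarrow> real" where
  "truncated d = (\<integral>z. (if d < norm z then H z else 0) \<partial>lborel)"

definition averaged :: "real \<Rightarrow> real" where
  "averaged r = (\<integral>z. H z * cdf (r * norm z) \<partial>lborel)"

lemma truncated_measurable [measurable]: "truncated \<in> borel_measurable borel"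
  unfolding truncated_def[abs_def] by measurable

lemma C_nonneg: "0 \<le> C"
proof -
  \<comment> \<open>At a basis vector the norm is 1 and the bound reads |H z| <= C.\<close>
  obtain z :: 'b where "z \<in> Basis" by (meson nonempty_Basis ex_in_conv)
  then show ?thesis using H_bound[of z] by simp
qed

text \<open>Inside the ball of radius 1 / r the distribution function coincides with its defect,
  which is integrable against |z|^(-n); outside, \<open>cdf\<close> is at most 1 and the tail of H
  suffices.\<close>

lemma nn_integral_H_cdf:
  assumes r: "0 < r"
  shows "(\<integral>\<^sup>+z. ennreal \<bar>H z * cdf (r * norm z)\<bar> \<partial>lborel) < \<infinity>"
proof -
  have "(\<integral>\<^sup>+z. ennreal \<bar>H z * cdf (r * norm z)\<bar> \<partial>lborel)
     \<le> (\<integral>\<^sup>+z. ennreal C * (ennreal (norm z powr (- real DIM('b))) * ennreal (cdf_defect (r * norm z)))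
         + ennreal \<bar>if 1 / r < norm z then H z else 0\<bar> \<partial>lborel)"
  proof (intro nn_integral_mono)
    fix z :: 'b
    have "\<bar>H z * cdf (r * norm z)\<bar> \<le> C * (norm z powr (- real DIM('b)) * cdf_defect (r * norm z))
       + \<bar>if 1 / r < norm z then H z else 0\<bar>"
    proof -
      have "\<bar>H z\<bar> * cdf (r * norm z) \<le> \<bar>H z\<bar> * cdf_defect (r * norm z) + \<bar>if 1 / r < norm z then H z else 0\<bar>"
      proof (cases "1 / r < norm z")
        case True
        have "\<bar>H z\<bar> * cdf (r * norm z) \<le> \<bar>H z\<bar> * 1"
          by (intro mult_left_mono cdf_le_1) auto
        moreover have "0 \<le> \<bar>H z\<bar> * cdf_defect (r * norm z)" by (simp add: cdf_defect_def)
        ultimately show ?thesis using True by simp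
      next
        case False
        then have "\<not> 1 < r * norm z" using r by (simp add: field_simps)
        then have "cdf_defect (r * norm z) = cdf (r * norm z)"
          by (simp add: cdf_defect_def cdf_nonneg)
        then show ?thesis using False by simp
      qed
      moreover have "\<bar>H z\<bar> * cdf_defect (r * norm z) \<le> C * norm z powr (- real DIM('b)) * cdf_defect (r * norm z)"
        by (intro mult_right_mono H_bound) (simp add: cdf_defect_def)
      ultimately show ?thesis by (simp add: abs_mult cdf_nonneg mult_ac)
    qed
    also have "ennreal \<dots> = ennreal C * (ennreal (norm z powr (- real DIM('b))) * ennreal (cdf_defect (r * norm z)))
         + ennreal \<bar>if 1 / r < norm z then H z else 0\<bar>"
      using C_nonneg by (subst ennreal_plus) (auto simp: ennreal_mult cdf_defect_def)
    finally show "ennreal \<bar>H z * cdf (r * norm z)\<bar> \<le> \<dots>"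
      by (simp add: ennreal_leI)
  qed
  also have "\<dots> = ennreal C * (\<integral>\<^sup>+z. ennreal (norm z powr (- real DIM('b))) * ennreal (cdf_defect (r * norm z)) \<partial>(lborel :: 'b measure))
      + (\<integral>\<^sup>+z. ennreal \<bar>if 1 / r < norm z then H z else 0\<bar> \<partial>lborel)"
    by (subst nn_integral_add, measurable) (subst nn_integral_cmult, measurable)
  also have "\<dots> < \<infinity>"
    using nn_integral_cdf_defect_space[OF r, where 'a='b] H_tail[of "1 / r"] r
    by (simp add: ennreal_mult_less_top integrable_iff_bounded)
  finally show ?thesis .
qed

lemma integrable_H_cdf: "0 < r \<Longrightarrow> integrable lborel (\<lambda>z. H z * cdf (r * norm z))"
  using nn_integral_H_cdf[of r] by (simp add: integrable_iff_bounded)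

text \<open>For nonzero z the density at scale |z|, integrated over rho < r, gives
  \<open>cdf (r * norm z)\<close>. This is the form in which the t-integral up to r^2
  appears.\<close>

lemma averaged_eq_partial:
  assumes r: "0 < r"
  shows "integrable haar (\<lambda>\<rho>. (if \<rho> < r then (\<integral>z. H z * \<kappa> (\<rho> * norm z) \<partial>lborel) else 0))"
    and "(\<integral>\<rho>. (if \<rho> < r then (\<integral>z. H z * \<kappa> (\<rho> * norm z) \<partial>lborel) else 0) \<partial>haar) = averaged r"
proof -
  have eq: "(if \<rho> < r then (\<integral>z. H z * \<kappa> (\<rho> * norm z) \<partial>lborel) else 0)
     = (\<integral>z. H z * (if \<rho> < r then \<kappa> (\<rho> * norm z) else 0) \<partial>lborel)" for \<rho>
    by simp
  have "(\<integral>\<^sup>+z. (\<integral>\<^sup>+\<rho>. ennreal \<bar>H z * (if \<rho> < r then \<kappa> (\<rho> * norm z) else 0)\<bar> \<partial>haar) \<partial>lborel)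
     = (\<integral>\<^sup>+z. ennreal \<bar>H z * cdf (r * norm z)\<bar> \<partial>lborel)"
  proof (rule nn_integral_cong_AE)
    show "AE z in lborel. (\<integral>\<^sup>+\<rho>. ennreal \<bar>H z * (if \<rho> < r then \<kappa> (\<rho> * norm z) else 0)\<bar> \<partial>haar)
      = ennreal \<bar>H z * cdf (r * norm z)\<bar>"
      using AE_lborel_nonzero
    proof eventually_elim
      case (elim z)
      have "(\<integral>\<^sup>+\<rho>. ennreal \<bar>H z * (if \<rho> < r then \<kappa> (\<rho> * norm z) else 0)\<bar> \<partial>haar)
         = (\<integral>\<^sup>+\<rho>. ennreal \<bar>H z\<bar> * ennreal (if \<rho> < r then \<kappa> (\<rho> * norm z) else 0) \<partial>haar)"
        by (intro nn_integral_cong) (auto simp: abs_mult kappa_nonneg ennreal_mult)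
      also have "\<dots> = ennreal \<bar>H z\<bar> * ennreal (cdf (r * norm z))"
        using elim by (subst nn_integral_cmult, measurable) (subst cdf_scaled(1), auto)
      finally show ?case by (simp add: abs_mult cdf_nonneg ennreal_mult)
    qed
  qed
  also have "\<dots> < \<infinity>" by (rule nn_integral_H_cdf[OF r])
  finally have fin: "(\<integral>\<^sup>+z. (\<integral>\<^sup>+\<rho>. ennreal \<bar>H z * (if \<rho> < r then \<kappa> (\<rho> * norm z) else 0)\<bar> \<partial>haar) \<partial>lborel) < \<infinity>" .
  show "integrable haar (\<lambda>\<rho>. (if \<rho> < r then (\<integral>z. H z * \<kappa> (\<rho> * norm z) \<partial>lborel) else 0))"
    unfolding eq by (rule haar_lborel_Fubini_integral(1)[OF _ fin]) measurable
  have "(\<integral>\<rho>. (\<integral>z. H z * (if \<rho> < r then \<kappa> (\<rho> * norm z) else 0) \<partial>lborel) \<partial>haar)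
     = (\<integral>z. (\<integral>\<rho>. H z * (if \<rho> < r then \<kappa> (\<rho> * norm z) else 0) \<partial>haar) \<partial>lborel)"
    by (rule haar_lborel_Fubini_integral(2)[OF _ fin]) measurable
  also have "\<dots> = averaged r"
    unfolding averaged_def
  proof (rule integral_cong_AE)
    show "AE z in lborel. (\<integral>\<rho>. H z * (if \<rho> < r then \<kappa> (\<rho> * norm z) else 0) \<partial>haar) = H z * cdf (r * norm z)"
      using AE_lborel_nonzero by eventually_elim (simp add: cdf_scaled(2))
  qed measurable
  finally show "(\<integral>\<rho>. (if \<rho> < r then (\<integral>z. H z * \<kappa> (\<rho> * norm z) \<partial>lborel) else 0) \<partial>haar) = averaged r"
    unfolding eq .
qed

text \<open>Here \<open>cdf (r * norm z)\<close> is read as an integral of the unscaled density over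
  rho < r |z|. After swapping, each rho contributes the sharp truncation at radius rho / r.\<close>

lemma averaged_eq_mean:
  assumes r: "0 < r"
  shows "averaged r = (\<integral>\<rho>. \<kappa> \<rho> * truncated (\<rho> / r) \<partial>haar)"
proof -
  have eq: "\<kappa> \<rho> * truncated (\<rho> / r) = (\<integral>z. H z * (if \<rho> < r * norm z then \<kappa> \<rho> else 0) \<partial>lborel)" for \<rho>
  proof -
    have "\<kappa> \<rho> * truncated (\<rho> / r) = (\<integral>z. \<kappa> \<rho> * (if \<rho> / r < norm z then H z else 0) \<partial>lborel)"
      by (simp add: truncated_def)
    also have "\<dots> = (\<integral>z. H z * (if \<rho> < r * norm z then \<kappa> \<rho> else 0) \<partial>lborel)"
      using r by (intro Bochner_Integration.integral_cong) (auto simp: field_simps)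
    finally show ?thesis .
  qed
  have "(\<integral>\<^sup>+z. (\<integral>\<^sup>+\<rho>. ennreal \<bar>H z * (if \<rho> < r * norm z then \<kappa> \<rho> else 0)\<bar> \<partial>haar) \<partial>lborel)
     = (\<integral>\<^sup>+z. ennreal \<bar>H z * cdf (r * norm z)\<bar> \<partial>lborel)"
  proof (intro nn_integral_cong)
    fix z :: 'b
    have "(\<integral>\<^sup>+\<rho>. ennreal \<bar>H z * (if \<rho> < r * norm z then \<kappa> \<rho> else 0)\<bar> \<partial>haar)
       = (\<integral>\<^sup>+\<rho>. ennreal \<bar>H z\<bar> * ennreal (if \<rho> < r * norm z then \<kappa> \<rho> else 0) \<partial>haar)"
      by (intro nn_integral_cong) (auto simp: abs_mult kappa_nonneg ennreal_mult)
    also have "\<dots> = ennreal \<bar>H z\<bar> * ennreal (cdf (r * norm z))"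
      unfolding cdf_nn by (rule nn_integral_cmult) measurable
    finally show "(\<integral>\<^sup>+\<rho>. ennreal \<bar>H z * (if \<rho> < r * norm z then \<kappa> \<rho> else 0)\<bar> \<partial>haar) = ennreal \<bar>H z * cdf (r * norm z)\<bar>"
      by (simp add: abs_mult cdf_nonneg ennreal_mult)
  qed
  also have "\<dots> < \<infinity>" by (rule nn_integral_H_cdf[OF r])
  finally have fin: "(\<integral>\<^sup>+z. (\<integral>\<^sup>+\<rho>. ennreal \<bar>H z * (if \<rho> < r * norm z then \<kappa> \<rho> else 0)\<bar> \<partial>haar) \<partial>lborel) < \<infinity>" .
  have "(\<integral>\<rho>. \<kappa> \<rho> * truncated (\<rho> / r) \<partial>haar)
     = (\<integral>z. (\<integral>\<rho>. H z * (if \<rho> < r * norm z then \<kappa> \<rho> else 0) \<partial>haar) \<partial>lborel)"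
    unfolding eq by (rule haar_lborel_Fubini_integral(2)[OF _ fin]) measurable
  also have "\<dots> = averaged r"
    unfolding averaged_def cdf_def by simp
  finally show ?thesis ..
qed

text \<open>The Abelian direction: for each fixed rho the radius rho / r tends to 0. Domination
  needs one bound for all truncations, obtained from the limit near 0 and from the integrable tail
  elsewhere.\<close>

lemma averaged_tendsto:
  assumes lim: "(truncated \<longlongrightarrow> M) (at_right 0)"
  shows "(averaged \<longlongrightarrow> M) at_top"
proof -
  from tendstoD[OF lim, of 1] obtain d where d: "0 < d" "\<And>e. 0 < e \<Longrightarrow> e < d \<Longrightarrow> dist (truncated e) M < 1"
    unfolding eventually_at_right_field by auto
  define N where "N = (\<integral>z. \<bar>if d / 2 < norm z then H z else 0\<bar> \<partial>lborel)"
  define B where "B = \<bar>M\<bar> + 1 + N"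
  have N0: "0 \<le> N" unfolding N_def by simp
  have bd: "\<bar>truncated e\<bar> \<le> B" if "0 < e" for e
  proof (cases "e < d")
    case True
    then show ?thesis using d(2)[of e] that N0 by (auto simp: B_def dist_real_def)
  next
    case False
    have "\<bar>truncated e\<bar> \<le> (\<integral>z. \<bar>if e < norm z then H z else 0\<bar> \<partial>lborel)"
      unfolding truncated_def by (rule integral_abs_bound)
    also have "\<dots> \<le> N"
      unfolding N_def using False d(1) H_tail[of e] H_tail[of "d / 2"]
      by (intro integral_mono) auto
    finally show ?thesis by (simp add: B_def)
  qed
  have "((\<lambda>r. \<integral>\<rho>. \<kappa> \<rho> * truncated (\<rho> / r) \<partial>haar) \<longlongrightarrow> (\<integral>\<rho>. \<kappa> \<rho> * M \<partial>haar)) at_top"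
  proof (rule integral_dominated_convergence_at_top)
    show "integrable haar (\<lambda>\<rho>. \<kappa> \<rho> * B)"
      using integrable_kappa by simp
    show "\<forall>\<^sub>F r in at_top. AE \<rho> in haar. norm (\<kappa> \<rho> * truncated (\<rho> / r)) \<le> \<kappa> \<rho> * B"
      using eventually_gt_at_top[of 0]
    proof eventually_elim
      case (elim r)
      show ?case using AE_haar_pos
        by eventually_elim
           (use elim in \<open>auto simp: abs_mult kappa_nonneg intro!: mult_left_mono bd\<close>)
    qed
    show "AE \<rho> in haar. ((\<lambda>r. \<kappa> \<rho> * truncated (\<rho> / r)) \<longlongrightarrow> \<kappa> \<rho> * M) at_top"
      using AE_haar_pos
    proof eventually_elim
      case (elim \<rho>)
      have "filterlim (\<lambda>r. \<rho> / r) (at_right 0) at_top"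
        unfolding filterlim_at
      proof
        show "\<forall>\<^sub>F r in at_top. \<rho> / r \<in> {0<..} \<and> \<rho> / r \<noteq> 0"
          using eventually_gt_at_top[of 0] by eventually_elim (use elim in auto)
        show "((\<lambda>r. \<rho> / r) \<longlongrightarrow> 0) at_top"
          by (rule tendsto_divide_0[OF tendsto_const]) (simp add: filterlim_at_top_imp_at_infinity filterlim_ident)
      qed
      then have "((\<lambda>r. truncated (\<rho> / r)) \<longlongrightarrow> M) at_top"
        by (rule filterlim_compose[OF lim])
      then show ?case by (intro tendsto_mult tendsto_const)
    qed
  qed measurable
  then have "((\<lambda>r. \<integral>\<rho>. \<kappa> \<rho> * truncated (\<rho> / r) \<partial>haar) \<longlongrightarrow> M) at_top"
    by (simp add: integral_kappa)
  then show ?thesis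
    by (rule Lim_transform_eventually)
       (use eventually_gt_at_top[of 0] in eventually_elim, simp add: averaged_eq_mean)
qed

text \<open>Rescaling by r turns the difference into an integral of H (w / r) r^(-n) against a fixed
  function, \<open>cdf\<close> minus the unit step, with the majorant C |w|^(-n)
  \<open>cdf_defect (norm w)\<close> independent of r. The blow-up h need not vanish, so nothing is
  yet known about the value of D.\<close>

lemma averaged_minus_truncated:
  assumes lim: "\<And>w. w \<noteq> 0 \<Longrightarrow> ((\<lambda>r. H ((1 / r) *\<^sub>R w) * (1 / r) ^ DIM('b)) \<longlongrightarrow> h w) at_top"
    and [measurable]: "h \<in> borel_measurable borel"
  shows "\<exists>D. ((\<lambda>r. averaged r - truncated (1 / r)) \<longlongrightarrow> D) at_top"
proof -
  let ?g = "\<lambda>w::'b. cdf (norm w) - (if 1 < norm w then 1 else 0)"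
  have eq: "averaged r - truncated (1 / r) = (\<integral>w. H ((1 / r) *\<^sub>R w) * (1 / r) ^ DIM('b) * ?g w \<partial>lborel)"
    if r: "0 < r" for r
  proof -
    have "averaged r - truncated (1 / r) = (\<integral>z. H z * cdf (r * norm z) - (if 1 / r < norm z then H z else 0) \<partial>lborel)"
      unfolding averaged_def truncated_def using r
      by (intro Bochner_Integration.integral_diff[symmetric] integrable_H_cdf H_tail) auto
    also have "\<dots> = (\<integral>w. (H ((1 / r) *\<^sub>R w) * cdf (r * norm ((1 / r) *\<^sub>R w))
        - (if 1 / r < norm ((1 / r) *\<^sub>R w) then H ((1 / r) *\<^sub>R w) else 0)) * (1 / r) ^ DIM('b) \<partial>lborel)"
      using r by (intro integral_lborel_scale) auto
    also have "\<dots> = (\<integral>w. H ((1 / r) *\<^sub>R w) * (1 / r) ^ DIM('b) * ?g w \<partial>lborel)"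
      using r by (intro Bochner_Integration.integral_cong) (auto simp: field_simps)
    finally show ?thesis .
  qed
  have "((\<lambda>r. \<integral>w. H ((1 / r) *\<^sub>R w) * (1 / r) ^ DIM('b) * ?g w \<partial>lborel)
     \<longlongrightarrow> (\<integral>w. h w * ?g w \<partial>lborel)) at_top"
  proof (rule integral_dominated_convergence_at_top)
    have "integrable lborel (\<lambda>w::'b. norm w powr (- real DIM('b)) * cdf_defect (1 * norm w))"
      using nn_integral_cdf_defect_space[of 1, where 'a='b]
      by (intro integrableI_nonneg) (auto simp: ennreal_mult cdf_defect_def)
    then show "integrable lborel (\<lambda>w::'b. C * (norm w powr (- real DIM('b)) * cdf_defect (norm w)))"
      by simp
    show "\<forall>\<^sub>F r in at_top. AE w in lborel. norm (H ((1 / r) *\<^sub>R w) * (1 / r) ^ DIM('b) * ?g w)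
        \<le> C * (norm w powr (- real DIM('b)) * cdf_defect (norm w))"
      using eventually_gt_at_top[of 0]
    proof eventually_elim
      case (elim r)
      show ?case using AE_lborel_nonzero
      proof eventually_elim
        case (elim w)
        have "\<bar>H ((1 / r) *\<^sub>R w)\<bar> * (1 / r) ^ DIM('b)
           \<le> C * norm ((1 / r) *\<^sub>R w) powr (- real DIM('b)) * (1 / r) ^ DIM('b)"
          using \<open>0 < r\<close> by (intro mult_right_mono H_bound) auto
        also have "\<dots> = C * norm w powr (- real DIM('b))"
          using \<open>0 < r\<close> elim
          by (simp add: powr_minus powr_realpow power_divide field_simps)
        finally have "\<bar>H ((1 / r) *\<^sub>R w)\<bar> * (1 / r) ^ DIM('b) * cdf_defect (norm w)
           \<le> C * norm w powr (- real DIM('b)) * cdf_defect (norm w)"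
          by (rule mult_right_mono) (simp add: cdf_defect_def)
        then show ?case
          using \<open>0 < r\<close> by (simp add: abs_mult cdf_defect_def mult.assoc)
      qed
    qed
    show "AE w in lborel. ((\<lambda>r. H ((1 / r) *\<^sub>R w) * (1 / r) ^ DIM('b) * ?g w) \<longlongrightarrow> h w * ?g w) at_top"
      using AE_lborel_nonzero
      by eventually_elim (intro tendsto_mult lim tendsto_const)
  qed measurable
  then have "((\<lambda>r. averaged r - truncated (1 / r)) \<longlongrightarrow> (\<integral>w. h w * ?g w \<partial>lborel)) at_top"
    by (rule Lim_transform_eventually)
       (use eventually_gt_at_top[of 0] in eventually_elim, simp add: eq)
  then show ?thesis by blast
qed

text \<open>The Tauberian direction is drawn from the Abelian one: if \<open>averaged\<close> tends
  to a finite M, then \<open>truncated\<close> tends to M - D, hence so does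
  \<open>averaged\<close>, and D = 0. Infinite limits absorb D.\<close>

lemma averaged_iff_truncated:
  fixes L :: ereal
  assumes lim: "\<And>w. w \<noteq> 0 \<Longrightarrow> ((\<lambda>r. H ((1 / r) *\<^sub>R w) * (1 / r) ^ DIM('b)) \<longlongrightarrow> h w) at_top"
    and h: "h \<in> borel_measurable borel"
  shows "((\<lambda>e. ereal (truncated e)) \<longlongrightarrow> L) (at_right 0) \<longleftrightarrow> ((\<lambda>r. ereal (averaged r)) \<longlongrightarrow> L) at_top"
proof -
  obtain D where D: "((\<lambda>r. averaged r - truncated (1 / r)) \<longlongrightarrow> D) at_top"
    using averaged_minus_truncated[OF lim h] by blast
  have Dneg: "((\<lambda>r. truncated (1 / r) - averaged r) \<longlongrightarrow> - D) at_top"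
    using tendsto_minus[OF D] by simp
  have to_avg: "((\<lambda>r. ereal (averaged r)) \<longlongrightarrow> l + ereal D) at_top"
    if "((\<lambda>r. ereal (truncated (1 / r))) \<longlongrightarrow> l) at_top" for l
  proof -
    have "((\<lambda>r. ereal (truncated (1 / r)) + ereal (averaged r - truncated (1 / r))) \<longlongrightarrow> l + ereal D) at_top"
      using that D by (intro tendsto_add_ereal_general) (auto intro!: tendsto_intros)
    then show ?thesis by simp
  qed
  have to_trunc: "((\<lambda>r. ereal (truncated (1 / r))) \<longlongrightarrow> l + ereal (- D)) at_top"
    if "((\<lambda>r. ereal (averaged r)) \<longlongrightarrow> l) at_top" for l
  proof -
    have "((\<lambda>r. ereal (averaged r) + ereal (truncated (1 / r) - averaged r)) \<longlongrightarrow> l + ereal (- D)) at_top"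
      using that Dneg by (intro tendsto_add_ereal_general) (auto intro!: tendsto_intros)
    then show ?thesis by simp
  qed
  have D0: "D = 0" if "(truncated \<longlongrightarrow> M) (at_right 0)" for M
  proof -
    have "(averaged \<longlongrightarrow> M) at_top" by (rule averaged_tendsto[OF that])
    moreover have "((\<lambda>r. truncated (1 / r)) \<longlongrightarrow> M) at_top" using that by (simp add: tendsto_at_right_0_iff)
    ultimately have "((\<lambda>r. averaged r - truncated (1 / r)) \<longlongrightarrow> M - M) at_top"
      by (rule tendsto_diff)
    with D show ?thesis using tendsto_unique[OF trivial_limit_at_top_linorder] by fastforce
  qed
  show ?thesis
  proof
    assume "((\<lambda>e. ereal (truncated e)) \<longlongrightarrow> L) (at_right 0)"
    then have L: "((\<lambda>r. ereal (truncated (1 / r))) \<longlongrightarrow> L) at_top" by (simp add: tendsto_at_right_0_iff)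
    have "L + ereal D = L"
    proof (cases L)
      case (real M)
      then have "D = 0" using \<open>((\<lambda>e. ereal (truncated e)) \<longlongrightarrow> L) (at_right 0)\<close> by (intro D0[of M]) simp
      then show ?thesis by simp
    qed auto
    then show "((\<lambda>r. ereal (averaged r)) \<longlongrightarrow> L) at_top" using to_avg[OF L] by simp
  next
    assume L: "((\<lambda>r. ereal (averaged r)) \<longlongrightarrow> L) at_top"
    have "L + ereal (- D) = L"
    proof (cases L)
      case (real M)
      then have "((\<lambda>r. ereal (truncated (1 / r))) \<longlongrightarrow> ereal (M - D)) at_top"
        using to_trunc[OF L] by simp
      then have "((\<lambda>r. truncated (1 / r)) \<longlongrightarrow> M - D) at_top" by simp
      then have "(truncated \<longlongrightarrow> M - D) (at_right 0)" by (simp add: tendsto_at_right_0_iff)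
      then have "D = 0" by (rule D0)
      then show ?thesis by simp
    qed auto
    then have "((\<lambda>r. ereal (truncated (1 / r))) \<longlongrightarrow> L) at_top" using to_trunc[OF L] by simp
    then show "((\<lambda>e. ereal (truncated e)) \<longlongrightarrow> L) (at_right 0)" by (simp add: tendsto_at_right_0_iff)
  qed
qed

end

section \<open>The odd power nonlinearity\<close>

lemma Phi_0 [simp]: "Phi p 0 = 0"
  by (simp add: Phi_def)

lemma Phi_minus [simp]: "Phi p (- t) = - Phi p t"
  by (simp add: Phi_def)

lemma Phi_measurable [measurable]: "Phi p \<in> borel_measurable borel"
  unfolding Phi_def[abs_def] by measurable

lemma Phi_pos: "0 < t \<Longrightarrow> Phi p t = t powr (p - 1)"
  using powr_add[of t "p - 2" 1] by (simp add: Phi_def)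

lemma abs_Phi: "\<bar>Phi p t\<bar> = \<bar>t\<bar> powr (p - 1)"
  using powr_add[of "\<bar>t\<bar>" "p - 2" 1] by (cases "t = 0") (simp_all add: Phi_def abs_mult)

lemma Phi_mult: "0 < l \<Longrightarrow> Phi p (l * t) = l powr (p - 1) * Phi p t"
  using powr_add[of l "p - 2" 1] by (simp add: Phi_def abs_mult powr_mult)

text \<open>For p < 2 the derivative is worst at the smaller modulus, yet the larger one may be
  used: for 0 < c <= a, c^(p-1) >= c a^(p-2). The constant p + 1 dominates the factors 1, 2 and p -
  1 coming from p < 2, from opposite signs and from the mean value theorem.\<close>

lemma Phi_diff_le:
  assumes p: "1 < p"
  shows "\<bar>Phi p a - Phi p c\<bar> \<le> (p + 1) * (max \<bar>a\<bar> \<bar>c\<bar> powr (p - 2) * \<bar>a - c\<bar>)"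
proof -
  \<comment> \<open>By oddness of Phi and symmetry in a and c it suffices to treat this
    case.\<close>
  have pos: "\<bar>Phi p a - Phi p c\<bar> \<le> (p + 1) * (a powr (p - 2) * (a - c))"
    if a: "0 < a" and ca: "\<bar>c\<bar> \<le> a" for a c
  proof (cases "c \<le> 0")
    case True
    have "\<bar>Phi p a - Phi p c\<bar> \<le> \<bar>Phi p a\<bar> + \<bar>Phi p c\<bar>" by simp
    also have "\<dots> = a powr (p - 1) + \<bar>c\<bar> powr (p - 1)"
      using a by (simp add: abs_Phi)
    also have "\<bar>c\<bar> powr (p - 1) \<le> a powr (p - 1)"
      using ca p by (intro powr_mono2) auto
    also have "a powr (p - 1) + a powr (p - 1) = 2 * (a powr (p - 2) * a)"
      using a powr_add[of a "p - 2" 1] by simp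
    also have "\<dots> \<le> (p + 1) * (a powr (p - 2) * (a - c))"
      using a p True by (intro mult_mono mult_left_mono) auto
    finally show ?thesis by simp
  next
    case False
    then have c: "0 < c" "c \<le> a" using ca by auto
    have le: "c powr (p - 1) \<le> a powr (p - 1)"
      using c p by (intro powr_mono2) auto
    have "a powr (p - 1) - c powr (p - 1) \<le> (p + 1) * (a powr (p - 2) * (a - c))"
    proof (cases "p < 2")
      case True
      have "a powr (p - 2) \<le> c powr (p - 2)"
        using c True by (intro powr_mono2') auto
      then have "c * a powr (p - 2) \<le> c * c powr (p - 2)"
        using c by (intro mult_left_mono) auto
      moreover have "a powr (p - 1) = a * a powr (p - 2)" "c powr (p - 1) = c * c powr (p - 2)"
        using a c powr_add[of a 1 "p - 2"] powr_add[of c 1 "p - 2"] by simp_all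
      ultimately have "a powr (p - 1) - c powr (p - 1) \<le> 1 * (a powr (p - 2) * (a - c))"
        by (simp add: algebra_simps)
      also have "\<dots> \<le> (p + 1) * (a powr (p - 2) * (a - c))"
        using p c by (intro mult_right_mono) auto
      finally show ?thesis .
    next
      case False
      show ?thesis
      proof (cases "c = a")
        case neq: False
        with c have ca: "c < a" by simp
        have "\<exists>z>c. z < a \<and> a powr (p - 1) - c powr (p - 1) = (a - c) * ((p - 1) * z powr (p - 1 - 1))"
          using c by (intro MVT2[OF ca]) (auto intro!: derivative_eq_intros)
        then obtain z where z: "c < z" "z < a"
          "a powr (p - 1) - c powr (p - 1) = (a - c) * ((p - 1) * z powr (p - 2))"
          by auto
        have "z powr (p - 2) \<le> a powr (p - 2)"
          using z c False by (intro powr_mono2) auto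
        then have "(a - c) * ((p - 1) * z powr (p - 2)) \<le> (a - c) * ((p + 1) * a powr (p - 2))"
          using ca p by (intro mult_left_mono mult_mono) auto
        then show ?thesis unfolding z(3) by (simp add: mult_ac)
      qed simp
    qed
    then show ?thesis
      using le a c by (simp add: Phi_pos)
  qed
  have main: "\<bar>Phi p a - Phi p c\<bar> \<le> (p + 1) * (\<bar>a\<bar> powr (p - 2) * \<bar>a - c\<bar>)"
    if "\<bar>c\<bar> \<le> \<bar>a\<bar>" for a c
  proof (cases "a = 0")
    case True
    then show ?thesis using that by simp
  next
    case False
    show ?thesis
    proof (cases "0 < a")
      case True
      then show ?thesis using pos[of a c] that by auto
    next
      case neg: False
      have "\<bar>Phi p (- a) - Phi p (- c)\<bar> \<le> (p + 1) * ((- a) powr (p - 2) * (- a - - c))"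
        using neg False that by (intro pos) auto
      moreover have "\<bar>Phi p (- a) - Phi p (- c)\<bar> = \<bar>Phi p a - Phi p c\<bar>" by simp
      moreover have "- a - - c = \<bar>a - c\<bar>" "- a = \<bar>a\<bar>" using neg that by auto
      ultimately show ?thesis by metis
    qed
  qed
  show ?thesis
  proof (cases "\<bar>c\<bar> \<le> \<bar>a\<bar>")
    case True
    then show ?thesis using main[of c a] by (simp add: max_def)
  next
    case False
    then show ?thesis using main[of a c] by (simp add: max_def abs_minus_commute)
  qed
qed

text \<open>The distance |a - c| is at most twice the larger modulus, and the exponent p - 2 is
  negative.\<close>

lemma Phi_diff_le_Holder:
  assumes p: "1 < p" "p < 2"
  shows "\<bar>Phi p a - Phi p c\<bar> \<le> (p + 1) * 2 powr (2 - p) * \<bar>a - c\<bar> powr (p - 1)"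
proof (cases "a = c")
  case False
  have "\<bar>Phi p a - Phi p c\<bar> \<le> (p + 1) * (max \<bar>a\<bar> \<bar>c\<bar> powr (p - 2) * \<bar>a - c\<bar>)"
    by (rule Phi_diff_le[OF p(1)])
  also have "max \<bar>a\<bar> \<bar>c\<bar> powr (p - 2) \<le> (\<bar>a - c\<bar> / 2) powr (p - 2)"
    using False p by (intro powr_mono2') auto
  also have "(\<bar>a - c\<bar> / 2) powr (p - 2) * \<bar>a - c\<bar> = 2 powr (2 - p) * \<bar>a - c\<bar> powr (p - 1)"
    using False powr_add[of "\<bar>a - c\<bar>" "p - 2" 1] powr_minus_divide[of 2 "2 - p"]
    by (simp add: powr_divide)
  finally show ?thesis using p by (simp add: mult.assoc mult_right_mono)
qed simp

lemma isCont_Phi: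
  assumes "1 < p"
  shows "isCont (Phi p) t"
proof (cases "t = 0")
  case True
  \<comment> \<open>For p < 2 the factor |t|^(p-2) blows up at 0; only the product |t|^(p-1) tends
    to 0.\<close>
  have "((\<lambda>x. \<bar>x\<bar> powr (p - 1)) \<longlongrightarrow> 0) (at 0)"
    using assms by (intro tendsto_zero_powrI) (auto intro!: tendsto_eq_intros)
  then have "((\<lambda>x. \<bar>Phi p x\<bar>) \<longlongrightarrow> 0) (at 0)" by (simp add: abs_Phi)
  then have "(Phi p \<longlongrightarrow> 0) (at 0)" by (rule tendsto_rabs_zero_cancel)
  then show ?thesis using True by (simp add: isCont_def)
next
  case False
  then show ?thesis unfolding Phi_def[abs_def] by (intro continuous_intros) auto
qed

section \<open>Second order Taylor expansion\<close>

text \<open>Cauchy-Schwarz in each row; bounding the Euclidean norm by the l1 norm costs the factor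
  n, whose size is immaterial.\<close>

lemma abs_inner_matrix_le:
  fixes A :: "real^'n^'n" and z :: "real^'n"
  shows "\<bar>z \<bullet> (A *v z)\<bar> \<le> CARD('n) * norm A * (norm z)\<^sup>2"
proof -
  have "norm (A *v z) \<le> (\<Sum>i\<in>UNIV. \<bar>(A *v z) $ i\<bar>)"
    by (rule norm_le_l1_cart)
  also have "\<dots> \<le> (\<Sum>i\<in>(UNIV::'n set). norm A * norm z)"
  proof (rule sum_mono)
    fix i :: 'n
    have "\<bar>(A *v z) $ i\<bar> \<le> norm (A $ i) * norm z"
      by (simp add: matrix_vector_mul_component Cauchy_Schwarz_ineq2)
    also have "\<dots> \<le> norm A * norm z"
      by (intro mult_right_mono Finite_Cartesian_Product.norm_nth_le) auto
    finally show "\<bar>(A *v z) $ i\<bar> \<le> norm A * norm z" .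
  qed
  also have "\<dots> = CARD('n) * (norm A * norm z)" by simp
  finally have "norm z * norm (A *v z) \<le> norm z * (CARD('n) * (norm A * norm z))"
    by (intro mult_left_mono) auto
  then show ?thesis
    using Cauchy_Schwarz_ineq2[of z "A *v z"] by (simp add: power2_eq_square mult_ac)
qed

lemma gradient_eq:
  assumes "GDERIV u x :> g"
  shows "gradient u x = g"
proof -
  have "g' = g" if "GDERIV u x :> g'" for g'
  proof -
    have "(\<lambda>h. h \<bullet> g') = (\<lambda>h. h \<bullet> g)"
      using that assms unfolding gderiv_def by (rule has_derivative_unique)
    then have "\<forall>h. h \<bullet> g' = h \<bullet> g" by (simp add: fun_eq_iff)
    then show ?thesis by (simp only: vector_eq_ldot)
  qed
  then show ?thesis unfolding gradient_def by (intro the_equality assms)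
qed

lemma Taylor_C2:
  fixes u :: "real^'n \<Rightarrow> real"
  assumes g: "\<And>x. GDERIV u x :> g x"
    and A: "\<And>x. (g has_derivative (\<lambda>h. A x *v h)) (at x)"
  shows "\<exists>\<xi>. 0 \<le> \<xi> \<and> \<xi> \<le> 1 \<and> u (x + z) = u x + z \<bullet> g x + z \<bullet> (A (x + \<xi> *\<^sub>R z) *v z) / 2"
proof -
  \<comment> \<open>For m = 0, 1, 2 this is the m-th derivative of t -> u (x + t z), to which the
    Maclaurin expansion on [0, 1] is applied.\<close>
  define D where "D m t = (if m = 0 then u (x + t *\<^sub>R z) else if m = 1 then z \<bullet> g (x + t *\<^sub>R z)
     else z \<bullet> (A (x + t *\<^sub>R z) *v z))" for m :: nat and t :: real
  have line: "((\<lambda>t. x + t *\<^sub>R z) has_derivative (\<lambda>h. h *\<^sub>R z)) (at t)" for t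
    by (auto intro!: derivative_eq_intros)
  have 0: "DERIV (D 0) t :> D 1 t" for t
  proof -
    have "((\<lambda>t. u (x + t *\<^sub>R z)) has_derivative (\<lambda>h. (h *\<^sub>R z) \<bullet> g (x + t *\<^sub>R z))) (at t)"
      by (rule has_derivative_compose[OF line]) (use g in \<open>simp add: gderiv_def\<close>)
    then show ?thesis
      by (simp add: D_def[abs_def] has_field_derivative_def mult.commute[of _ "_ \<bullet> _"])
  qed
  have 1: "DERIV (D 1) t :> D 2 t" for t
  proof -
    have "((\<lambda>t. g (x + t *\<^sub>R z)) has_derivative (\<lambda>h. A (x + t *\<^sub>R z) *v (h *\<^sub>R z))) (at t)"
      by (rule has_derivative_compose[OF line A])
    then have "((\<lambda>t. z \<bullet> g (x + t *\<^sub>R z)) has_derivative (\<lambda>h. z \<bullet> (A (x + t *\<^sub>R z) *v (h *\<^sub>R z)))) (at t)"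
      by (rule has_derivative_inner_right)
    then show ?thesis
      by (simp add: D_def[abs_def] has_field_derivative_def matrix_vector_mult_scaleR mult.commute[of _ "_ \<bullet> _"])
  qed
  have "\<exists>t. 0 < t \<and> t \<le> 1 \<and> D 0 1 = (\<Sum>m<2. D m 0 / fact m * 1 ^ m) + D 2 t / fact 2 * 1 ^ 2"
  proof (rule Maclaurin2)
    show "\<forall>m t. m < 2 \<and> 0 \<le> t \<and> t \<le> 1 \<longrightarrow> DERIV (D m) t :> D (Suc m) t"
    proof (intro allI impI)
      fix m :: nat and t :: real
      assume "m < 2 \<and> 0 \<le> t \<and> t \<le> 1"
      then have "m = 0 \<or> m = 1" by auto
      then show "DERIV (D m) t :> D (Suc m) t"
        using 0[of t] 1[of t] by (auto simp: numeral_2_eq_2)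
    qed
  qed auto
  then obtain t where t: "0 < t" "t \<le> 1" "D 0 1 = D 0 0 + D 1 0 + D 2 t / 2"
    by (auto simp: numeral_2_eq_2)
  then show ?thesis
    by (intro exI[of _ t]) (simp add: D_def)
qed

section \<open>Integrability of a negative power of a linear form\<close>

lemma nn_integral_abs_powr_finite:
  fixes q :: real
  assumes "-1 < q" "0 < R"
  shows "(\<integral>\<^sup>+y. ennreal (\<bar>y\<bar> powr q) * indicator {-R..R} y \<partial>lborel) < \<infinity>"
proof -
  let ?f = "\<lambda>y. ennreal (y powr q) * indicator {0<..R} y"
  have pos: "(\<integral>\<^sup>+y. ?f y \<partial>lborel) < \<infinity>"
  proof -
    have "(\<integral>\<^sup>+y. ennreal (y powr (q + 1)) * indicator {..R} y \<partial>haar) = (\<integral>\<^sup>+y. ?f y \<partial>lborel)"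
      by (subst nn_integral_haar)
         (auto intro!: nn_integral_cong simp: powr_add ennreal_mult[symmetric] split: split_indicator)
    then show ?thesis using nn_integral_haar_powr_atMost[of "q + 1" R] assms by simp
  qed
  have neg: "(\<integral>\<^sup>+y. ?f (0 + -1 * y) \<partial>lborel) = (\<integral>\<^sup>+y. ?f y \<partial>lborel)"
    by (subst (2) nn_integral_real_affine[of _ "-1" 0]) auto
  have "(\<integral>\<^sup>+y. ennreal (\<bar>y\<bar> powr q) * indicator {-R..R} y \<partial>lborel) \<le> (\<integral>\<^sup>+y. ?f y + ?f (0 + -1 * y) \<partial>lborel)"
    by (rule nn_integral_mono_AE, rule AE_mp[OF AE_lborel_singleton[of 0]]) (auto split: split_indicator)
  also have "\<dots> = (\<integral>\<^sup>+y. ?f y \<partial>lborel) + (\<integral>\<^sup>+y. ?f (0 + -1 * y) \<partial>lborel)"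
    by (rule nn_integral_add) auto
  also have "\<dots> < \<infinity>" using pos neg by simp
  finally show ?thesis .
qed

text \<open>Averaging over translations by \<open>\<tau> e\<close>, \<open>\<tau> \<in> [0, 1]\<close>, reduces the integral to one dimension
  without choosing coordinates adapted to \<open>e\<close>.\<close>

lemma nn_integral_linear_form_powr_finite:
  fixes e :: "'a::euclidean_space" and q :: real
  assumes q: "-1 < q" and e: "e \<noteq> 0"
  shows "(\<integral>\<^sup>+w. ennreal (\<bar>e \<bullet> w\<bar> powr q) * indicator (ball 0 2) w \<partial>lborel) < \<infinity>"
proof -
  let ?E = "(norm e)\<^sup>2"
  let ?B = "ball 0 (2 + norm e) :: 'a set"
  \<comment> \<open>R bounds |e . w + tau |e|^2| for w in the enlarged ball and tau in [0, 1]; hence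
    M bounds the inner integral uniformly in w.\<close>
  define R where "R = (2 + norm e) * norm e + ?E"
  define M where "M = ennreal (1 / ?E) * (\<integral>\<^sup>+y. ennreal (\<bar>y\<bar> powr q) * indicator {-R..R} y \<partial>lborel)"
  define X where "X = (\<integral>\<^sup>+w. ennreal (\<bar>e \<bullet> w\<bar> powr q) * indicator (ball 0 2) w \<partial>lborel)"
  have [measurable]: "?B \<in> sets borel" by simp
  have E: "0 < ?E" using e by simp
  have R: "0 < R" unfolding R_def using e by (intro add_pos_pos mult_pos_pos) (auto intro: add_pos_nonneg)
  have shift: "X \<le> (\<integral>\<^sup>+w. ennreal (\<bar>e \<bullet> w + \<tau> * ?E\<bar> powr q) * indicator ?B w \<partial>lborel)"
    if "0 \<le> \<tau>" "\<tau> \<le> 1" for \<tau> :: real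
  proof -
    have "X = ennreal (\<bar>1\<bar> ^ DIM('a)) * (\<integral>\<^sup>+w. ennreal (\<bar>e \<bullet> (\<tau> *\<^sub>R e + 1 *\<^sub>R w)\<bar> powr q) * indicator (ball 0 2) (\<tau> *\<^sub>R e + 1 *\<^sub>R w) \<partial>lborel)"
      unfolding X_def by (intro nn_integral_lborel_affine) (measurable, simp_all)
    also have "\<dots> = (\<integral>\<^sup>+w. ennreal (\<bar>e \<bullet> w + \<tau> * ?E\<bar> powr q) * indicator (ball 0 2) (\<tau> *\<^sub>R e + w) \<partial>lborel)"
      by (simp add: inner_add_right power2_norm_eq_inner add.commute)
    also have "\<dots> \<le> (\<integral>\<^sup>+w. ennreal (\<bar>e \<bullet> w + \<tau> * ?E\<bar> powr q) * indicator ?B w \<partial>lborel)"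
    proof (intro nn_integral_mono mult_left_mono)
      fix w :: 'a
      have "norm w < 2 + norm e" if "norm (\<tau> *\<^sub>R e + w) < 2"
      proof -
        have "norm w \<le> norm (\<tau> *\<^sub>R e + w) + norm (\<tau> *\<^sub>R e)"
          by (metis add_diff_cancel_left' norm_triangle_ineq4)
        moreover have "norm (\<tau> *\<^sub>R e) \<le> norm e"
          using \<open>0 \<le> \<tau>\<close> \<open>\<tau> \<le> 1\<close> by (simp add: mult_left_le_one_le)
        ultimately show ?thesis using that by linarith
      qed
      then show "indicator (ball 0 2) (\<tau> *\<^sub>R e + w) \<le> (indicator ?B w :: ennreal)"
        by (auto split: split_indicator)
    qed simp
    finally show ?thesis .
  qed
  have inner: "(\<integral>\<^sup>+\<tau>. indicator {0..1} \<tau> * (ennreal (\<bar>e \<bullet> w + \<tau> * ?E\<bar> powr q) * indicator ?B w) \<partial>lborel)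
      \<le> M * indicator ?B w" for w
  proof (cases "w \<in> ?B")
    case True
    have "\<bar>e \<bullet> w\<bar> \<le> norm e * norm w" by (rule Cauchy_Schwarz_ineq2)
    also have "\<dots> \<le> norm e * (2 + norm e)" using True by (intro mult_left_mono) auto
    finally have ew: "\<bar>e \<bullet> w\<bar> \<le> norm e * (2 + norm e)" .
    have "(\<integral>\<^sup>+\<tau>. indicator {0..1} \<tau> * (ennreal (\<bar>e \<bullet> w + \<tau> * ?E\<bar> powr q) * indicator ?B w) \<partial>lborel)
      \<le> (\<integral>\<^sup>+\<tau>. ennreal (\<bar>e \<bullet> w + ?E * \<tau>\<bar> powr q) * indicator {-R..R} (e \<bullet> w + ?E * \<tau>) \<partial>lborel)"
    proof (intro nn_integral_mono)
      fix \<tau> :: real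
      have "e \<bullet> w + ?E * \<tau> \<in> {-R..R}" if "0 \<le> \<tau>" "\<tau> \<le> 1"
      proof -
        have "0 \<le> ?E * \<tau>" "?E * \<tau> \<le> ?E" using that by (auto simp: mult_left_le)
        then show ?thesis using ew by (auto simp: R_def mult.commute)
      qed
      then show "indicator {0..1} \<tau> * (ennreal (\<bar>e \<bullet> w + \<tau> * ?E\<bar> powr q) * indicator ?B w)
          \<le> ennreal (\<bar>e \<bullet> w + ?E * \<tau>\<bar> powr q) * indicator {-R..R} (e \<bullet> w + ?E * \<tau>)"
        by (auto simp: mult.commute split: split_indicator)
    qed
    also have "\<dots> = M"
    proof -
      have "(\<integral>\<^sup>+y. ennreal (\<bar>y\<bar> powr q) * indicator {-R..R} y \<partial>lborel)
        = ennreal \<bar>?E\<bar> * (\<integral>\<^sup>+\<tau>. ennreal (\<bar>e \<bullet> w + ?E * \<tau>\<bar> powr q) * indicator {-R..R} (e \<bullet> w + ?E * \<tau>) \<partial>lborel)"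
        using E by (intro nn_integral_real_affine) auto
      moreover have "ennreal (1 / ?E) * ennreal \<bar>?E\<bar> = 1"
        using E by (simp add: ennreal_mult[symmetric])
      ultimately show ?thesis
        unfolding M_def by (simp only: mult.assoc[symmetric]) simp
    qed
    finally show ?thesis using True by simp
  qed simp
  have "X = (\<integral>\<^sup>+\<tau>. indicator {0..1} \<tau> * X \<partial>(lborel :: real measure))"
    by (subst nn_integral_multc) auto
  also have "\<dots> \<le> (\<integral>\<^sup>+\<tau>. (\<integral>\<^sup>+w. indicator {0..1} \<tau> * (ennreal (\<bar>e \<bullet> w + \<tau> * ?E\<bar> powr q) * indicator ?B w) \<partial>lborel) \<partial>lborel)"
  proof (intro nn_integral_mono)
    fix \<tau> :: real
    show "indicator {0..1} \<tau> * X \<le> (\<integral>\<^sup>+w. indicator {0..1} \<tau> * (ennreal (\<bar>e \<bullet> w + \<tau> * ?E\<bar> powr q) * indicator ?B w) \<partial>lborel)"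
      using shift[of \<tau>] by (auto split: split_indicator)
  qed
  also have "\<dots> = (\<integral>\<^sup>+w. (\<integral>\<^sup>+\<tau>. indicator {0..1} \<tau> * (ennreal (\<bar>e \<bullet> w + \<tau> * ?E\<bar> powr q) * indicator ?B w) \<partial>lborel) \<partial>lborel)"
    by (rule lborel_pair.Fubini') measurable
  also have "\<dots> \<le> (\<integral>\<^sup>+w. M * indicator ?B w \<partial>lborel)"
    by (intro nn_integral_mono inner)
  also have "\<dots> = M * emeasure lborel ?B"
    by (rule nn_integral_cmult_indicator) simp
  also have "\<dots> < \<infinity>"
    using nn_integral_abs_powr_finite[OF q R] emeasure_bounded_finite[of ?B]
    by (simp add: M_def ennreal_mult_less_top)
  finally show ?thesis unfolding X_def .
qed

section \<open>Reduction to the symmetrised increment\<close>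

locale frac_p_setting =
  fixes u :: "real^'n \<Rightarrow> real" and x0 :: "real^'n" and s p C1 :: real
  assumes s: "0 < s" "s < 1" and p: "1 < p" and C1: "0 < C1" and u: "u \<in> C2b"
begin

definition incr :: "real^'n \<Rightarrow> real" where
  "incr z = u x0 - u (x0 - z)"

text \<open>An even weight sees only the even part of Phi_p of the increment, and in this part the
  contributions of the gradient compensate.\<close>

definition sym_incr :: "real^'n \<Rightarrow> real" where
  "sym_incr z = (Phi p (incr z) + Phi p (incr (- z))) / 2"

definition H :: "real^'n \<Rightarrow> real" where
  "H z = C1 * (sym_incr z * norm z powr (- (real CARD('n) + s * p)))"

definition \<kappa> :: "real \<Rightarrow> real" where
  "\<kappa> r = 2 * r powr (real CARD('n) + s * p) * resolvent_profile CARD('n) r / mellin_const CARD('n) (s * p)"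

lemma sp_pos: "0 < s * p"
  using s p by simp

lemma const_pos: "0 < mellin_const CARD('n) (s * p)"
  using sp_pos by (intro mellin_const_pos) auto

text \<open>Multiplying by r^d shifts the Mellin exponent from s p to s p + d. The shifts used are d
  = 0, s p and -s p, the last one leading to exponent 0.\<close>

lemma kappa_moment:
  assumes "0 \<le> s * p + d"
  shows "(\<integral>\<^sup>+r. ennreal (r powr d * \<kappa> r) \<partial>haar) = ennreal (mellin_const CARD('n) (s * p + d) / mellin_const CARD('n) (s * p))"
proof -
  let ?c = "mellin_const CARD('n) (s * p)"
  have "(\<integral>\<^sup>+r. ennreal (r powr d * \<kappa> r) \<partial>haar)
      = (\<integral>\<^sup>+r. ennreal (1 / ?c) * ennreal (2 * r powr (real CARD('n) + (s * p + d)) * resolvent_profile CARD('n) r) \<partial>haar)"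
  proof (rule nn_integral_cong_AE)
    show "AE r in haar. ennreal (r powr d * \<kappa> r)
        = ennreal (1 / ?c) * ennreal (2 * r powr (real CARD('n) + (s * p + d)) * resolvent_profile CARD('n) r)"
      using AE_haar_pos
    proof eventually_elim
      case (elim r)
      have "r powr d * \<kappa> r = 1 / ?c * (2 * r powr (real CARD('n) + (s * p + d)) * resolvent_profile CARD('n) r)"
        using elim by (simp add: \<kappa>_def powr_add)
      then show ?case using const_pos
        by (simp only:) (intro ennreal_mult, auto simp: resolvent_profile_nonneg)
    qed
  qed
  also have "\<dots> = ennreal (1 / ?c) * ennreal (mellin_const CARD('n) (s * p + d))"
    using assms by (subst nn_integral_cmult, measurable) (subst mellin_resolvent_profile, auto)
  also have "\<dots> = ennreal (mellin_const CARD('n) (s * p + d) / ?c)"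
    using const_pos mellin_const_pos[OF assms, of "CARD('n)"] by (subst ennreal_mult[symmetric]) auto
  finally show ?thesis .
qed

sublocale mult_density \<kappa> "s * p"
proof
  show "\<kappa> \<in> borel_measurable borel" unfolding \<kappa>_def[abs_def] by measurable
  show "0 \<le> \<kappa> r" for r
    using const_pos by (simp add: \<kappa>_def resolvent_profile_nonneg)
  have "(\<integral>\<^sup>+r. ennreal (r powr 0 * \<kappa> r) \<partial>haar) = 1"
    using sp_pos const_pos less_imp_le[OF sp_pos] by (subst kappa_moment) auto
  moreover have "(\<integral>\<^sup>+r. ennreal (r powr 0 * \<kappa> r) \<partial>haar) = (\<integral>\<^sup>+r. ennreal (\<kappa> r) \<partial>haar)"
    by (rule nn_integral_cong_AE, rule AE_mp[OF AE_haar_pos]) simp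
  ultimately show "(\<integral>\<^sup>+r. ennreal (\<kappa> r) \<partial>haar) = 1" by simp
  show "0 < s * p" by (rule sp_pos)
  show "(\<integral>\<^sup>+r. ennreal (r powr (s * p) * \<kappa> r) \<partial>haar) < \<infinity>"
    using less_imp_le[OF sp_pos] by (subst kappa_moment) (auto simp: mult.commute)
  show "(\<integral>\<^sup>+r. ennreal (r powr (- (s * p)) * \<kappa> r) \<partial>haar) < \<infinity>"
    by (subst kappa_moment) auto
qed

lemma u_measurable [measurable]: "u \<in> borel_measurable borel"
proof -
  have "\<exists>g. \<forall>x. (u has_derivative (\<lambda>h. h \<bullet> g x)) (at x)"
    using u unfolding C2b_def gderiv_def by blast
  then have "continuous_on UNIV u"
    by (meson continuous_at_imp_continuous_on has_derivative_continuous)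
  then show ?thesis by (rule borel_measurable_continuous_onI)
qed

lemma incr_measurable [measurable]: "incr \<in> borel_measurable borel"
  unfolding incr_def[abs_def] by measurable

lemma sym_incr_measurable [measurable]: "sym_incr \<in> borel_measurable borel"
  unfolding sym_incr_def[abs_def] by measurable

lemma H_measurable [measurable]: "H \<in> borel_measurable borel"
  unfolding H_def[abs_def] by measurable

lemma Phi_incr_bounded: "\<exists>B\<ge>0. \<forall>z. \<bar>Phi p (incr z)\<bar> \<le> B"
proof -
  from u have "bounded (range u)" by (auto simp: C2b_def)
  then obtain M where M: "\<And>x. \<bar>u x\<bar> \<le> M" unfolding bounded_iff by auto
  have "\<bar>Phi p (incr z)\<bar> \<le> (2 * M) powr (p - 1)" for z
    unfolding abs_Phi using M[of x0] M[of "x0 - z"] p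
    by (intro powr_mono2) (auto simp: incr_def)
  then show ?thesis by (intro exI[of _ "(2 * M) powr (p - 1)"]) simp
qed

lemma integrable_mult_Phi_incr:
  assumes w: "integrable lborel w"
  shows "integrable lborel (\<lambda>z. w z * Phi p (incr z))"
proof -
  have [measurable]: "w \<in> borel_measurable borel" using w by (simp add: borel_measurable_integrable)
  obtain B where B: "0 \<le> B" "\<And>z. \<bar>Phi p (incr z)\<bar> \<le> B" using Phi_incr_bounded by blast
  have "integrable lborel (\<lambda>z. B * w z)" using w by simp
  then show ?thesis
    by (rule Bochner_Integration.integrable_bound)
       (auto intro!: AE_I2 mult_right_mono B(2) simp: abs_mult B(1) mult.commute[of "\<bar>w _\<bar>"])
qed

text \<open>The average of the integral and its reflection under z -> -z. It serves both the
  truncated power weight and the resolvent kernel.\<close>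

lemma integral_symmetrise:
  assumes w: "integrable lborel w" and even: "\<And>z. w (- z) = w z"
  shows "(\<integral>z. w z * Phi p (incr z) \<partial>lborel) = (\<integral>z. w z * sym_incr z \<partial>lborel)"
    and "integrable lborel (\<lambda>z. w z * sym_incr z)"
proof -
  have [measurable]: "w \<in> borel_measurable borel" using w by (simp add: borel_measurable_integrable)
  have i1: "integrable lborel (\<lambda>z. w z * Phi p (incr z))" by (rule integrable_mult_Phi_incr[OF w])
  from integrable_lborel_reflect[OF this, of 0]
  have i2: "integrable lborel (\<lambda>z. w z * Phi p (incr (- z)))" by (simp add: even)
  have "(\<integral>z. w z * Phi p (incr (- z)) \<partial>lborel) = (\<integral>z. w z * Phi p (incr z) \<partial>lborel)"
    using integral_lborel_reflect[of "\<lambda>z. w z * Phi p (incr z)" 0] by (simp add: even)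
  moreover have eq: "w z * sym_incr z = (w z * Phi p (incr z) + w z * Phi p (incr (- z))) / 2" for z
    by (simp add: sym_incr_def algebra_simps add_divide_distrib)
  ultimately show "(\<integral>z. w z * Phi p (incr z) \<partial>lborel) = (\<integral>z. w z * sym_incr z \<partial>lborel)"
    using i1 i2 unfolding eq by simp
  show "integrable lborel (\<lambda>z. w z * sym_incr z)"
    unfolding eq using i1 i2 by simp
qed

lemma integrable_tail_weight:
  assumes "0 < d"
  shows "integrable lborel (\<lambda>z::real^'n. if d < norm z then norm z powr (- (real CARD('n) + s * p)) else 0)"
proof (rule integrableI_nonneg)
  have "(\<integral>\<^sup>+z. ennreal (if d < norm z then norm z powr (- (real CARD('n) + s * p)) else 0) \<partial>(lborel :: (real^'n) measure))
     \<le> (\<integral>\<^sup>+z. ennreal (norm z powr (- (real CARD('n) + s * p))) * indicator {d..} (norm z) \<partial>(lborel :: (real^'n) measure))"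
    by (intro nn_integral_mono) (auto split: split_indicator)
  also have "\<dots> < \<infinity>"
    using nn_integral_haar_powr_atLeast[of "- (s * p)" d] assms sp_pos
    by (intro nn_integral_radial_finite) auto
  finally show "(\<integral>\<^sup>+z. ennreal (if d < norm z then norm z powr (- (real CARD('n) + s * p)) else 0) \<partial>(lborel :: (real^'n) measure)) < \<infinity>" .
qed auto

lemma H_tail:
  assumes "0 < d"
  shows "integrable lborel (\<lambda>z. if d < norm z then H z else 0)"
proof -
  have "integrable lborel (\<lambda>z. C1 * ((if d < norm z then norm z powr (- (real CARD('n) + s * p)) else 0) * sym_incr z))"
    using integral_symmetrise(2)[OF integrable_tail_weight[OF assms]] by simp
  moreover have "(\<lambda>z. C1 * ((if d < norm z then norm z powr (- (real CARD('n) + s * p)) else 0) * sym_incr z))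
      = (\<lambda>z. if d < norm z then H z else 0)"
    by (auto simp: H_def fun_eq_iff)
  ultimately show ?thesis by simp
qed

lemma frac_p_laplacian_trunc_eq:
  assumes "0 < d"
  shows "frac_p_laplacian_trunc C1 s p u x0 d = (\<integral>z. (if d < norm z then H z else 0) \<partial>lborel)"
proof -
  let ?w = "\<lambda>z::real^'n. if d < norm z then norm z powr (- (real CARD('n) + s * p)) else 0"
  have "frac_p_laplacian_trunc C1 s p u x0 d = C1 * (\<integral>y. ?w (x0 - y) * Phi p (u x0 - u y) \<partial>lborel)"
    unfolding frac_p_laplacian_trunc_def set_lebesgue_integral_def
    by (intro arg_cong[where f="\<lambda>x. C1 * x"] Bochner_Integration.integral_cong)
       (auto simp: indicator_def powr_minus_divide simp del: minus_add_distrib)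
  \<comment> \<open>The reflection y = x0 - z moves the singularity to the origin.\<close>
  also have "(\<integral>y. ?w (x0 - y) * Phi p (u x0 - u y) \<partial>lborel) = (\<integral>z. ?w (x0 - (x0 - z)) * Phi p (u x0 - u (x0 - z)) \<partial>lborel)"
    by (rule integral_lborel_reflect[symmetric]) measurable
  also have "\<dots> = (\<integral>z. ?w z * Phi p (incr z) \<partial>lborel)"
    unfolding incr_def by (intro Bochner_Integration.integral_cong) (auto simp: norm_minus_commute)
  also have "\<dots> = (\<integral>z. ?w z * sym_incr z \<partial>lborel)"
    by (rule integral_symmetrise(1)[OF integrable_tail_weight[OF assms]]) simp
  also have "C1 * \<dots> = (\<integral>z. C1 * (?w z * sym_incr z) \<partial>lborel)" by simp
  also have "\<dots> = (\<integral>z. (if d < norm z then H z else 0) \<partial>lborel)"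
    by (intro Bochner_Integration.integral_cong) (auto simp: H_def)
  finally show ?thesis .
qed

section \<open>The t-integral as an average over scales\<close>

definition J :: "real \<Rightarrow> real" where
  "J r = (\<integral>z. H z * \<kappa> (r * norm z) \<partial>lborel)"

lemma J_measurable [measurable]: "J \<in> borel_measurable borel"
  unfolding J_def[abs_def] by measurable

text \<open>The subtracted value at x0 is \<open>Phi p 0\<close>, which is 0, so only the
  convolution remains. At scale sqrt t, weight times density is the kernel times 2 t^(s p / 2) / c,
  and t / t^(1 - s p / 2) is this same power of t. The leading t converts dt into dt/t.\<close>

lemma balakrishnan_integrand_eq:
  assumes t: "0 < t"
  shows "t * balakrishnan_integrand s p u x0 t = mellin_const CARD('n) (s * p) / (2 * C1) * J (sqrt t)"
proof -
  let ?R = "resolvent_kernel t :: real^'n \<Rightarrow> real" and ?c = "mellin_const CARD('n) (s * p)"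
  have R: "integrable lborel ?R" by (rule integrable_resolvent_kernel[OF t])
  then have [measurable]: "?R \<in> borel_measurable borel" by (simp add: borel_measurable_integrable)
  have "laplacian_resolvent t (\<lambda>y. Phi p (u x0 - u y)) x0 = (\<integral>y. ?R (x0 - y) * Phi p (u x0 - u y) \<partial>lborel)"
    by (simp add: laplacian_resolvent_def)
  also have "\<dots> = (\<integral>z. ?R (x0 - (x0 - z)) * Phi p (u x0 - u (x0 - z)) \<partial>lborel)"
    by (rule integral_lborel_reflect[symmetric]) measurable
  also have "\<dots> = (\<integral>z. ?R z * Phi p (incr z) \<partial>lborel)"
    by (simp add: incr_def)
  also have "\<dots> = (\<integral>z. ?R z * sym_incr z \<partial>lborel)"
    using t by (intro integral_symmetrise(1)[OF R]) (simp add: resolvent_kernel_eq)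
  finally have L: "laplacian_resolvent t (\<lambda>y. Phi p (u x0 - u y)) x0 = (\<integral>z. ?R z * sym_incr z \<partial>lborel)" .
  have "J (sqrt t) = (\<integral>z. 2 * C1 / ?c * t powr (s * p / 2) * (?R z * sym_incr z) \<partial>lborel)"
    unfolding J_def
  proof (rule integral_cong_AE)
    show "AE z in lborel. H z * \<kappa> (sqrt t * norm z) = 2 * C1 / ?c * t powr (s * p / 2) * (?R z * sym_incr z)"
      using AE_lborel_nonzero
    proof eventually_elim
      case (elim z)
      have 1: "(sqrt t * norm z) powr (real CARD('n) + s * p) = t powr (real CARD('n) / 2) * t powr (s * p / 2) * norm z powr (real CARD('n) + s * p)"
      proof -
        have "sqrt t powr (real CARD('n) + s * p) = t powr ((real CARD('n) + s * p) / 2)"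
          using t by (simp add: powr_half_sqrt[symmetric] powr_powr)
        also have "\<dots> = t powr (real CARD('n) / 2) * t powr (s * p / 2)"
          by (simp only: powr_add[symmetric] add_divide_distrib)
        finally show ?thesis using t by (simp add: powr_mult)
      qed
      have 2: "norm z powr (- (real CARD('n) + s * p)) * norm z powr (real CARD('n) + s * p) = 1"
        using elim by (simp add: powr_add[symmetric])
      have "norm z powr (- (real CARD('n) + s * p)) * (sqrt t * norm z) powr (real CARD('n) + s * p)
          = t powr (real CARD('n) / 2) * t powr (s * p / 2) * (norm z powr (- (real CARD('n) + s * p)) * norm z powr (real CARD('n) + s * p))"
        unfolding 1 by (simp only: mult_ac)
      then have "norm z powr (- (real CARD('n) + s * p)) * (sqrt t * norm z) powr (real CARD('n) + s * p) = t powr (real CARD('n) / 2) * t powr (s * p / 2)"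
        unfolding 2 by simp
      then have e: "norm z powr (- (real CARD('n) + s * p)) * (sqrt t * norm z) powr (real CARD('n) + s * p) * r = t powr (real CARD('n) / 2) * t powr (s * p / 2) * r" for r
        by simp
      have "H z * \<kappa> (sqrt t * norm z) = norm z powr (- (real CARD('n) + s * p)) * (sqrt t * norm z) powr (real CARD('n) + s * p)
         * (2 * C1 / ?c * sym_incr z * resolvent_profile CARD('n) (sqrt t * norm z))"
        by (simp add: H_def \<kappa>_def mult_ac)
      also have "\<dots> = 2 * C1 / ?c * t powr (s * p / 2) * (?R z * sym_incr z)"
        unfolding e resolvent_kernel_eq[OF t] by (simp add: mult_ac)
      finally show ?case .
    qed
  qed measurable
  also have "\<dots> = 2 * C1 / ?c * t powr (s * p / 2) * (\<integral>z. ?R z * sym_incr z \<partial>lborel)"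
    by simp
  finally have "?c / (2 * C1) * J (sqrt t) = t powr (s * p / 2) * (\<integral>z. ?R z * sym_incr z \<partial>lborel)"
    using const_pos C1 by simp
  moreover have "t / t powr (1 - s * p / 2) = t powr (s * p / 2)"
    using t powr_diff[of t 1 "1 - s * p / 2"] by simp
  ultimately show ?thesis
    unfolding balakrishnan_integrand_def L by (metis times_divide_eq_left times_divide_eq_right)
qed

text \<open>With t = r^2, dt/t becomes 2 dr/r, which cancels the 2 in the denominator of
  \<open>balakrishnan_integrand_eq\<close>. S is \<open>UNIV\<close> for the full integral and
  \<open>{..T}\<close> for the truncated one.\<close>

lemma balakrishnan_integral_eq:
  assumes [measurable]: "S \<in> sets borel"
  shows "(\<integral>t. indicator ({0<..} \<inter> S) t * balakrishnan_integrand s p u x0 t \<partial>lborel)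
      = mellin_const CARD('n) (s * p) / C1 * (\<integral>r. indicator S (r powr 2) * J r \<partial>haar)"
    and "integrable lborel (\<lambda>t. indicator ({0<..} \<inter> S) t * balakrishnan_integrand s p u x0 t)
      \<longleftrightarrow> integrable haar (\<lambda>r. indicator S (r powr 2) * J r)"
proof -
  let ?c = "mellin_const CARD('n) (s * p)"
  define f where "f t = ?c / (2 * C1) * (indicator S t * J (sqrt t))" for t
  have [measurable]: "f \<in> borel_measurable borel" unfolding f_def by measurable
  have eq: "indicator ({0<..} \<inter> S) t * balakrishnan_integrand s p u x0 t = indicator {0<..} t / t * f t" for t
  proof (cases "0 < t")
    case True
    then have "balakrishnan_integrand s p u x0 t = ?c / (2 * C1) * J (sqrt t) / t"
      using balakrishnan_integrand_eq[OF True] True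
      by (metis less_irrefl nonzero_mult_div_cancel_left)
    then show ?thesis using True by (simp add: f_def indicator_def)
  qed simp
  have sq: "AE r in haar. f (r powr 2) = ?c / (2 * C1) * (indicator S (r powr 2) * J r)"
    using AE_haar_pos
  proof eventually_elim
    case (elim r)
    have "sqrt (r powr 2) = r" using elim by simp
    then show ?case by (simp add: f_def)
  qed
  have "(\<integral>t. indicator ({0<..} \<inter> S) t * balakrishnan_integrand s p u x0 t \<partial>lborel) = (\<integral>t. f t \<partial>haar)"
    unfolding eq by (rule integral_haar(1)[symmetric]) measurable
  also have "\<dots> = \<bar>2\<bar> * (\<integral>r. f (r powr 2) \<partial>haar)"
    by (rule integral_haar_powr(1)) auto
  also have "(\<integral>r. f (r powr 2) \<partial>haar) = (\<integral>r. ?c / (2 * C1) * (indicator S (r powr 2) * J r) \<partial>haar)"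
    by (rule integral_cong_AE[OF _ _ sq]) measurable
  also have "\<bar>2\<bar> * \<dots> = ?c / C1 * (\<integral>r. indicator S (r powr 2) * J r \<partial>haar)"
    by simp
  finally show "(\<integral>t. indicator ({0<..} \<inter> S) t * balakrishnan_integrand s p u x0 t \<partial>lborel)
      = ?c / C1 * (\<integral>r. indicator S (r powr 2) * J r \<partial>haar)" .
  have "integrable lborel (\<lambda>t. indicator ({0<..} \<inter> S) t * balakrishnan_integrand s p u x0 t) \<longleftrightarrow> integrable haar f"
    unfolding eq by (rule integral_haar(2)[symmetric]) measurable
  also have "\<dots> \<longleftrightarrow> integrable haar (\<lambda>r. f (r powr 2))"
    by (rule integral_haar_powr(2)) auto
  also have "\<dots> \<longleftrightarrow> integrable haar (\<lambda>r. ?c / (2 * C1) * (indicator S (r powr 2) * J r))"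
    by (rule integrable_cong_AE[OF _ _ sq]) measurable
  also have "\<dots> \<longleftrightarrow> integrable haar (\<lambda>r. indicator S (r powr 2) * J r)"
  proof
    assume "integrable haar (\<lambda>r. ?c / (2 * C1) * (indicator S (r powr 2) * J r))"
    then have "integrable haar (\<lambda>r. 2 * C1 / ?c * (?c / (2 * C1) * (indicator S (r powr 2) * J r)))"
      by (rule integrable_mult_right)
    then show "integrable haar (\<lambda>r. indicator S (r powr 2) * J r)"
      using const_pos C1 by simp
  qed (rule integrable_mult_right)
  finally show "integrable lborel (\<lambda>t. indicator ({0<..} \<inter> S) t * balakrishnan_integrand s p u x0 t)
      \<longleftrightarrow> integrable haar (\<lambda>r. indicator S (r powr 2) * J r)" .
qed

lemma C4_eq: "C4 C1 CARD('n) s p = C1 / mellin_const CARD('n) (s * p)"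
proof -
  have e: "(2 + s * p) / 2 = 1 + s * p / 2" by simp
  show ?thesis unfolding C4_def mellin_const_def e by (simp add: mult_ac)
qed

lemma C4_balakrishnan_partial:
  assumes T: "0 < T"
  shows "C4 C1 CARD('n) s p * (LINT t:{0<..T}|lborel. balakrishnan_integrand s p u x0 t)
     = (\<integral>r. (if r < sqrt T then J r else 0) \<partial>haar)"
proof -
  have S: "{0<..T} = {0<..} \<inter> {..T}" by auto
  have "(LINT t:{0<..T}|lborel. balakrishnan_integrand s p u x0 t)
     = mellin_const CARD('n) (s * p) / C1 * (\<integral>r. indicator {..T} (r powr 2) * J r \<partial>haar)"
    unfolding set_lebesgue_integral_def S using balakrishnan_integral_eq(1)[of "{..T}"] by simp
  also have "(\<integral>r. indicator {..T} (r powr 2) * J r \<partial>haar) = (\<integral>r. (if r < sqrt T then J r else 0) \<partial>haar)"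
  proof (rule integral_cong_AE)
    show "AE r in haar. indicator {..T} (r powr 2) * J r = (if r < sqrt T then J r else 0)"
      \<comment> \<open>The endpoint r = sqrt T is a null set; this reconciles the closed end of the
        t-interval with the strict inequality in \<open>cdf\<close>.\<close>
      using AE_haar_pos haar_neq[of "sqrt T"]
    proof eventually_elim
      case (elim r)
      have "r powr 2 \<le> T \<longleftrightarrow> r \<le> sqrt T"
        using elim T real_le_rsqrt[of r T] sqrt_ge_absD[of r T] by auto
      then show ?case using elim by (simp add: indicator_def)
    qed
  qed measurable
  finally show ?thesis using const_pos C1 by (simp add: C4_eq)
qed

section \<open>The absolutely convergent case\<close>

lemma truncation_tendsto:
  assumes H: "integrable lborel H"
  shows "((\<lambda>d. \<integral>z. (if d < norm z then H z else 0) \<partial>lborel) \<longlongrightarrow> (\<integral>z. H z \<partial>lborel)) (at_right 0)"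
  unfolding tendsto_at_right_0_iff
proof (rule integral_dominated_convergence_at_top)
  show "integrable lborel (\<lambda>z. \<bar>H z\<bar>)" using H by simp
  show "\<forall>\<^sub>F r in at_top. AE z in lborel. norm (if 1 / r < norm z then H z else 0) \<le> \<bar>H z\<bar>"
    by simp
  show "AE z in lborel. ((\<lambda>r. if 1 / r < norm z then H z else 0) \<longlongrightarrow> H z) at_top"
    using AE_lborel_nonzero
  proof eventually_elim
    case (elim z)
    have "\<forall>\<^sub>F r in at_top. (if 1 / r < norm z then H z else 0) = H z"
      using eventually_gt_at_top[of "1 / norm z"] eventually_gt_at_top[of 0]
      by eventually_elim (use elim in \<open>auto simp: field_simps\<close>)
    then show ?case by (rule tendsto_eventually)
  qed
qed measurable

lemma absolutely_convergent_case:
  assumes H: "integrable lborel H"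
  shows "(frac_p_laplacian_trunc C1 s p u x0 \<longlongrightarrow> (\<integral>z. H z \<partial>lborel)) (at_right 0)"
    and "set_integrable lborel {0<..} (balakrishnan_integrand s p u x0)"
    and "C4 C1 CARD('n) s p * (LINT t:{0<..}|lborel. balakrishnan_integrand s p u x0 t) = (\<integral>z. H z \<partial>lborel)"
    and "((\<lambda>T. C4 C1 CARD('n) s p * (LINT t:{0<..T}|lborel. balakrishnan_integrand s p u x0 t))
           \<longlongrightarrow> (\<integral>z. H z \<partial>lborel)) at_top"
proof -
  let ?b = "balakrishnan_integrand s p u x0"
  show "(frac_p_laplacian_trunc C1 s p u x0 \<longlongrightarrow> (\<integral>z. H z \<partial>lborel)) (at_right 0)"
  proof (rule Lim_transform_eventually[OF truncation_tendsto[OF H]])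
    show "\<forall>\<^sub>F d in at_right 0. (\<integral>z. (if d < norm z then H z else 0) \<partial>lborel) = frac_p_laplacian_trunc C1 s p u x0 d"
      using eventually_at_right_less[of 0] by eventually_elim (simp add: frac_p_laplacian_trunc_eq)
  qed
  have J: "integrable haar J" "(\<integral>r. J r \<partial>haar) = (\<integral>z. H z \<partial>lborel)"
    unfolding J_def[abs_def] by (rule average_integrable[OF H])+
  show si: "set_integrable lborel {0<..} ?b"
    unfolding set_integrable_def using balakrishnan_integral_eq(2)[of UNIV] J by simp
  have "(LINT t:{0<..}|lborel. ?b t) = mellin_const CARD('n) (s * p) / C1 * (\<integral>r. J r \<partial>haar)"
    unfolding set_lebesgue_integral_def using balakrishnan_integral_eq(1)[of UNIV] by simp
  then show C4: "C4 C1 CARD('n) s p * (LINT t:{0<..}|lborel. ?b t) = (\<integral>z. H z \<partial>lborel)"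
    using const_pos C1 J by (simp add: C4_eq)
  let ?f = "\<lambda>t. indicator {0<..} t *\<^sub>R ?b t"
  have f: "integrable lborel ?f" using si by (simp add: set_integrable_def)
  have [measurable]: "?f \<in> borel_measurable borel" using f by (simp add: borel_measurable_integrable)
  have "((\<lambda>T. \<integral>t. indicator {..T} t * ?f t \<partial>lborel) \<longlongrightarrow> (\<integral>t. ?f t \<partial>lborel)) at_top"
  proof (rule integral_dominated_convergence_at_top)
    show "integrable lborel (\<lambda>t. \<bar>?f t\<bar>)" using f by (rule integrable_abs)
    show "\<forall>\<^sub>F T in at_top. AE t in lborel. norm (indicator {..T} t * ?f t) \<le> \<bar>?f t\<bar>"
      by (auto simp: indicator_def)
    show "AE t in lborel. ((\<lambda>T. indicator {..T} t * ?f t) \<longlongrightarrow> ?f t) at_top"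
    proof (rule AE_I2)
      fix t :: real
      have "\<forall>\<^sub>F T in at_top. indicator {..T} t * ?f t = ?f t"
        using eventually_ge_at_top[of t] by eventually_elim (simp add: indicator_def)
      then show "((\<lambda>T. indicator {..T} t * ?f t) \<longlongrightarrow> ?f t) at_top" by (rule tendsto_eventually)
    qed
  qed measurable
  moreover have "(\<integral>t. indicator {..T} t * ?f t \<partial>lborel) = (LINT t:{0<..T}|lborel. ?b t)" for T
    unfolding set_lebesgue_integral_def
    by (intro Bochner_Integration.integral_cong) (auto simp: indicator_def)
  ultimately have "((\<lambda>T. LINT t:{0<..T}|lborel. ?b t) \<longlongrightarrow> (LINT t:{0<..}|lborel. ?b t)) at_top"
    by (simp add: set_lebesgue_integral_def)
  then show "((\<lambda>T. C4 C1 CARD('n) s p * (LINT t:{0<..T}|lborel. ?b t)) \<longlongrightarrow> (\<integral>z. H z \<partial>lborel)) at_top"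
    unfolding C4[symmetric] by (intro tendsto_mult tendsto_const)
qed

end

context frac_p_setting
begin

section \<open>Bounds on the symmetrised increment\<close>

abbreviation e :: "real^'n" where "e \<equiv> gradient u x0"

text \<open>\<open>A\<close> is the Hessian of u. Its boundedness gives the estimates of this
  section; its continuity and the explicit intermediate point are kept for the blow-up at
  x0.\<close>

lemma incr_Taylor:
  obtains A :: "real^'n \<Rightarrow> real^'n^'n" where "continuous_on UNIV A" "bounded (range A)"
    "\<And>z. \<exists>\<xi>. 0 \<le> \<xi> \<and> \<xi> \<le> 1 \<and> incr z = e \<bullet> z - z \<bullet> (A (x0 - \<xi> *\<^sub>R z) *v z) / 2"
proof -
  from u obtain g :: "real^'n \<Rightarrow> real^'n" and A :: "real^'n \<Rightarrow> real^'n^'n" where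
    g: "\<And>x. GDERIV u x :> g x" and A: "\<And>x. (g has_derivative (\<lambda>h. A x *v h)) (at x)"
    and cA: "continuous_on UNIV A" and bA: "bounded (range A)"
    unfolding C2b_def by blast
  have e: "e = g x0" by (rule gradient_eq[OF g])
  have "\<exists>\<xi>. 0 \<le> \<xi> \<and> \<xi> \<le> 1 \<and> incr z = e \<bullet> z - z \<bullet> (A (x0 - \<xi> *\<^sub>R z) *v z) / 2" for z
  proof -
    have neg: "A y *v (- z) = - (A y *v z)" for y
      using matrix_vector_mult_scaleR[of "A y" "-1" z] by simp
    obtain \<xi> where "0 \<le> \<xi>" "\<xi> \<le> 1"
      "u (x0 + - z) = u x0 + (- z) \<bullet> g x0 + (- z) \<bullet> (A (x0 + \<xi> *\<^sub>R (- z)) *v (- z)) / 2"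
      using Taylor_C2[of u g A, OF g A] by blast
    then show ?thesis
      by (intro exI[of _ \<xi>]) (simp add: incr_def e inner_commute[of z "g x0"] neg)
  qed
  then show thesis using that cA bA by blast
qed

lemma incr_linear_bound: "\<exists>C>0. \<forall>z. \<bar>incr z - e \<bullet> z\<bar> \<le> C * (norm z)\<^sup>2"
proof -
  obtain A :: "real^'n \<Rightarrow> real^'n^'n" where bA: "bounded (range A)"
    and T: "\<And>z. \<exists>\<xi>. 0 \<le> \<xi> \<and> \<xi> \<le> 1 \<and> incr z = e \<bullet> z - z \<bullet> (A (x0 - \<xi> *\<^sub>R z) *v z) / 2"
    using incr_Taylor by metis
  obtain M where M: "\<And>y. norm (A y) \<le> M" using bA unfolding bounded_iff by auto
  \<comment> \<open>The added 1 makes the constant positive even if M is 0.\<close>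
  have "\<bar>incr z - e \<bullet> z\<bar> \<le> (CARD('n) * M + 1) * (norm z)\<^sup>2" for z
  proof -
    obtain \<xi> where \<xi>: "incr z = e \<bullet> z - z \<bullet> (A (x0 - \<xi> *\<^sub>R z) *v z) / 2" using T by blast
    have "\<bar>incr z - e \<bullet> z\<bar> \<le> \<bar>z \<bullet> (A (x0 - \<xi> *\<^sub>R z) *v z)\<bar>" unfolding \<xi> by simp
    also have "\<dots> \<le> CARD('n) * norm (A (x0 - \<xi> *\<^sub>R z)) * (norm z)\<^sup>2"
      by (rule abs_inner_matrix_le)
    also have "\<dots> \<le> (CARD('n) * M + 1) * (norm z)\<^sup>2"
    proof (intro mult_right_mono)
      have "CARD('n) * norm (A (x0 - \<xi> *\<^sub>R z)) \<le> CARD('n) * M" by (intro mult_left_mono M) simp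
      then show "CARD('n) * norm (A (x0 - \<xi> *\<^sub>R z)) \<le> CARD('n) * M + 1" by linarith
    qed simp
    finally show ?thesis .
  qed
  moreover have "0 < CARD('n) * M + 1"
    using order_trans[OF norm_ge_zero M[of x0]] by (intro add_nonneg_pos) auto
  ultimately show ?thesis by blast
qed

lemma incr_0 [simp]: "incr 0 = 0"
  by (simp add: incr_def)

lemma sym_incr_0 [simp]: "sym_incr 0 = 0"
  by (simp add: sym_incr_def)

text \<open>By oddness the sum becomes a difference of Phi at two points with the same linear part e
  . z, so only second-order terms separate them.\<close>

lemma sym_incr_eq: "sym_incr z = (Phi p (incr z) - Phi p (- incr (- z))) / 2"
  by (simp add: sym_incr_def)

lemma incr_sum_bound:
  assumes "\<And>z. \<bar>incr z - e \<bullet> z\<bar> \<le> C * (norm z)\<^sup>2"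
  shows "\<bar>incr z - - incr (- z)\<bar> \<le> 2 * C * (norm z)\<^sup>2"
  using assms[of z] assms[of "- z"] by auto

text \<open>Both arguments of Phi are O(|z|) and differ by O(|z|^2), so \<open>Phi_diff_le\<close>
  gives |z|^(p-2) |z|^2.\<close>

lemma sym_incr_bound_ge_2:
  assumes p2: "2 \<le> p"
  shows "\<exists>K. \<forall>z. norm z \<le> 1 \<longrightarrow> \<bar>sym_incr z\<bar> \<le> K * norm z powr p"
proof -
  obtain C where C: "0 < C" "\<And>z. \<bar>incr z - e \<bullet> z\<bar> \<le> C * (norm z)\<^sup>2"
    using incr_linear_bound by blast
  let ?K = "(p + 1) * (norm e + C) powr (p - 2) * C"
  have b: "\<bar>incr z\<bar> \<le> (norm e + C) * norm z" if "norm z \<le> 1" for z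
  proof -
    have "\<bar>incr z\<bar> \<le> \<bar>e \<bullet> z\<bar> + C * (norm z)\<^sup>2" using C(2)[of z] by linarith
    also have "\<bar>e \<bullet> z\<bar> \<le> norm e * norm z" by (rule Cauchy_Schwarz_ineq2)
    also have "C * (norm z)\<^sup>2 \<le> C * norm z"
      using that C by (intro mult_left_mono) (auto simp: power2_eq_square mult_left_le)
    finally show ?thesis by (simp add: algebra_simps)
  qed
  have "\<bar>sym_incr z\<bar> \<le> ?K * norm z powr p" if z: "norm z \<le> 1" for z
  proof (cases "z = 0")
    case False
    have "2 * \<bar>sym_incr z\<bar> = \<bar>Phi p (incr z) - Phi p (- incr (- z))\<bar>"
      unfolding sym_incr_eq by simp
    also have "\<dots> \<le> (p + 1) * (max \<bar>incr z\<bar> \<bar>- incr (- z)\<bar> powr (p - 2) * \<bar>incr z - - incr (- z)\<bar>)"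
      by (rule Phi_diff_le[OF p])
    also have "\<dots> \<le> (p + 1) * (((norm e + C) * norm z) powr (p - 2) * (2 * C * (norm z)\<^sup>2))"
      using b[of z] b[of "- z"] z p2 C
      by (intro mult_left_mono mult_mono powr_mono2 incr_sum_bound C(2)) auto
    also have "\<dots> = 2 * (?K * (norm z powr (p - 2) * (norm z)\<^sup>2))"
      using C by (simp add: powr_mult)
    also have "norm z powr (p - 2) * (norm z)\<^sup>2 = norm z powr p"
      using False powr_add[of "norm z" "p - 2" 2] by simp
    finally show ?thesis by simp
  qed simp
  then show ?thesis by blast
qed

text \<open>The Hoelder exponent p - 1 acts on a difference of order |z|^2, whatever the gradient.
  The resulting degree exceeds s p exactly for p > 2 / (2 - s) and equals it at the critical
  exponent.\<close>

lemma sym_incr_bound_less_2: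
  assumes p2: "p < 2"
  shows "\<exists>K. \<forall>z. \<bar>sym_incr z\<bar> \<le> K * norm z powr (2 * (p - 1))"
proof -
  obtain C where C: "0 < C" "\<And>z. \<bar>incr z - e \<bullet> z\<bar> \<le> C * (norm z)\<^sup>2"
    using incr_linear_bound by blast
  let ?L = "(p + 1) * 2 powr (2 - p)"
  have "\<bar>sym_incr z\<bar> \<le> (?L * (2 * C) powr (p - 1)) * norm z powr (2 * (p - 1))" for z
  proof (cases "z = 0")
    case False
    have "\<bar>sym_incr z\<bar> \<le> \<bar>Phi p (incr z) - Phi p (- incr (- z))\<bar>"
      unfolding sym_incr_eq by simp
    also have "\<dots> \<le> ?L * \<bar>incr z - - incr (- z)\<bar> powr (p - 1)"
      by (rule Phi_diff_le_Holder[OF p p2])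
    also have "\<dots> \<le> ?L * (2 * C * (norm z)\<^sup>2) powr (p - 1)"
      using p by (intro mult_left_mono powr_mono2 incr_sum_bound C(2)) auto
    also have "(2 * C * (norm z)\<^sup>2) powr (p - 1) = (2 * C) powr (p - 1) * norm z powr (2 * (p - 1))"
    proof -
      have "(norm z)\<^sup>2 powr (p - 1) = norm z powr (2 * (p - 1))"
        using False by (simp add: powr_powr flip: powr_numeral)
      then show ?thesis using C by (simp add: powr_mult)
    qed
    finally show ?thesis by (simp add: mult.assoc)
  qed simp
  then show ?thesis by blast
qed

text \<open>Either the linear part dominates the increment and \<open>\<Phi>\<close> is differentiable there, or the linear
  part is itself at most quadratic and the Hoelder bound suffices; as \<open>p < 2\<close>, both cases give the
  same bound.\<close>

lemma sym_incr_bound_gradient: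
  assumes p2: "p < 2"
  shows "\<exists>K. \<forall>z. e \<bullet> z \<noteq> 0 \<longrightarrow> \<bar>sym_incr z\<bar> \<le> K * (\<bar>e \<bullet> z\<bar> powr (p - 2) * (norm z)\<^sup>2)"
proof -
  obtain C where C: "0 < C" "\<And>z. \<bar>incr z - e \<bullet> z\<bar> \<le> C * (norm z)\<^sup>2"
    using incr_linear_bound by blast
  let ?L = "(p + 1) * 2 powr (2 - p)"
  have "\<bar>sym_incr z\<bar> \<le> (?L * C) * (\<bar>e \<bullet> z\<bar> powr (p - 2) * (norm z)\<^sup>2)" if ez: "e \<bullet> z \<noteq> 0" for z
  proof -
    let ?E = "\<bar>e \<bullet> z\<bar>"
    have E: "0 < ?E" using ez by simp
    have z: "0 < norm z" using ez by auto
    have 2: "2 * \<bar>sym_incr z\<bar> = \<bar>Phi p (incr z) - Phi p (- incr (- z))\<bar>"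
      unfolding sym_incr_eq by simp
    have "\<bar>Phi p (incr z) - Phi p (- incr (- z))\<bar> \<le> ?L * (?E powr (p - 2) * (2 * C * (norm z)\<^sup>2))"
    proof (cases "2 * C * (norm z)\<^sup>2 \<le> ?E")
      case True
      have "?E / 2 \<le> \<bar>incr z\<bar>" using C(2)[of z] True by linarith
      then have "max \<bar>incr z\<bar> \<bar>- incr (- z)\<bar> powr (p - 2) \<le> (?E / 2) powr (p - 2)"
        using E p2 by (intro powr_mono2') auto
      also have "\<dots> = 2 powr (2 - p) * ?E powr (p - 2)"
        using powr_minus_divide[of 2 "2 - p"] by (simp add: powr_divide)
      finally have m: "max \<bar>incr z\<bar> \<bar>- incr (- z)\<bar> powr (p - 2) \<le> 2 powr (2 - p) * ?E powr (p - 2)" .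
      have "\<bar>Phi p (incr z) - Phi p (- incr (- z))\<bar>
        \<le> (p + 1) * (max \<bar>incr z\<bar> \<bar>- incr (- z)\<bar> powr (p - 2) * \<bar>incr z - - incr (- z)\<bar>)"
        by (rule Phi_diff_le[OF p])
      also have "\<dots> \<le> (p + 1) * ((2 powr (2 - p) * ?E powr (p - 2)) * (2 * C * (norm z)\<^sup>2))"
        using p by (intro mult_left_mono mult_mono m incr_sum_bound C(2)) auto
      finally show ?thesis by (simp only: mult_ac)
    next
      case False
      let ?q = "2 * C * (norm z)\<^sup>2"
      have q: "0 < ?q" using C z by simp
      have "\<bar>Phi p (incr z) - Phi p (- incr (- z))\<bar> \<le> ?L * \<bar>incr z - - incr (- z)\<bar> powr (p - 1)"
        by (rule Phi_diff_le_Holder[OF p p2])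
      also have "\<dots> \<le> ?L * ?q powr (p - 1)"
        using p by (intro mult_left_mono powr_mono2 incr_sum_bound C(2)) auto
      also have "?q powr (p - 1) = ?q powr (p - 2) * ?q"
        using q powr_add[of ?q "p - 2" 1] by simp
      also have "?L * (?q powr (p - 2) * ?q) \<le> ?L * (?E powr (p - 2) * ?q)"
        using False E p p2 q by (intro mult_left_mono mult_right_mono powr_mono2') auto
      finally show ?thesis .
    qed
    then show ?thesis using 2 by (simp add: mult_ac)
  qed
  then show ?thesis by blast
qed

text \<open>A homogeneous majorant of degree b leaves the radial integral of r^(b - s p) dr/r over
  (0, 1], finite for b > s p. The bound is asked only almost everywhere so that a hyperplane can be
  left out.\<close>

lemma integrable_H:
  assumes [measurable]: "Q \<in> borel_measurable borel" and Q0: "\<And>z. 0 \<le> Q z"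
    and hom: "\<And>l z. 0 < l \<Longrightarrow> Q (l *\<^sub>R z) = l powr b * Q z"
    and Q: "(\<integral>\<^sup>+w. ennreal (Q w) * indicator {1<..<2} (norm w) \<partial>lborel) < \<infinity>"
    and b: "s * p < b"
    and bound: "AE z in lborel. norm z \<le> 1 \<longrightarrow> \<bar>sym_incr z\<bar> \<le> K * Q z"
  shows "integrable lborel H"
proof -
  let ?a = "- (real CARD('n) + s * p)"
  have "(\<integral>\<^sup>+z. ennreal (Q z) * (ennreal (norm z powr ?a) * indicator {..1} (norm z)) \<partial>lborel) < \<infinity>"
  proof (rule nn_integral_homogeneous_finite[OF assms(1) _ Q0 hom Q])
    have "(\<integral>\<^sup>+r. ennreal (r powr (b + real DIM(real^'n))) * (ennreal (r powr ?a) * indicator {..1} r) \<partial>haar)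
       = (\<integral>\<^sup>+r. ennreal (r powr (b - s * p)) * indicator {..1} r \<partial>haar)"
    proof (rule nn_integral_cong_AE)
      show "AE r in haar. ennreal (r powr (b + real DIM(real^'n))) * (ennreal (r powr ?a) * indicator {..1} r)
        = ennreal (r powr (b - s * p)) * indicator {..1} r"
        using AE_haar_pos
      proof eventually_elim
        case (elim r)
        have "r powr (b + real DIM(real^'n)) * r powr ?a = r powr (b - s * p)"
          by (simp add: powr_add[symmetric])
        then show ?case by (simp add: mult.assoc[symmetric] ennreal_mult[symmetric])
      qed
    qed
    also have "\<dots> < \<infinity>" using b by (intro nn_integral_haar_powr_atMost) auto
    finally show "(\<integral>\<^sup>+r. ennreal (r powr (b + real DIM(real^'n))) * (ennreal (r powr ?a) * indicator {..1} r) \<partial>haar) < \<infinity>" .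
  qed auto
  then have fin: "(\<integral>\<^sup>+z. ennreal (C1 * \<bar>K\<bar>) * (ennreal (Q z) * (ennreal (norm z powr ?a) * indicator {..1} (norm z))) \<partial>lborel) < \<infinity>"
    by (subst nn_integral_cmult) (auto simp: ennreal_mult_less_top)
  have near: "integrable lborel (\<lambda>z. if norm z \<le> 1 then H z else 0)"
  proof (rule integrableI_bounded)
    have "(\<integral>\<^sup>+z. ennreal (norm (if norm z \<le> 1 then H z else 0)) \<partial>lborel)
      \<le> (\<integral>\<^sup>+z. ennreal (C1 * \<bar>K\<bar>) * (ennreal (Q z) * (ennreal (norm z powr ?a) * indicator {..1} (norm z))) \<partial>lborel)"
    proof (rule nn_integral_mono_AE)
      show "AE z in lborel. ennreal (norm (if norm z \<le> 1 then H z else 0))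
        \<le> ennreal (C1 * \<bar>K\<bar>) * (ennreal (Q z) * (ennreal (norm z powr ?a) * indicator {..1} (norm z)))"
        using bound
      proof eventually_elim
        case (elim z)
        have "\<bar>H z\<bar> \<le> C1 * \<bar>K\<bar> * (Q z * norm z powr ?a)" if "norm z \<le> 1"
        proof -
          have "\<bar>sym_incr z\<bar> \<le> \<bar>K\<bar> * Q z"
            using elim that mult_right_mono[OF abs_ge_self[of K] Q0[of z]] by linarith
          then have "C1 * (\<bar>sym_incr z\<bar> * norm z powr ?a) \<le> C1 * (\<bar>K\<bar> * Q z * norm z powr ?a)"
            using C1 by (intro mult_left_mono mult_right_mono) auto
          then show ?thesis using C1 by (simp add: H_def abs_mult mult.assoc)
        qed
        then show ?case
          using C1 Q0[of z] by (auto simp: ennreal_mult[symmetric] intro!: ennreal_leI)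
      qed
    qed
    then show "(\<integral>\<^sup>+z. ennreal (norm (if norm z \<le> 1 then H z else 0)) \<partial>lborel) < \<infinity>"
      using fin by (rule le_less_trans)
  qed measurable
  have "integrable lborel (\<lambda>z. (if norm z \<le> 1 then H z else 0) + (if 1 < norm z then H z else 0))"
    using near H_tail[of 1] by simp
  moreover have "(\<lambda>z. (if norm z \<le> 1 then H z else 0) + (if 1 < norm z then H z else 0)) = H"
    by auto
  ultimately show ?thesis by simp
qed

lemma integrable_H_powr:
  assumes b: "s * p < b" and bound: "\<And>z. norm z \<le> 1 \<Longrightarrow> \<bar>sym_incr z\<bar> \<le> K * norm z powr b"
  shows "integrable lborel H"
proof (rule integrable_H[where Q="\<lambda>z. norm z powr b" and K=K])
  have "0 < b" using b sp_pos by linarith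
  have "(\<integral>\<^sup>+w. ennreal (norm w powr b) * indicator {1<..<2} (norm w) \<partial>(lborel :: (real^'n) measure))
     \<le> (\<integral>\<^sup>+w. ennreal (2 powr b) * indicator {1<..<2} (norm w) \<partial>(lborel :: (real^'n) measure))"
    using \<open>0 < b\<close> by (intro nn_integral_mono) (auto split: split_indicator intro!: ennreal_leI powr_mono2)
  also have "\<dots> = ennreal (2 powr b) * (\<integral>\<^sup>+w. indicator {1<..<2} (norm w) \<partial>(lborel :: (real^'n) measure))"
    by (rule nn_integral_cmult) measurable
  also have "\<dots> < \<infinity>" using shell_finite[where 'a="real^'n"] by (simp add: ennreal_mult_less_top)
  finally show "(\<integral>\<^sup>+w. ennreal (norm w powr b) * indicator {1<..<2} (norm w) \<partial>(lborel :: (real^'n) measure)) < \<infinity>" .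
  show "AE z in lborel. norm z \<le> 1 \<longrightarrow> \<bar>sym_incr z\<bar> \<le> K * norm z powr b"
    using bound by simp
qed (use b in \<open>auto simp: powr_mult\<close>)

text \<open>The majorant has degree (p - 2) + 2 = p, which exceeds s p. Its shell integral is finite
  because p - 2 > -1, and the hyperplane orthogonal to the gradient, on which no bound is available,
  is null.\<close>

lemma integrable_H_gradient:
  assumes p2: "p < 2" and e: "e \<noteq> 0"
  shows "integrable lborel H"
proof -
  obtain K where K: "\<And>z. e \<bullet> z \<noteq> 0 \<Longrightarrow> \<bar>sym_incr z\<bar> \<le> K * (\<bar>e \<bullet> z\<bar> powr (p - 2) * (norm z)\<^sup>2)"
    using sym_incr_bound_gradient[OF p2] by blast
  have [measurable]: "ball 0 2 \<in> sets (borel :: (real^'n) measure)" by simp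
  show ?thesis
  proof (rule integrable_H[where Q="\<lambda>z. \<bar>e \<bullet> z\<bar> powr (p - 2) * (norm z)\<^sup>2" and K=K and b=p])
    show "\<bar>e \<bullet> (l *\<^sub>R z)\<bar> powr (p - 2) * (norm (l *\<^sub>R z))\<^sup>2 = l powr p * (\<bar>e \<bullet> z\<bar> powr (p - 2) * (norm z)\<^sup>2)"
      if "0 < l" for l z
    proof -
      have "l powr (p - 2) * l\<^sup>2 = l powr p" using that powr_add[of l "p - 2" 2] by simp
      then show ?thesis using that by (simp add: abs_mult powr_mult power_mult_distrib mult_ac)
    qed
    show "s * p < p" using s p by simp
    have "(\<integral>\<^sup>+w. ennreal (\<bar>e \<bullet> w\<bar> powr (p - 2) * (norm w)\<^sup>2) * indicator {1<..<2} (norm w) \<partial>lborel)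
      \<le> (\<integral>\<^sup>+w. ennreal 4 * (ennreal (\<bar>e \<bullet> w\<bar> powr (p - 2)) * indicator (ball 0 2) w) \<partial>lborel)"
    proof (intro nn_integral_mono)
      fix w :: "real^'n"
      have "\<bar>e \<bullet> w\<bar> powr (p - 2) * (norm w)\<^sup>2 \<le> 4 * \<bar>e \<bullet> w\<bar> powr (p - 2)" if "norm w < 2"
      proof -
        have "(norm w)\<^sup>2 \<le> 2\<^sup>2" using that by (intro power_mono) auto
        then have "\<bar>e \<bullet> w\<bar> powr (p - 2) * (norm w)\<^sup>2 \<le> \<bar>e \<bullet> w\<bar> powr (p - 2) * 4"
          by (intro mult_left_mono) auto
        then show ?thesis by simp
      qed
      then have "norm w < 2 \<Longrightarrow> ennreal (\<bar>e \<bullet> w\<bar> powr (p - 2) * (norm w)\<^sup>2) \<le> ennreal 4 * ennreal (\<bar>e \<bullet> w\<bar> powr (p - 2))"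
        by (subst ennreal_mult[symmetric]) (auto intro!: ennreal_leI)
      then show "ennreal (\<bar>e \<bullet> w\<bar> powr (p - 2) * (norm w)\<^sup>2) * indicator {1<..<2} (norm w)
        \<le> ennreal 4 * (ennreal (\<bar>e \<bullet> w\<bar> powr (p - 2)) * indicator (ball 0 2) w)"
        by (auto split: split_indicator)
    qed
    also have "\<dots> = ennreal 4 * (\<integral>\<^sup>+w. ennreal (\<bar>e \<bullet> w\<bar> powr (p - 2)) * indicator (ball 0 2) w \<partial>lborel)"
      by (rule nn_integral_cmult) measurable
    also have "\<dots> < \<infinity>"
      using nn_integral_linear_form_powr_finite[of "p - 2" e] p e by (simp add: ennreal_mult_less_top)
    finally show "(\<integral>\<^sup>+w. ennreal (\<bar>e \<bullet> w\<bar> powr (p - 2) * (norm w)\<^sup>2) * indicator {1<..<2} (norm w) \<partial>lborel) < \<infinity>" .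
    have "{z. e \<bullet> z = 0} \<in> null_sets lebesgue"
      using negligible_hyperplane[of e 0] e by (simp add: negligible_iff_null_sets)
    then have "{z. e \<bullet> z = 0} \<in> null_sets lborel"
      by (subst (asm) null_sets_completion_iff) measurable
    then have "AE z in lborel. e \<bullet> z \<noteq> 0"
      by (rule AE_I') auto
    then show "AE z in lborel. norm z \<le> 1 \<longrightarrow> \<bar>sym_incr z\<bar> \<le> K * (\<bar>e \<bullet> z\<bar> powr (p - 2) * (norm z)\<^sup>2)"
      by eventually_elim (use K in auto)
  qed auto
qed

text \<open>Three sources of convergence: p >= 2; p < 2 with nonzero gradient; p < 2 with zero
  gradient, where the hypotheses leave only p > 2 / (2 - s), that is s p < 2 (p - 1).\<close>

lemma integrable_H_noncritical:
  assumes "p \<noteq> 2 / (2 - s) \<or> e \<noteq> 0" and "p < 2 / (2 - s) \<Longrightarrow> e \<noteq> 0"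
  shows "integrable lborel H"
proof (cases "p < 2")
  case True
  show ?thesis
  proof (cases "e = 0")
    case False
    then show ?thesis using integrable_H_gradient True by blast
  next
    case True
    then have "2 / (2 - s) < p" using assms by force
    then have "s * p < 2 * (p - 1)" using s by (simp add: field_simps)
    then show ?thesis
      using sym_incr_bound_less_2[OF \<open>p < 2\<close>] integrable_H_powr by metis
  qed
next
  case False
  have "s * p < p" using s p by simp
  then show ?thesis
    using sym_incr_bound_ge_2 False integrable_H_powr by (metis not_less)
qed

section \<open>The critical exponent at a critical point\<close>

text \<open>With zero gradient the increment is asymptotically the quadratic form of -1/2 times the
  Hessian at x0. The limit is even, so symmetrising does not cancel it.\<close>

lemma incr_blowup:
  assumes e: "e = 0"
  obtains q :: "real^'n \<Rightarrow> real" where "q \<in> borel_measurable borel" "\<And>w. q (- w) = q w"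
    "\<And>w. ((\<lambda>r. r\<^sup>2 * incr ((1 / r) *\<^sub>R w)) \<longlongrightarrow> q w) at_top"
proof -
  obtain A :: "real^'n \<Rightarrow> real^'n^'n" where cA: "continuous_on UNIV A"
    and T: "\<And>z. \<exists>\<xi>. 0 \<le> \<xi> \<and> \<xi> \<le> 1 \<and> incr z = e \<bullet> z - z \<bullet> (A (x0 - \<xi> *\<^sub>R z) *v z) / 2"
    using incr_Taylor by metis
  then obtain \<xi> where \<xi>: "\<And>z. 0 \<le> \<xi> z" "\<And>z. \<xi> z \<le> 1"
    "\<And>z. incr z = - (z \<bullet> (A (x0 - \<xi> z *\<^sub>R z) *v z) / 2)"
    using e by (simp, metis)
  define q where "q w = - (w \<bullet> (A x0 *v w) / 2)" for w
  have "continuous_on UNIV q"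
    unfolding q_def[abs_def] by (intro continuous_intros linear_continuous_on matrix_vector_mul_bounded_linear) auto
  then have 1: "q \<in> borel_measurable borel" by (rule borel_measurable_continuous_onI)
  have neg: "M *v (- w) = - (M *v w)" for M :: "real^'n^'n" and w
    using matrix_vector_mult_scaleR[of M "-1" w] by simp
  have 2: "q (- w) = q w" for w by (simp add: q_def neg)
  have 3: "((\<lambda>r. r\<^sup>2 * incr ((1 / r) *\<^sub>R w)) \<longlongrightarrow> q w) at_top" for w
  proof -
    \<comment> \<open>The intermediate point of the Taylor formula at scale 1 / r; its distance to
      x0 is at most |w| / r.\<close>
    define y where "y r = x0 - \<xi> ((1 / r) *\<^sub>R w) *\<^sub>R ((1 / r) *\<^sub>R w)" for r :: real
    have inv: "((\<lambda>r::real. 1 / r) \<longlongrightarrow> 0) at_top"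
      by (rule tendsto_divide_0[OF tendsto_const]) (simp add: filterlim_at_top_imp_at_infinity filterlim_ident)
    have "((\<lambda>r. y r - x0) \<longlongrightarrow> 0) at_top"
    proof (rule Lim_null_comparison)
      show "\<forall>\<^sub>F r in at_top. norm (y r - x0) \<le> 1 / r * norm w"
        using eventually_gt_at_top[of 0]
      proof eventually_elim
        case (elim r)
        have "norm (y r - x0) = \<xi> ((1 / r) *\<^sub>R w) * (1 / r * norm w)"
          using elim \<xi>(1)[of "(1 / r) *\<^sub>R w"] by (simp add: y_def)
        also have "\<dots> \<le> 1 * (1 / r * norm w)"
          using elim by (intro mult_right_mono \<xi>) auto
        finally show ?case by simp
      qed
      show "((\<lambda>r. 1 / r * norm w) \<longlongrightarrow> 0) at_top"
        using tendsto_mult_left_zero[OF inv] by simp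
    qed
    then have "(y \<longlongrightarrow> x0) at_top" by (simp add: Lim_null[of y])
    moreover have "isCont A x0" using cA by (simp add: continuous_on_eq_continuous_at)
    ultimately have "((\<lambda>r. A (y r)) \<longlongrightarrow> A x0) at_top" by (rule isCont_tendsto_compose[rotated])
    then have An: "((\<lambda>r. norm (A (y r) - A x0)) \<longlongrightarrow> 0) at_top"
      by (simp add: tendsto_norm_zero LIM_zero)
    have "((\<lambda>r. w \<bullet> (A (y r) *v w) - w \<bullet> (A x0 *v w)) \<longlongrightarrow> 0) at_top"
    proof (rule Lim_null_comparison)
      show "\<forall>\<^sub>F r in at_top. norm (w \<bullet> (A (y r) *v w) - w \<bullet> (A x0 *v w))
          \<le> CARD('n) * norm (A (y r) - A x0) * (norm w)\<^sup>2"
        using abs_inner_matrix_le[of w]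
        by (simp add: inner_diff_right[symmetric] matrix_vector_mult_diff_rdistrib[symmetric])
      show "((\<lambda>r. CARD('n) * norm (A (y r) - A x0) * (norm w)\<^sup>2) \<longlongrightarrow> 0) at_top"
        using tendsto_mult_left_zero[OF tendsto_mult_right_zero[OF An]] by simp
    qed
    then have "((\<lambda>r. w \<bullet> (A (y r) *v w)) \<longlongrightarrow> w \<bullet> (A x0 *v w)) at_top"
      by (rule LIM_zero_cancel)
    then have "((\<lambda>r. - (w \<bullet> (A (y r) *v w) / 2)) \<longlongrightarrow> q w) at_top"
      unfolding q_def by (rule tendsto_minus[OF tendsto_divide[OF _ tendsto_const]]) simp
    then show ?thesis
    proof (rule Lim_transform_eventually)
      show "\<forall>\<^sub>F r in at_top. - (w \<bullet> (A (y r) *v w) / 2) = r\<^sup>2 * incr ((1 / r) *\<^sub>R w)"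
        using eventually_gt_at_top[of 0]
        by eventually_elim
           (simp add: \<xi>(3) y_def matrix_vector_mult_scaleR power2_eq_square)
    qed
  qed
  show thesis using that 1 2 3 by blast
qed

lemma critical_exponent:
  assumes "p = 2 / (2 - s)"
  shows "p < 2" "s * p = 2 * (p - 1)"
proof -
  have "2 / (2 - s) < 2" using s by (simp add: divide_less_eq)
  then show "p < 2" using assms by simp
  show "s * p = 2 * (p - 1)" using assms s by (simp add: field_simps)
qed

lemma critical_case:
  assumes crit: "p = 2 / (2 - s)" and e: "e = 0"
  shows "((\<lambda>d. ereal (frac_p_laplacian_trunc C1 s p u x0 d)) \<longlongrightarrow> L) (at_right 0) \<longleftrightarrow>
     ((\<lambda>T. ereal (C4 C1 CARD('n) s p * (LINT t:{0<..T}|lborel. balakrishnan_integrand s p u x0 t))) \<longlongrightarrow> L) at_top"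
proof -
  note sp = critical_exponent[OF crit]
  \<comment> \<open>At the critical exponent the degree 2 (p - 1) of the Hoelder bound equals s p,
    so after weighting exactly |z|^(-n) remains.\<close>
  obtain K where K: "\<And>z. \<bar>sym_incr z\<bar> \<le> K * norm z powr (s * p)"
    using sym_incr_bound_less_2[OF sp(1)] sp(2) by auto
  interpret critical_density \<kappa> "s * p" H "C1 * K"
  proof
    show "H \<in> borel_measurable borel" by measurable
    show "\<bar>H z\<bar> \<le> C1 * K * norm z powr (- real DIM(real^'n))" for z
    proof (cases "z = 0")
      case False
      have "\<bar>H z\<bar> = C1 * (\<bar>sym_incr z\<bar> * norm z powr (- (real CARD('n) + s * p)))"
        using C1 by (simp add: H_def abs_mult)
      also have "\<dots> \<le> C1 * (K * norm z powr (s * p) * norm z powr (- (real CARD('n) + s * p)))"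
        using C1 by (intro mult_left_mono mult_right_mono K) auto
      also have "\<dots> = C1 * K * (norm z powr (s * p) * norm z powr (- (real CARD('n) + s * p)))"
        by simp
      also have "norm z powr (s * p) * norm z powr (- (real CARD('n) + s * p)) = norm z powr (- real DIM(real^'n))"
        by (simp add: powr_add[symmetric])
      finally show ?thesis .
    qed (simp add: H_def)
    show "integrable lborel (\<lambda>z. if d < norm z then H z else 0)" if "0 < d" for d
      by (rule H_tail[OF that])
  qed
  obtain q where q: "q \<in> borel_measurable borel" "\<And>w. q (- w) = q w"
    "\<And>w. ((\<lambda>r. r\<^sup>2 * incr ((1 / r) *\<^sub>R w)) \<longlongrightarrow> q w) at_top"
    by (rule incr_blowup[OF e], rule that)
  note [measurable] = q(1)
  \<comment> \<open>The blow-up of H at the origin. Phi of the quadratic limit q has degree s p, so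
    the total degree is -n, which the factor (1 / r)^n below compensates.\<close>
  let ?h = "\<lambda>w. C1 * (Phi p (q w) * norm w powr (- (real CARD('n) + s * p)))"
  have lim: "((\<lambda>r. H ((1 / r) *\<^sub>R w) * (1 / r) ^ DIM(real^'n)) \<longlongrightarrow> ?h w) at_top" if w: "w \<noteq> 0" for w
  proof -
    have P: "((\<lambda>r. Phi p (r\<^sup>2 * incr ((1 / r) *\<^sub>R v))) \<longlongrightarrow> Phi p (q v)) at_top" for v
      by (rule isCont_tendsto_compose[OF isCont_Phi[OF p] q(3)])
    have "((\<lambda>r. (Phi p (r\<^sup>2 * incr ((1 / r) *\<^sub>R w)) + Phi p (r\<^sup>2 * incr ((1 / r) *\<^sub>R (- w)))) / 2)
        \<longlongrightarrow> (Phi p (q w) + Phi p (q (- w))) / 2) at_top"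
      by (intro tendsto_divide tendsto_add P tendsto_const) simp
    then have S: "((\<lambda>r. (Phi p (r\<^sup>2 * incr ((1 / r) *\<^sub>R w)) + Phi p (r\<^sup>2 * incr ((1 / r) *\<^sub>R (- w)))) / 2)
        \<longlongrightarrow> Phi p (q w)) at_top"
      by (simp add: q(2))
    have "((\<lambda>r. C1 * ((Phi p (r\<^sup>2 * incr ((1 / r) *\<^sub>R w)) + Phi p (r\<^sup>2 * incr ((1 / r) *\<^sub>R (- w)))) / 2
         * norm w powr (- (real CARD('n) + s * p)))) \<longlongrightarrow> ?h w) at_top"
      by (intro tendsto_mult tendsto_const S)
    then show ?thesis
    proof (rule Lim_transform_eventually)
      show "\<forall>\<^sub>F r in at_top. C1 * ((Phi p (r\<^sup>2 * incr ((1 / r) *\<^sub>R w)) + Phi p (r\<^sup>2 * incr ((1 / r) *\<^sub>R (- w)))) / 2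
         * norm w powr (- (real CARD('n) + s * p))) = H ((1 / r) *\<^sub>R w) * (1 / r) ^ DIM(real^'n)"
        using eventually_gt_at_top[of 0]
      proof eventually_elim
        case (elim r)
        have r2: "r\<^sup>2 powr (p - 1) = r powr (s * p)"
          using elim sp(2) by (simp add: powr_powr flip: powr_numeral)
        have "(Phi p (r\<^sup>2 * incr ((1 / r) *\<^sub>R w)) + Phi p (r\<^sup>2 * incr ((1 / r) *\<^sub>R (- w)))) / 2
           = r powr (s * p) * sym_incr ((1 / r) *\<^sub>R w)"
          using elim by (simp add: Phi_mult r2 sym_incr_def distrib_left)
        moreover have "norm ((1 / r) *\<^sub>R w) powr (- (real CARD('n) + s * p)) * (1 / r) ^ DIM(real^'n)
           = r powr (s * p) * norm w powr (- (real CARD('n) + s * p))"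
        proof -
          have "norm ((1 / r) *\<^sub>R w) = norm w / r" using elim by simp
          then have "norm ((1 / r) *\<^sub>R w) powr (- (real CARD('n) + s * p))
             = norm w powr (- (real CARD('n) + s * p)) * r powr (real CARD('n) + s * p)"
            using elim powr_minus_divide[of r "real CARD('n) + s * p"] by (simp add: powr_divide)
          moreover have "r powr (real CARD('n) + s * p) * (1 / r) ^ DIM(real^'n) = r powr (s * p)"
            using elim by (simp add: powr_add powr_realpow power_divide)
          then have "norm w powr (- (real CARD('n) + s * p)) * (r powr (real CARD('n) + s * p) * (1 / r) ^ DIM(real^'n))
            = norm w powr (- (real CARD('n) + s * p)) * r powr (s * p)"
            by (simp only:)
          ultimately show ?thesis by (simp only: mult_ac)
        qed
        ultimately show ?case by (simp add: H_def mult_ac)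
      qed
    qed
  qed
  have "((\<lambda>d. ereal (frac_p_laplacian_trunc C1 s p u x0 d)) \<longlongrightarrow> L) (at_right 0)
     \<longleftrightarrow> ((\<lambda>d. ereal (truncated d)) \<longlongrightarrow> L) (at_right 0)"
    by (intro tendsto_cong)
       (use eventually_at_right_less[of 0] in eventually_elim, simp add: frac_p_laplacian_trunc_eq truncated_def)
  also have "\<dots> \<longleftrightarrow> ((\<lambda>r. ereal (averaged r)) \<longlongrightarrow> L) at_top"
    by (rule averaged_iff_truncated[OF lim]) measurable
  \<comment> \<open>The truncation of the t-integral at T corresponds to r = sqrt T, and both r and
    T run to infinity.\<close>
  also have "\<dots> \<longleftrightarrow> ((\<lambda>T. ereal (averaged (sqrt T))) \<longlongrightarrow> L) at_top"
  proof
    assume "((\<lambda>r. ereal (averaged r)) \<longlongrightarrow> L) at_top"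
    then show "((\<lambda>T. ereal (averaged (sqrt T))) \<longlongrightarrow> L) at_top"
      by (rule filterlim_compose[OF _ sqrt_at_top])
  next
    assume *: "((\<lambda>T. ereal (averaged (sqrt T))) \<longlongrightarrow> L) at_top"
    have "((\<lambda>r::real. ereal (averaged (sqrt (r\<^sup>2)))) \<longlongrightarrow> L) at_top"
      by (rule filterlim_compose[OF *]) (simp add: filterlim_pow_at_top filterlim_ident)
    then show "((\<lambda>r. ereal (averaged r)) \<longlongrightarrow> L) at_top"
      by (rule Lim_transform_eventually)
         (use eventually_gt_at_top[of 0] in eventually_elim, simp)
  qed
  also have "\<dots> \<longleftrightarrow> ((\<lambda>T. ereal (C4 C1 CARD('n) s p * (LINT t:{0<..T}|lborel. balakrishnan_integrand s p u x0 t))) \<longlongrightarrow> L) at_top"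
  proof (intro tendsto_cong)
    show "\<forall>\<^sub>F T in at_top. ereal (averaged (sqrt T))
      = ereal (C4 C1 CARD('n) s p * (LINT t:{0<..T}|lborel. balakrishnan_integrand s p u x0 t))"
      using eventually_gt_at_top[of 0]
    proof eventually_elim
      case (elim T)
      have "averaged (sqrt T) = (\<integral>r. (if r < sqrt T then J r else 0) \<partial>haar)"
        unfolding J_def using averaged_eq_partial(2)[of "sqrt T"] elim by simp
      then show ?case using C4_balakrishnan_partial[OF elim] by simp
    qed
  qed
  finally show ?thesis .
qed

end

text \<open>In the absolutely convergent case both sides have the same finite limit; uniqueness then
  settles the equivalence for every extended real L.\<close>

lemma tendsto_iff_of_common_limit:
  fixes f :: "'a \<Rightarrow> 'c::t2_space" and g :: "'b \<Rightarrow> 'c"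
  assumes "(f \<longlongrightarrow> l) F" "(g \<longlongrightarrow> l) G" "F \<noteq> bot" "G \<noteq> bot"
  shows "(f \<longlongrightarrow> L) F \<longleftrightarrow> (g \<longlongrightarrow> L) G"
  using assms tendsto_unique by metis

theorem theorem4p1:
  fixes u :: "real^'n \<Rightarrow> real" and x0 :: "real^'n" and s p C1 :: real
  assumes "0 < s" and "s < 1" and "1 < p"
    and "0 < C1"
    and "u \<in> C2b"
    and "p < 2 / (2 - s) \<Longrightarrow> gradient u x0 \<noteq> 0"
  shows
    "(p \<noteq> 2 / (2 - s) \<or> gradient u x0 \<noteq> 0 \<longrightarrow>
        (\<exists>L::real. (frac_p_laplacian_trunc C1 s p u x0 \<longlongrightarrow> L) (at_right 0)) \<and>
        set_integrable lborel {0<..} (balakrishnan_integrand s p u x0) \<and>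
        frac_p_laplacian C1 s p u x0
          = C4 C1 CARD('n) s p * (LINT t:{0<..}|lborel. balakrishnan_integrand s p u x0 t)) \<and>
     (\<forall>L::ereal.
        ((\<lambda>\<epsilon>. ereal (frac_p_laplacian_trunc C1 s p u x0 \<epsilon>)) \<longlongrightarrow> L) (at_right 0) \<longleftrightarrow>
        ((\<lambda>T. ereal (C4 C1 CARD('n) s p
                 * (LINT t:{0<..T}|lborel. balakrishnan_integrand s p u x0 t))) \<longlongrightarrow> L) at_top)"
  (* The second conjunct is the same identity read with improper integrals in the extended reals;
     it is needed for p = 2 / (2 - s) and vanishing gradient, where both sides can be infinite. *)
proof -
  interpret frac_p_setting u x0 s p C1
    by unfold_locales (use assms in auto)
  show ?thesis
  proof (cases "p \<noteq> 2 / (2 - s) \<or> gradient u x0 \<noteq> 0")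
    case True
    note lim = absolutely_convergent_case[OF integrable_H_noncritical[OF True assms(6)]]
    \<comment> \<open>\<open>Lim\<close> carries information only once convergence is known; the
      limit of the truncations identifies it.\<close>
    have "frac_p_laplacian C1 s p u x0 = (\<integral>z. H z \<partial>lborel)"
      unfolding frac_p_laplacian_def by (rule tendsto_Lim[OF _ lim(1)]) simp
    moreover have "((\<lambda>d. ereal (frac_p_laplacian_trunc C1 s p u x0 d)) \<longlongrightarrow> L) (at_right 0) \<longleftrightarrow>
        ((\<lambda>T. ereal (C4 C1 CARD('n) s p
           * (LINT t:{0<..T}|lborel. balakrishnan_integrand s p u x0 t))) \<longlongrightarrow> L) at_top" for L
      using lim(1,4) by (intro tendsto_iff_of_common_limit[where l="ereal (\<integral>z. H z \<partial>lborel)"]) auto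
    ultimately show ?thesis using lim(1-3) by auto
  next
    case False
    then show ?thesis using critical_case by simp
  qed
qed

end
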